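(* Let $X$ be a proper geodesic Gromov hyperbolic space, let $\Gamma$ be a non-elementary group acting properly and cocompactly by isometries on $X$, and let $\mu_o$ be the (unique class of) Patterson–Sullivan probability measure on the Gromov boundary $\partial X$. Let $H<\Gamma$ be a subgroup. Then the following are equivalent: the small horospheric limit set $\Lambda^{\mathrm{hor}}(Ho)$ is $\mu_o$-full; the big horospheric limit set $\Lambda^{\mathrm{Hor}}(Ho)$ is $\mu_o$-full; $X/H$ grows slower than $X$. Moreover, $\mu_o(\Lambda^{\mathrm{hor}}(Ho))<1$ is equivalent to $$\sharp\{Hgo:\ \bar d(Ho,Hgo)\le n,\ g\in\Gamma\}\asymp e^{\omega_\Gamma n}.$$
   Context: Fix $o\in X$. A group is elementary if finite or virtually $\mathbb Z$. $\omega_\Gamma=\limsup_n\frac1n\log\sharp\{go:g\in\Gamma,d(o,go)\le n\}$. $X/H=\{Hx:x\in X\}$ carries $\bar d(Hx,Hy)=\inf_{h\in H}d(x,hy)$; $\pi:X\to X/H$ is the projection. $\asymp$ denotes equality up to a multiplicative constant independent of $n$. Patterson–Sullivan measure: weak limit on $X\cup\partial X$ along $s_i\searrow\omega_\Gamma$ of $\frac{1}{\mathcal P(s)}\sum_{g\in\Gamma}e^{-sd(o,go)}\delta_{go}$, $\mathcal P(s)=\sum_{g\in\Gamma}e^{-sd(o,go)}$. Horospheric limit points: for $\xi\in\partial X$ put $B_\xi(x,y)=\limsup_{z\to\xi}(d(x,z)-d(y,z))$ and $\mathcal{HB}(\xi,L)=\{y\in X:B_\xi(y,o)\le L\}$.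 A limit point $\xi$ of $Ho$ is a big (resp. small) horospheric limit point if for some (resp. every) $L\in\mathbb R$ the horoball $\mathcal{HB}(\xi,L)$ contains infinitely many points $h_no\in Ho$ with $h_no\to\xi$. $\Lambda^{\mathrm{Hor}}(Ho)$ (resp. $\Lambda^{\mathrm{hor}}(Ho)$) is the set of big (resp. small) horospheric limit points. A set is $\mu_o$-full if its complement is $\mu_o$-null. $X/H$ grows slower than $X$ if, given maximal $R$-separated subsets $Z\subseteq X$ and $W\subseteq X/H$ for some $R>0$, $\frac{\sharp(W\cap \bar B(\pi(o),n))}{\sharp(Z\cap B(o,n))}\to0$ as $n\to\infty$, where $B$ and $\bar B$ are the balls for $d$ and $\bar d$ (independent of the choices of $Z,W,R$). *)

theory Defs
  imports
    "HOL-Probability.Probability"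
    "HOL-Algebra.Group_Action"
    "HOL-Algebra.Elementary_Groups"
begin

section \<open>Proper geodesic hyperbolic spaces\<close>

text \<open>The space \<open>X\<close> is a type \<open>'a\<close> of class \<open>metric_space\<close>; \<open>p\<close> is the base point.\<close>

definition proper_metric :: "'a::metric_space itself \<Rightarrow> bool" where
  "proper_metric _ \<longleftrightarrow> (\<forall>(x::'a) r. compact (cball x r))"

definition geodesic_metric :: "'a::metric_space itself \<Rightarrow> bool" where
  "geodesic_metric _ \<longleftrightarrow>
     (\<forall>x y::'a. \<exists>c::real \<Rightarrow> 'a. c 0 = x \<and> c (dist x y) = y \<and>
        (\<forall>s\<in>{0..dist x y}. \<forall>t\<in>{0..dist x y}. dist (c s) (c t) = \<bar>s - t\<bar>))"

definition gromov_product :: "'a::metric_space \<Rightarrow> 'a \<Rightarrow> 'a \<Rightarrow> real" where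
  "gromov_product p x y = (dist p x + dist p y - dist x y) / 2"

definition gromov_hyperbolic :: "'a::metric_space itself \<Rightarrow> bool" where
  "gromov_hyperbolic _ \<longleftrightarrow>
     (\<exists>\<delta>. \<forall>p x y z::'a.
        gromov_product p x z \<ge> min (gromov_product p x y) (gromov_product p y z) - \<delta>)"

section \<open>The Gromov boundary and the compactification\<close>

definition converges_to_infinity :: "'a::metric_space \<Rightarrow> (nat \<Rightarrow> 'a) \<Rightarrow> bool" where
  "converges_to_infinity p u \<longleftrightarrow>
     filterlim (\<lambda>(i, j). gromov_product p (u i) (u j)) at_top (sequentially \<times>\<^sub>F sequentially)"

definition boundary_rel :: "'a::metric_space \<Rightarrow> ((nat \<Rightarrow> 'a) \<times> (nat \<Rightarrow> 'a)) set" where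
  "boundary_rel p = {(u, v). converges_to_infinity p u \<and> converges_to_infinity p v \<and>
     filterlim (\<lambda>i. gromov_product p (u i) (v i)) at_top sequentially}"

text \<open>\<open>Inl\<close> injects the points of \<open>X\<close>; a boundary point is \<open>Inr\<close> of an equivalence class of
  sequences. Up to equality neither the boundary nor the topology below depends on \<open>p\<close>.\<close>

type_synonym 'a bordif = "'a + (nat \<Rightarrow> 'a) set"

definition gromov_boundary :: "'a::metric_space \<Rightarrow> 'a bordif set" where
  "gromov_boundary p = Inr ` ({u. converges_to_infinity p u} // boundary_rel p)"

definition bordification :: "'a::metric_space \<Rightarrow> 'a bordif set" where
  "bordification p = range Inl \<union> gromov_boundary p"

fun representatives :: "'a bordif \<Rightarrow> (nat \<Rightarrow> 'a) set" where
  "representatives (Inl x) = {\<lambda>_. x}"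
| "representatives (Inr \<xi>) = \<xi>"

definition ext_gromov_product :: "'a::metric_space \<Rightarrow> 'a bordif \<Rightarrow> 'a bordif \<Rightarrow> ereal" where
  "ext_gromov_product p \<xi> \<eta> =
     (SUP u\<in>representatives \<xi>. SUP v\<in>representatives \<eta>.
        Liminf (sequentially \<times>\<^sub>F sequentially) (\<lambda>(i, j). ereal (gromov_product p (u i) (v j))))"

text \<open>The topology on \<open>X \<union> \<partial>X\<close>: \<open>X\<close> is open with its metric topology, and the sets
  \<open>{\<eta>. (\<xi>|\<eta>)\<^sub>p > R}\<close> form a basis of (not necessarily open) neighbourhoods of a boundary
  point \<open>\<xi>\<close>.\<close>

definition bordif_topology :: "'a::metric_space \<Rightarrow> 'a bordif topology" where
  "bordif_topology p = topology (\<lambda>U. U \<subseteq> bordification p \<and> open (Inl -` U) \<and>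
     (\<forall>\<xi>\<in>U \<inter> gromov_boundary p. \<exists>R. {\<eta>\<in>bordification p. ext_gromov_product p \<xi> \<eta> > ereal R} \<subseteq> U))"

lemma openin_bordif_topology:
  "openin (bordif_topology p) U \<longleftrightarrow> U \<subseteq> bordification p \<and> open (Inl -` U) \<and>
     (\<forall>\<xi>\<in>U \<inter> gromov_boundary p. \<exists>R. {\<eta>\<in>bordification p. ext_gromov_product p \<xi> \<eta> > ereal R} \<subseteq> U)"
proof -
  define N where "N \<xi> R = {\<eta>\<in>bordification p. ext_gromov_product p \<xi> \<eta> > ereal R}" for \<xi> R
  define P where "P U \<longleftrightarrow> (\<forall>\<xi>\<in>U \<inter> gromov_boundary p. \<exists>R. N \<xi> R \<subseteq> U)" for U
  have anti: "N \<xi> R' \<subseteq> N \<xi> R" if "R \<le> R'" for \<xi> R R'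
    unfolding N_def using that by (auto intro: le_less_trans[of "ereal R" "ereal R'"])
  have inter: "P (S \<inter> T)" if S: "P S" and T: "P T" for S T
    unfolding P_def
  proof
    fix \<xi> assume \<xi>: "\<xi> \<in> S \<inter> T \<inter> gromov_boundary p"
    obtain R1 where R1: "N \<xi> R1 \<subseteq> S" using S \<xi> unfolding P_def by blast
    obtain R2 where R2: "N \<xi> R2 \<subseteq> T" using T \<xi> unfolding P_def by blast
    have "N \<xi> (max R1 R2) \<subseteq> S" "N \<xi> (max R1 R2) \<subseteq> T"
      using anti[of R1 "max R1 R2" \<xi>] anti[of R2 "max R1 R2" \<xi>] R1 R2 by simp_all
    then show "\<exists>R. N \<xi> R \<subseteq> S \<inter> T" by (intro exI[of _ "max R1 R2"]) simp
  qed
  have union: "P (\<Union>K)" if K: "\<And>S. S \<in> K \<Longrightarrow> P S" for K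
    unfolding P_def
  proof
    fix \<xi> assume "\<xi> \<in> \<Union>K \<inter> gromov_boundary p"
    then obtain S where S: "S \<in> K" "\<xi> \<in> S \<inter> gromov_boundary p" by blast
    then obtain R where "N \<xi> R \<subseteq> S" using K[of S] unfolding P_def by blast
    with S(1) show "\<exists>R. N \<xi> R \<subseteq> \<Union>K" by blast
  qed
  have "istopology (\<lambda>U. U \<subseteq> bordification p \<and> open (Inl -` U) \<and> P U)"
    unfolding istopology_def
  proof (intro conjI allI impI)
    fix S T
    assume "S \<subseteq> bordification p \<and> open (Inl -` S) \<and> P S"
      and "T \<subseteq> bordification p \<and> open (Inl -` T) \<and> P T"
    then show "S \<inter> T \<subseteq> bordification p" "open (Inl -` (S \<inter> T))" "P (S \<inter> T)"
      by (auto simp: inter)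
  next
    fix K assume K: "\<forall>S\<in>K. S \<subseteq> bordification p \<and> open (Inl -` S) \<and> P S"
    show "\<Union>K \<subseteq> bordification p" using K by blast
    show "open (Inl -` \<Union>K)" unfolding vimage_Union using K by (intro open_UN) blast
    show "P (\<Union>K)" using K by (intro union) blast
  qed
  then show ?thesis unfolding bordif_topology_def P_def N_def by simp
qed

lemma topspace_bordif_topology [simp]: "topspace (bordif_topology p) = bordification p"
proof
  show "topspace (bordif_topology p) \<subseteq> bordification p"
    unfolding topspace_def openin_bordif_topology by blast
  have "Inl -` bordification p = UNIV" unfolding bordification_def by blast
  then have "openin (bordif_topology p) (bordification p)"
    unfolding openin_bordif_topology by (simp add: subset_iff)
  then show "bordification p \<subseteq> topspace (bordif_topology p)"
    by (rule openin_subset)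
qed

definition bordif_borel :: "'a::metric_space \<Rightarrow> 'a bordif measure" where
  "bordif_borel p = sigma (bordification p) {U. openin (bordif_topology p) U}"

section \<open>Group actions\<close>

definition isometric_action :: "('g, 'm) monoid_scheme \<Rightarrow> ('g \<Rightarrow> 'a::metric_space \<Rightarrow> 'a) \<Rightarrow> bool" where
  "isometric_action G \<phi> \<longleftrightarrow> group_action G UNIV \<phi> \<and>
     (\<forall>g\<in>carrier G. \<forall>x y. dist (\<phi> g x) (\<phi> g y) = dist x y)"

definition proper_action :: "('g, 'm) monoid_scheme \<Rightarrow> ('g \<Rightarrow> 'a::metric_space \<Rightarrow> 'a) \<Rightarrow> bool" where
  "proper_action G \<phi> \<longleftrightarrow> (\<forall>K. compact K \<longrightarrow> finite {g\<in>carrier G. \<phi> g ` K \<inter> K \<noteq> {}})"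

definition cocompact_action :: "('g, 'm) monoid_scheme \<Rightarrow> ('g \<Rightarrow> 'a::metric_space \<Rightarrow> 'a) \<Rightarrow> bool" where
  "cocompact_action G \<phi> \<longleftrightarrow> (\<exists>K. compact K \<and> (\<Union>g\<in>carrier G. \<phi> g ` K) = UNIV)"

definition elementary_group :: "('g, 'm) monoid_scheme \<Rightarrow> bool" where
  "elementary_group G \<longleftrightarrow> finite (carrier G) \<or>
     (\<exists>K. subgroup K G \<and> finite (rcosets\<^bsub>G\<^esub> K) \<and> G\<lparr>carrier := K\<rparr> \<cong> integer_group)"

text \<open>For a proper cocompact action on a proper geodesic space the upper limit is finite, so the conversion
  from \<open>ereal\<close> loses nothing.\<close>

definition growth_rate :: "('g, 'm) monoid_scheme \<Rightarrow> ('g \<Rightarrow> 'a::metric_space \<Rightarrow> 'a) \<Rightarrow> 'a \<Rightarrow> real" where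
  "growth_rate G \<phi> p = real_of_ereal (limsup (\<lambda>n.
     ereal (1 / real n * ln (real (card {\<phi> g p |g. g \<in> carrier G \<and> dist p (\<phi> g p) \<le> real n})))))"

section \<open>Patterson--Sullivan measures\<close>

definition poincare_series ::
    "('g, 'm) monoid_scheme \<Rightarrow> ('g \<Rightarrow> 'a::metric_space \<Rightarrow> 'a) \<Rightarrow> 'a \<Rightarrow> real \<Rightarrow> real" where
  "poincare_series G \<phi> p s = (\<Sum>\<^sub>\<infinity>g\<in>carrier G. exp (- s * dist p (\<phi> g p)))"

text \<open>The sum over \<open>g\<close> of the Dirac masses at \<open>gp\<close> with weights \<open>exp (-s d(p,gp)) / P(s)\<close>, as the image of a weighted counting measure
  on the group under the orbit map.\<close>

definition orbital_measure ::
    "('g, 'm) monoid_scheme \<Rightarrow> ('g \<Rightarrow> 'a::metric_space \<Rightarrow> 'a) \<Rightarrow> 'a \<Rightarrow> real \<Rightarrow> 'a bordif measure" where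
  "orbital_measure G \<phi> p s =
     distr (density (count_space (carrier G))
              (\<lambda>g. ennreal (exp (- s * dist p (\<phi> g p)) / poincare_series G \<phi> p s)))
           (bordif_borel p) (\<lambda>g. Inl (\<phi> g p))"

definition patterson_sullivan ::
    "('g, 'm) monoid_scheme \<Rightarrow> ('g \<Rightarrow> 'a::metric_space \<Rightarrow> 'a) \<Rightarrow> 'a \<Rightarrow> 'a bordif measure \<Rightarrow> bool" where
  "patterson_sullivan G \<phi> p \<mu> \<longleftrightarrow> prob_space \<mu> \<and> sets \<mu> = sets (bordif_borel p) \<and>
     (\<exists>s::nat \<Rightarrow> real. decseq s \<and> (\<forall>i. s i > growth_rate G \<phi> p) \<and> s \<longlonglongrightarrow> growth_rate G \<phi> p \<and>
        (\<forall>f. continuous_map (bordif_topology p) euclideanreal f \<longrightarrow>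
           (\<lambda>i. integral\<^sup>L (orbital_measure G \<phi> p (s i)) f) \<longlonglongrightarrow> integral\<^sup>L \<mu> f))"

text \<open>\<open>A\<close> is meant to be a subset of the boundary, and the complement is taken there.\<close>

definition full_in_boundary :: "'a::metric_space \<Rightarrow> 'a bordif measure \<Rightarrow> 'a bordif set \<Rightarrow> bool" where
  "full_in_boundary p \<mu> A \<longleftrightarrow> gromov_boundary p - A \<in> null_sets \<mu>"

section \<open>Horospheric limit points\<close>

text \<open>\<open>z \<rightarrow> \<xi>\<close> with \<open>z\<close> ranging over \<open>X\<close>. The values \<open>d(x,z) - d(y,z)\<close> are bounded by \<open>d(x,y)\<close>;
  \<open>ereal\<close> only serves to have \<open>Limsup\<close> available.\<close>

definition tends_to_boundary :: "'a::metric_space \<Rightarrow> 'a bordif \<Rightarrow> 'a filter" where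
  "tends_to_boundary p \<xi> = filtercomap Inl (nhdsin (bordif_topology p) \<xi>)"

definition busemann :: "'a::metric_space \<Rightarrow> 'a bordif \<Rightarrow> 'a \<Rightarrow> 'a \<Rightarrow> ereal" where
  "busemann p \<xi> x y = Limsup (tends_to_boundary p \<xi>) (\<lambda>z. ereal (dist x z - dist y z))"

definition horoball :: "'a::metric_space \<Rightarrow> 'a bordif \<Rightarrow> real \<Rightarrow> 'a set" where
  "horoball p \<xi> L = {y. busemann p \<xi> y p \<le> ereal L}"

text \<open>From here on \<open>H\<close> is the underlying set of a subgroup and \<open>H\<cdot>x\<close> is its orbit of \<open>x\<close>.\<close>

definition sub_orbit ::
    "('g, 'm) monoid_scheme \<Rightarrow> ('g \<Rightarrow> 'a::metric_space \<Rightarrow> 'a) \<Rightarrow> 'g set \<Rightarrow> 'a \<Rightarrow> 'a set" where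
  "sub_orbit G \<phi> H x = orbit (G\<lparr>carrier := H\<rparr>) \<phi> x"

definition limit_set ::
    "('g, 'm) monoid_scheme \<Rightarrow> ('g \<Rightarrow> 'a::metric_space \<Rightarrow> 'a) \<Rightarrow> 'g set \<Rightarrow> 'a \<Rightarrow> 'a bordif set" where
  "limit_set G \<phi> H p =
     gromov_boundary p \<inter> (bordif_topology p derived_set_of (Inl ` sub_orbit G \<phi> H p))"

definition horoball_approach ::
    "('g \<Rightarrow> 'a::metric_space \<Rightarrow> 'a) \<Rightarrow> 'g set \<Rightarrow> 'a \<Rightarrow> 'a bordif \<Rightarrow> real \<Rightarrow> bool" where
  "horoball_approach \<phi> H p \<xi> L \<longleftrightarrow>
     (\<exists>h::nat \<Rightarrow> 'g. range h \<subseteq> H \<and> inj (\<lambda>n. \<phi> (h n) p) \<and>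
        (\<forall>n. \<phi> (h n) p \<in> horoball p \<xi> L) \<and>
        limitin (bordif_topology p) (\<lambda>n. Inl (\<phi> (h n) p)) \<xi> sequentially)"

definition big_horospheric_limit_set ::
    "('g, 'm) monoid_scheme \<Rightarrow> ('g \<Rightarrow> 'a::metric_space \<Rightarrow> 'a) \<Rightarrow> 'g set \<Rightarrow> 'a \<Rightarrow> 'a bordif set" where
  "big_horospheric_limit_set G \<phi> H p =
     {\<xi>\<in>limit_set G \<phi> H p. \<exists>L. horoball_approach \<phi> H p \<xi> L}"

definition small_horospheric_limit_set ::
    "('g, 'm) monoid_scheme \<Rightarrow> ('g \<Rightarrow> 'a::metric_space \<Rightarrow> 'a) \<Rightarrow> 'g set \<Rightarrow> 'a \<Rightarrow> 'a bordif set" where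
  "small_horospheric_limit_set G \<phi> H p =
     {\<xi>\<in>limit_set G \<phi> H p. \<forall>L. horoball_approach \<phi> H p \<xi> L}"

section \<open>The quotient and its growth\<close>

definition quotient_space ::
    "('g, 'm) monoid_scheme \<Rightarrow> ('g \<Rightarrow> 'a::metric_space \<Rightarrow> 'a) \<Rightarrow> 'g set \<Rightarrow> 'a set set" where
  "quotient_space G \<phi> H = orbits (G\<lparr>carrier := H\<rparr>) UNIV \<phi>"

text \<open>On orbits of a group of isometries, \<open>setdist\<close> is the quotient distance.\<close>

lemma setdist_sub_orbit:
  assumes "isometric_action G \<phi>" "subgroup H G"
  shows "setdist (sub_orbit G \<phi> H x) (sub_orbit G \<phi> H y) = (INF h\<in>H. dist x (\<phi> h y))"
proof -
  interpret group_action G UNIV \<phi> using assms(1) by (simp add: isometric_action_def)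
  interpret group G using group_hom group_hom.axioms(1) by blast
  have iso: "dist (\<phi> g u) (\<phi> g v) = dist u v" if "g \<in> carrier G" for g u v
    using assms(1) that by (simp add: isometric_action_def)
  have HG: "h \<in> carrier G" if "h \<in> H" for h using assms(2) that by (rule subgroup.mem_carrier)
  have one: "\<one>\<^bsub>G\<^esub> \<in> H" using assms(2) by (rule subgroup.one_closed)
  have phi1: "\<phi> \<one>\<^bsub>G\<^esub> x = x" for x using id_eq_one by (metis UNIV_I restrict_apply')
  have orb: "sub_orbit G \<phi> H z = (\<lambda>h. \<phi> h z) ` H" for z
    by (auto simp: sub_orbit_def orbit_def)
  have bdd: "bdd_below ((\<lambda>h. dist x (\<phi> h y)) ` H)" by (rule bdd_belowI2[of _ 0]) simp
  have ge: "(INF h\<in>H. dist x (\<phi> h y)) \<le> dist (\<phi> a x) (\<phi> b y)" if "a \<in> H" "b \<in> H" for a b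
  proof -
    let ?c = "inv\<^bsub>G\<^esub> a \<otimes>\<^bsub>G\<^esub> b"
    have c: "?c \<in> H" using assms(2) that by (simp add: subgroup.m_closed subgroup.m_inv_closed)
    have "\<phi> b y = \<phi> (a \<otimes>\<^bsub>G\<^esub> ?c) y"
      using that HG by (simp add: m_assoc[symmetric])
    also have "\<dots> = \<phi> a (\<phi> ?c y)"
      using that HG c by (intro composition_rule) auto
    finally have "dist (\<phi> a x) (\<phi> b y) = dist x (\<phi> ?c y)" using iso HG that by simp
    then show ?thesis using cINF_lower[OF bdd c] by simp
  qed
  show ?thesis
  proof (rule antisym)
    show "setdist (sub_orbit G \<phi> H x) (sub_orbit G \<phi> H y) \<le> (INF h\<in>H. dist x (\<phi> h y))"
    proof (rule cINF_greatest)
      show "H \<noteq> {}" using one by blast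
      fix h assume "h \<in> H"
      moreover have "x \<in> sub_orbit G \<phi> H x" unfolding orb using one phi1 by (metis imageI)
      ultimately show "setdist (sub_orbit G \<phi> H x) (sub_orbit G \<phi> H y) \<le> dist x (\<phi> h y)"
        by (intro setdist_le_dist) (auto simp: orb)
    qed
    show "(INF h\<in>H. dist x (\<phi> h y)) \<le> setdist (sub_orbit G \<phi> H x) (sub_orbit G \<phi> H y)"
      using one ge by (subst le_setdist_iff) (auto simp: orb)
  qed
qed

definition separated :: "('b \<Rightarrow> 'b \<Rightarrow> real) \<Rightarrow> real \<Rightarrow> 'b set \<Rightarrow> bool" where
  "separated d R S \<longleftrightarrow> (\<forall>x\<in>S. \<forall>y\<in>S. x \<noteq> y \<longrightarrow> d x y \<ge> R)"

definition maximal_separated :: "'b set \<Rightarrow> ('b \<Rightarrow> 'b \<Rightarrow> real) \<Rightarrow> real \<Rightarrow> 'b set \<Rightarrow> bool" where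
  "maximal_separated M d R S \<longleftrightarrow> S \<subseteq> M \<and> separated d R S \<and>
     (\<forall>T. S \<subseteq> T \<and> T \<subseteq> M \<and> separated d R T \<longrightarrow> T = S)"

text \<open>\<open>X/H\<close> grows slower than \<open>X\<close>, as witnessed by nets \<open>Z\<close> of \<open>X\<close> and \<open>W\<close> of \<open>X/H\<close>.\<close>

definition quotient_grows_slower ::
    "('g, 'm) monoid_scheme \<Rightarrow> ('g \<Rightarrow> 'a::metric_space \<Rightarrow> 'a) \<Rightarrow> 'g set \<Rightarrow> 'a \<Rightarrow> 'a set \<Rightarrow> 'a set set \<Rightarrow> bool" where
  "quotient_grows_slower G \<phi> H p Z W \<longleftrightarrow>
     (\<lambda>n. real (card {w\<in>W. setdist (sub_orbit G \<phi> H p) w \<le> real n}) /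
          real (card (Z \<inter> cball p (real n)))) \<longlonglongrightarrow> 0"

definition quotient_orbit_count ::
    "('g, 'm) monoid_scheme \<Rightarrow> ('g \<Rightarrow> 'a::metric_space \<Rightarrow> 'a) \<Rightarrow> 'g set \<Rightarrow> 'a \<Rightarrow> nat \<Rightarrow> nat" where
  "quotient_orbit_count G \<phi> H p n =
     card {sub_orbit G \<phi> H (\<phi> g p) |g. g \<in> carrier G \<and>
             setdist (sub_orbit G \<phi> H p) (sub_orbit G \<phi> H (\<phi> g p)) \<le> real n}"

definition comparable :: "(nat \<Rightarrow> real) \<Rightarrow> (nat \<Rightarrow> real) \<Rightarrow> bool" where
  "comparable a b \<longleftrightarrow> (\<exists>C\<ge>1. \<forall>n. b n / C \<le> a n \<and> a n \<le> C * b n)"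

end

theory Submission
  imports Defs
begin

text \<open>Call the shadow of an orbit point \<open>z\<close> the set of points whose geodesics from \<open>p\<close> pass near \<open>z\<close>. Translating
  \<open>z\<close> back to \<open>p\<close> bounds the orbital mass of its shadow by a multiple of \<open>exp (- \<omega> d(p,z))\<close>. If \<open>\<omega> > 0\<close>, this makes
  the shadows of far away points small, and as the complement of a translated shadow is such a shadow, the bound is
  sharp. Hence orbit points grow like \<open>exp (\<omega> n)\<close> without subexponential corrections, the Poincare series diverges
  at \<open>\<omega>\<close>, and the estimate passes to \<open>\<mu>\<close>. To see \<open>\<omega> > 0\<close>: three directions at \<open>p\<close> yield a free binary tree in the
  orbit, while two directions force the orbit to stay near the axis of a single element.

  A boundary point outside the big horospheric limit set has finitely many points of \<open>H p\<close> in each horoball, so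
  the orbit points near its ray lie boundedly many to one over their \<open>H\<close>-orbits. If such points have positive
  measure, shadows at distance \<open>n\<close> have to cover them, and there are at least \<open>c exp (\<omega> n)\<close> many \<open>H\<close>-orbits.
  Conversely, if there are that many for infinitely many \<open>n\<close>, the upper limit of the shadows of the points
  nearest to \<open>p\<close> in their \<open>H\<close>-orbits has positive measure, and no point in it is small horospheric.

  Finally the big horospheric limit points that are not small are a null set: near such a point there is at every
  scale a hole, of definite relative size, consisting of points to which some point of \<open>H p\<close> is closer than
  allowed. A Vitali covering argument, with the holes for the same covering disjoint, concludes.\<close>

section \<open>Gromov products\<close>

text \<open>\<open>patterson_sullivan\<close> gives access to \<open>\<mu>\<close> only through
  integrals of continuous functions on the bordification, and indicators of shadows are not
  continuous. The obstacle is to produce a continuous function between the indicators of two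
  concentric shadows. \<open>exp (- \<epsilon> * prd x y)\<close> is a metric only up to a factor;
  chains repair this, and the resulting cutoff carries the shadow estimates from the orbital
  measures to \<open>\<mu>\<close> at the price of changing \<open>r\<close> by a bounded amount.
  Boundary points enter through the real function \<open>bprd\<close>, read off from the Busemann
  function. On finitely many points it agrees up to \<delta> with the Gromov product with one far
  away point, so inequalities at infinity become four point inequalities in the space. Divergence of
  the Poincare series also has the task of pushing the mass of \<open>\<mu>\<close> to the boundary.
  In the null set argument a decreasing sequence plays the role of a density theorem: the covers at
  scale \<open>n\<close> shrink into a set \<open>lower E\<close>, while the holes lie in the cover
  but outside that very set, so their mass tends to 0.\<close>

lemma gromov_product_commute: "gromov_product q x y = gromov_product q y x"
  by (simp add: gromov_product_def dist_commute)

lemma gromov_product_le_left: "gromov_product q x y \<le> dist q x"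
  using dist_triangle[of q y x] by (simp add: gromov_product_def dist_commute)

lemma gromov_product_le_right: "gromov_product q x y \<le> dist q y"
  using gromov_product_le_left gromov_product_commute by metis

lemma gromov_product_self [simp]: "gromov_product q x x = dist q x"
  by (simp add: gromov_product_def)

lemma gromov_product_base [simp]: "gromov_product q q x = 0"
  by (simp add: gromov_product_def)

lemma gromov_product_Lipschitz: "\<bar>gromov_product q x y - gromov_product q x z\<bar> \<le> dist y z"
proof -
  have "\<bar>dist q y - dist q z\<bar> \<le> dist y z" "\<bar>dist x y - dist x z\<bar> \<le> dist y z"
    using dist_triangle[of q y z] dist_triangle[of q z y] dist_triangle[of x y z] dist_triangle[of x z y]
    by (auto simp: abs_le_iff dist_commute)
  then show ?thesis by (simp add: gromov_product_def field_simps)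
qed

lemma dist_eq_gromov_product: "dist x y = dist q x + dist q y - 2 * gromov_product q x y"
  by (simp add: gromov_product_def field_simps)

text \<open>On a tripod these are the distances of the two ends from the branch point. Used to trade
  a small product at one end of a side for a large one at the other.\<close>

lemma gromov_product_change_base: "gromov_product x q y + gromov_product q x y = dist q x"
  by (simp add: gromov_product_def dist_commute field_simps)

locale hyperbolic_space =
  fixes p :: "'a::metric_space" and \<delta> :: real
  assumes hyperbolic:
    "\<And>q x y z :: 'a. min (gromov_product q x y) (gromov_product q y z) - \<delta> \<le> gromov_product q x z"
begin

lemma delta_nonneg: "0 \<le> \<delta>"
  using hyperbolic[of p p p p] by simp

lemma hyperbolic3:
  fixes q :: 'a
  shows "min (gromov_product q x y) (min (gromov_product q y z) (gromov_product q z w)) - 2 * \<delta> \<le> gromov_product q x w"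
  using hyperbolic[of q x y w] hyperbolic[of q y z w] delta_nonneg unfolding min_def by argo

text \<open>The induction keeps the product of \<open>f 0\<close> and \<open>f (Suc i)\<close> at
  \<open>f i\<close> below \<open>a + \<delta>\<close>. At the next vertex the product of
  \<open>f i\<close> and \<open>f 0\<close> then exceeds \<open>a + \<delta>\<close>, so in the four
  point inequality for the turn only the product of \<open>f 0\<close> and the next point can be the
  small one.\<close>

lemma local_quasi_geodesic:
  fixes f :: "nat \<Rightarrow> 'a"
  assumes a: "0 \<le> a" and l: "2 * a + 2 * \<delta> < l"
    and step: "\<And>i. i < n \<Longrightarrow> l \<le> dist (f i) (f (Suc i))"
    and turn: "\<And>i. Suc i < n \<Longrightarrow> gromov_product (f (Suc i)) (f i) (f (Suc (Suc i))) \<le> a"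
  shows "real n * (l - 2 * a - 2 * \<delta>) \<le> dist (f 0) (f n)"
    and "0 < n \<Longrightarrow> gromov_product (f (n - 1)) (f 0) (f n) \<le> a + \<delta>"
proof -
  have turn0: "gromov_product (f i) (f 0) (f (Suc i)) \<le> a + \<delta>" if "i < n" for i
    using that
  proof (induction i)
    case 0
    then show ?case using a delta_nonneg by simp
  next
    case (Suc i)
    then have IH: "gromov_product (f i) (f 0) (f (Suc i)) \<le> a + \<delta>" by simp
    have "gromov_product (f (Suc i)) (f i) (f 0) = dist (f i) (f (Suc i)) - gromov_product (f i) (f 0) (f (Suc i))"
      using gromov_product_change_base[of "f (Suc i)" "f i" "f 0"]
      by (simp add: gromov_product_commute dist_commute)
    then have far: "a + \<delta> < gromov_product (f (Suc i)) (f i) (f 0)"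
      using IH step[of i] Suc.prems l by simp
    have "min (gromov_product (f (Suc i)) (f i) (f 0)) (gromov_product (f (Suc i)) (f 0) (f (Suc (Suc i)))) \<le> a + \<delta>"
      using hyperbolic[of "f (Suc i)" "f i" "f 0" "f (Suc (Suc i))"] turn[of i] Suc.prems by linarith
    then show ?case using far by linarith
  qed
  show "real n * (l - 2 * a - 2 * \<delta>) \<le> dist (f 0) (f n)"
    using step turn0
  proof (induction n)
    case 0
    then show ?case by simp
  next
    case (Suc n)
    have "real n * (l - 2 * a - 2 * \<delta>) \<le> dist (f 0) (f n)" using Suc by simp
    moreover have "dist (f 0) (f (Suc n)) = dist (f n) (f 0) + dist (f n) (f (Suc n)) - 2 * gromov_product (f n) (f 0) (f (Suc n))"
      by (rule dist_eq_gromov_product)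
    moreover have "l \<le> dist (f n) (f (Suc n))" "gromov_product (f n) (f 0) (f (Suc n)) \<le> a + \<delta>"
      using Suc.prems by auto
    ultimately show ?case by (simp add: algebra_simps dist_commute)
  qed
  show "gromov_product (f (n - 1)) (f 0) (f n) \<le> a + \<delta>" if "0 < n"
    using turn0[of "n - 1"] that by simp
qed

section \<open>The boundary\<close>

abbreviation prd :: "'a \<Rightarrow> 'a \<Rightarrow> real" where "prd \<equiv> gromov_product p"

lemma converges_to_infinity_iff:
  "converges_to_infinity p u \<longleftrightarrow> (\<forall>R. \<exists>N. \<forall>i\<ge>N. \<forall>j\<ge>N. R \<le> prd (u i) (u j))"
proof -
  have "converges_to_infinity p u \<longleftrightarrow> (\<forall>R. \<exists>N. \<forall>i\<ge>N. \<forall>j\<ge>N. R \<le> prd (u j) (u i))"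
    unfolding converges_to_infinity_def filterlim_at_top eventually_prod_sequentially by simp
  then show ?thesis by (simp add: gromov_product_commute)
qed

text \<open>\<open>boundary_rel\<close> controls the diagonal only; the Cauchy property of
  \<open>u\<close> and one use of hyperbolicity through \<open>u j\<close> make the indices
  independent.\<close>

lemma boundary_relD:
  assumes "(u, v) \<in> boundary_rel p"
  shows "\<exists>N. \<forall>i\<ge>N. \<forall>j\<ge>N. R \<le> prd (u i) (v j)"
proof -
  have u: "converges_to_infinity p u" and lim: "filterlim (\<lambda>i. prd (u i) (v i)) at_top sequentially"
    using assms by (auto simp: boundary_rel_def)
  obtain N where N: "\<forall>i\<ge>N. \<forall>j\<ge>N. R + \<delta> \<le> prd (u i) (u j)"
    using u converges_to_infinity_iff by blast
  have "\<forall>\<^sub>F j in sequentially. R + \<delta> \<le> prd (u j) (v j)"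
    using lim by (simp add: filterlim_at_top)
  then obtain M where M: "\<forall>j\<ge>M. R + \<delta> \<le> prd (u j) (v j)"
    by (auto simp: eventually_sequentially)
  have "R \<le> prd (u i) (v j)" if "i \<ge> max N M" "j \<ge> max N M" for i j
    using hyperbolic[of p "u i" "u j" "v j"] N M that
    by (smt (verit) max.boundedE)
  then show ?thesis by blast
qed

lemma boundary_rel_refl: "converges_to_infinity p u \<Longrightarrow> (u, u) \<in> boundary_rel p"
  unfolding boundary_rel_def filterlim_at_top eventually_sequentially
  by (auto simp: converges_to_infinity_iff) (metis gromov_product_self)

lemma gromov_boundaryE:
  assumes "\<xi> \<in> gromov_boundary p"
  obtains u where "converges_to_infinity p u" "u \<in> representatives \<xi>"
    "\<And>v. v \<in> representatives \<xi> \<longleftrightarrow> (u, v) \<in> boundary_rel p"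
proof -
  obtain u where u: "converges_to_infinity p u" "\<xi> = Inr (boundary_rel p `` {u})"
    using assms by (auto simp: gromov_boundary_def quotient_def)
  show ?thesis
    by (rule that[of u]) (use u boundary_rel_refl in auto)
qed

lemma representatives_converge:
  assumes "\<xi> \<in> gromov_boundary p" "u \<in> representatives \<xi>"
  shows "converges_to_infinity p u"
proof -
  obtain w where "(w, u) \<in> boundary_rel p" using assms gromov_boundaryE by metis
  then show ?thesis by (simp add: boundary_rel_def)
qed

lemma representatives_nonempty:
  assumes "\<xi> \<in> bordification p" shows "\<exists>u. u \<in> representatives \<xi>"
proof (cases "\<xi> \<in> gromov_boundary p")
  case True
  then show ?thesis using gromov_boundaryE by metis
next
  case False
  then show ?thesis using assms by (auto simp: bordification_def)
qed

lemma representatives_close: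
  assumes \<xi>: "\<xi> \<in> gromov_boundary p" and u: "u \<in> representatives \<xi>" and v: "v \<in> representatives \<xi>"
  shows "\<exists>N. \<forall>i\<ge>N. \<forall>j\<ge>N. R \<le> prd (u i) (v j)"
proof -
  obtain w where w: "\<And>v. v \<in> representatives \<xi> \<longleftrightarrow> (w, v) \<in> boundary_rel p"
    using gromov_boundaryE[OF \<xi>] by metis
  obtain N where N: "\<forall>i\<ge>N. \<forall>j\<ge>N. R + \<delta> \<le> prd (w i) (u j)" using boundary_relD w u by blast
  obtain M where M: "\<forall>i\<ge>M. \<forall>j\<ge>M. R + \<delta> \<le> prd (w i) (v j)" using boundary_relD w v by blast
  have "R \<le> prd (u i) (v j)" if "i \<ge> max N M" "j \<ge> max N M" for i j
  proof -
    have "R + \<delta> \<le> prd (w (max N M)) (u i)" "R + \<delta> \<le> prd (w (max N M)) (v j)"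
      using N M that by auto
    then show ?thesis
      using hyperbolic[of p "u i" "w (max N M)" "v j"] by (simp add: gromov_product_commute)
  qed
  then show ?thesis by blast
qed

text \<open>Treats the constant representative of a point and sequences to the boundary alike. That
  \<open>N\<close> is uniform in \<open>y\<close> matters: below, \<open>y\<close> itself runs along
  a sequence.\<close>

lemma representatives_transfer:
  assumes "\<xi> \<in> bordification p" and "u \<in> representatives \<xi>" and "v \<in> representatives \<xi>"
  shows "\<exists>N. \<forall>i\<ge>N. \<forall>j\<ge>N. \<forall>y. R \<le> prd y (u i) \<longrightarrow> R - \<delta> \<le> prd y (v j)"
proof (cases "\<xi> \<in> gromov_boundary p")
  case True
  then obtain N where N: "\<forall>i\<ge>N. \<forall>j\<ge>N. R \<le> prd (u i) (v j)"
    using representatives_close assms by blast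
  have "R - \<delta> \<le> prd y (v j)" if "i \<ge> N" "j \<ge> N" "R \<le> prd y (u i)" for i j y
  proof -
    have "R \<le> prd (u i) (v j)" using N that by blast
    then show ?thesis using hyperbolic[of p y "u i" "v j"] that by linarith
  qed
  then show ?thesis by blast
next
  case False
  then obtain x where "\<xi> = Inl x" using assms by (auto simp: bordification_def)
  then show ?thesis using assms delta_nonneg by force
qed

text \<open>The supremum in \<open>ext_gromov_product\<close> provides good representatives;
  replacing them by the given ones costs \<delta> for each of the two arguments.\<close>

lemma ext_gromov_product_gtD:
  assumes "ereal R < ext_gromov_product p \<xi> \<eta>" and \<xi>: "\<xi> \<in> bordification p" and \<eta>: "\<eta> \<in> bordification p"
    and u: "u \<in> representatives \<xi>" and v: "v \<in> representatives \<eta>"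
  shows "\<exists>N. \<forall>i\<ge>N. \<forall>j\<ge>N. R - 2 * \<delta> \<le> prd (u i) (v j)"
proof -
  obtain u' v' where u': "u' \<in> representatives \<xi>" and v': "v' \<in> representatives \<eta>"
    and "ereal R < Liminf (sequentially \<times>\<^sub>F sequentially) (\<lambda>(i, j). ereal (prd (u' i) (v' j)))"
    using assms(1) unfolding ext_gromov_product_def less_SUP_iff by auto
  then have "\<forall>\<^sub>F ij in sequentially \<times>\<^sub>F sequentially. ereal R < (case ij of (i, j) \<Rightarrow> ereal (prd (u' i) (v' j)))"
    by (simp add: less_LiminfD)
  then obtain N0 where N0: "\<And>i j. i \<ge> N0 \<Longrightarrow> j \<ge> N0 \<Longrightarrow> R \<le> prd (u' i) (v' j)"
    unfolding eventually_prod_sequentially by fastforce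
  obtain N1 where N1: "\<forall>i\<ge>N1. \<forall>j\<ge>N1. \<forall>y. R \<le> prd y (u' i) \<longrightarrow> R - \<delta> \<le> prd y (u j)"
    using representatives_transfer[OF \<xi> u' u] by blast
  obtain N2 where N2: "\<forall>i\<ge>N2. \<forall>j\<ge>N2. \<forall>y. R - \<delta> \<le> prd y (v' i) \<longrightarrow> R - \<delta> - \<delta> \<le> prd y (v j)"
    using representatives_transfer[OF \<eta> v' v] by blast
  define N where "N = max N0 (max N1 N2)"
  have "R - 2 * \<delta> \<le> prd (u i) (v j)" if "i \<ge> N" "j \<ge> N" for i j
  proof -
    have "R \<le> prd (v' N) (u' N)" using N0[of N N] gromov_product_commute by (metis N_def max.cobounded1)
    then have "R - \<delta> \<le> prd (v' N) (u i)" using N1[rule_format, of N i "v' N"] that by (simp add: N_def)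
    then have "R - \<delta> \<le> prd (u i) (v' N)" by (metis gromov_product_commute)
    then have "R - \<delta> - \<delta> \<le> prd (u i) (v j)" using N2[rule_format, of N j "u i"] that by (simp add: N_def)
    then show ?thesis by simp
  qed
  then show ?thesis by blast
qed

lemma ext_gromov_product_gtI:
  assumes "u \<in> representatives \<xi>" and "v \<in> representatives \<eta>" and "R < R'"
    and ev: "\<And>i j. i \<ge> N \<Longrightarrow> j \<ge> N \<Longrightarrow> R' \<le> prd (u i) (v j)"
  shows "ereal R < ext_gromov_product p \<xi> \<eta>"
proof -
  have "ereal R < ereal R'" using assms by simp
  also have "\<dots> \<le> Liminf (sequentially \<times>\<^sub>F sequentially) (\<lambda>(i, j). ereal (prd (u i) (v j)))"
    using ev by (intro Liminf_bounded) (auto simp: eventually_prod_sequentially)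
  also have "\<dots> \<le> ext_gromov_product p \<xi> \<eta>"
    unfolding ext_gromov_product_def using assms by (auto intro!: SUP_upper2)
  finally show ?thesis .
qed

lemma Inl_in_bordification [simp]: "Inl x \<in> bordification p"
  by (simp add: bordification_def)

lemma boundary_in_bordification: "\<xi> \<in> gromov_boundary p \<Longrightarrow> \<xi> \<in> bordification p"
  by (simp add: bordification_def)

lemma ext_point_gtD:
  assumes "ereal R < ext_gromov_product p \<xi> (Inl x)" and "\<xi> \<in> bordification p" and "u \<in> representatives \<xi>"
  shows "\<exists>N. \<forall>i\<ge>N. R - 2 * \<delta> \<le> prd (u i) x"
  using ext_gromov_product_gtD[OF assms(1,2) _ assms(3), of "\<lambda>_. x"] by auto

text \<open>The sets \<open>{\<eta>. (\<xi>|\<eta>)\<^sub>p > R}\<close> need not be open. Those below are, because membership of a boundary point only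
  refers to points of the space: passing to a nearby boundary point changes the witness \<open>R\<close>, but not \<open>Q\<close>.\<close>

lemma openin_bordif_extension:
  assumes Q: "open Q"
  shows "openin (bordif_topology p)
    (Inl ` Q \<union> {\<eta>\<in>gromov_boundary p. \<exists>R. \<forall>x. ereal R < ext_gromov_product p \<eta> (Inl x) \<longrightarrow> x \<in> Q})"
    (is "openin _ ?U")
  unfolding openin_bordif_topology
proof (intro conjI ballI)
  show "?U \<subseteq> bordification p" by (auto simp: bordification_def)
  have "Inl -` ?U = Q" by (auto simp: gromov_boundary_def)
  then show "open (Inl -` ?U)" using Q by simp
  fix \<eta> assume "\<eta> \<in> ?U \<inter> gromov_boundary p"
  then obtain R where \<eta>: "\<eta> \<in> gromov_boundary p"
    and R: "\<And>x. ereal R < ext_gromov_product p \<eta> (Inl x) \<Longrightarrow> x \<in> Q"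
    by (auto simp: gromov_boundary_def)
  have "\<zeta> \<in> ?U" if \<zeta>: "\<zeta> \<in> bordification p" and near: "ereal (R + 4 * \<delta> + 1) < ext_gromov_product p \<eta> \<zeta>" for \<zeta>
  proof (cases "\<zeta> \<in> gromov_boundary p")
    case True
    have "x \<in> Q" if x: "ereal (R + 4 * \<delta> + 1) < ext_gromov_product p \<zeta> (Inl x)" for x
    proof (rule R)
      obtain u v where u: "u \<in> representatives \<eta>" and v: "v \<in> representatives \<zeta>"
        using representatives_nonempty \<eta> \<zeta> boundary_in_bordification by blast
      obtain N where N: "\<And>i j. i \<ge> N \<Longrightarrow> j \<ge> N \<Longrightarrow> R + 4 * \<delta> + 1 - 2 * \<delta> \<le> prd (u i) (v j)"
        using ext_gromov_product_gtD[OF near boundary_in_bordification[OF \<eta>] \<zeta> u v] by blast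
      obtain M where M: "\<And>i. i \<ge> M \<Longrightarrow> R + 4 * \<delta> + 1 - 2 * \<delta> \<le> prd (v i) x"
        using ext_point_gtD[OF x \<zeta> v] by blast
      show "ereal R < ext_gromov_product p \<eta> (Inl x)"
      proof (rule ext_gromov_product_gtI[of u \<eta> "\<lambda>_. x" _ R "R + 1" "max N M"])
        show "R + 1 \<le> prd (u i) x" if "i \<ge> max N M" for i
          using N[of i "max N M"] M[of "max N M"] hyperbolic[of p "u i" "v (max N M)" x] that delta_nonneg
          by simp
      qed (use u in auto)
    qed
    then show ?thesis using True by blast
  next
    case False
    then obtain x where "\<zeta> = Inl x" using \<zeta> by (auto simp: bordification_def)
    moreover have "ereal R < ext_gromov_product p \<eta> \<zeta>"
      using near delta_nonneg by (auto intro: le_less_trans[of "ereal R" "ereal (R + 4 * \<delta> + 1)"])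
    ultimately show ?thesis using R by auto
  qed
  then show "\<exists>R. {\<zeta>\<in>bordification p. ereal R < ext_gromov_product p \<eta> \<zeta>} \<subseteq> ?U" by blast
qed

text \<open>Removes open sets from the filter. Since the sets \<open>{x. (\<xi>|x) > R}\<close> need
  not be open, they are first thickened by unit balls and then extended to the boundary by
  \<open>openin_bordif_extension\<close>.\<close>

lemma eventually_tends_to_boundary:
  assumes \<xi>: "\<xi> \<in> gromov_boundary p"
  shows "eventually P (tends_to_boundary p \<xi>) \<longleftrightarrow> (\<exists>R. \<forall>x. ereal R < ext_gromov_product p \<xi> (Inl x) \<longrightarrow> P x)"
    (is "?L \<longleftrightarrow> ?R")
proof
  have top: "\<xi> \<in> topspace (bordif_topology p)" using boundary_in_bordification[OF \<xi>] by simp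
  have ev: "?L \<longleftrightarrow> (\<exists>U. openin (bordif_topology p) U \<and> \<xi> \<in> U \<and> (\<forall>x. Inl x \<in> U \<longrightarrow> P x))"
    unfolding tends_to_boundary_def eventually_filtercomap eventually_nhdsin using top by auto
  show ?R if ?L
  proof -
    obtain U where U: "openin (bordif_topology p) U" "\<xi> \<in> U" "\<forall>x. Inl x \<in> U \<longrightarrow> P x" using \<open>?L\<close> ev by blast
    obtain R where "{\<eta>\<in>bordification p. ext_gromov_product p \<xi> \<eta> > ereal R} \<subseteq> U"
      using U(1,2) \<xi> unfolding openin_bordif_topology by blast
    then have "\<forall>x. ereal R < ext_gromov_product p \<xi> (Inl x) \<longrightarrow> P x"
      using U(3) by (auto simp: subset_iff)
    then show ?R by blast
  qed
  show ?L if ?R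
  proof -
    obtain R where R: "\<And>x. ereal R < ext_gromov_product p \<xi> (Inl x) \<Longrightarrow> P x" using \<open>?R\<close> by blast
    \<comment> \<open>Moving a point by less than 1 changes the product by less than 1, and
      \<open>ext_point_gtD\<close> costs \<open>2 * \<delta>\<close>; what remains still exceeds
      \<open>R\<close> by 1, which yields the strict inequality.\<close>
    define Q where "Q = (\<Union>y\<in>{y. ereal (R + 2 * \<delta> + 2) < ext_gromov_product p \<xi> (Inl y)}. ball y 1)"
    have QP: "P x" if x: "x \<in> Q" for x
    proof (rule R)
      obtain y where y: "ereal (R + 2 * \<delta> + 2) < ext_gromov_product p \<xi> (Inl y)" "dist y x < 1"
        using x unfolding Q_def UN_iff mem_Collect_eq mem_ball by blast
      obtain u where u: "u \<in> representatives \<xi>"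
        using representatives_nonempty \<xi> boundary_in_bordification by blast
      obtain N where N: "\<forall>i\<ge>N. R + 2 * \<delta> + 2 - 2 * \<delta> \<le> prd (u i) y"
        using ext_point_gtD[OF y(1) boundary_in_bordification[OF \<xi>] u] by blast
      show "ereal R < ext_gromov_product p \<xi> (Inl x)"
      proof (rule ext_gromov_product_gtI[of u \<xi> "\<lambda>_. x" _ R "R + 1" N])
        show "R + 1 \<le> prd (u i) x" if "i \<ge> N" for i
        proof -
          have "R + 2 * \<delta> + 2 - 2 * \<delta> \<le> prd (u i) y" using N that by blast
          then show ?thesis using y(2) gromov_product_Lipschitz[of p "u i" y x] by linarith
        qed
      qed (use u in auto)
    qed
    have "open Q" unfolding Q_def by (rule open_UN) simp
    then have "openin (bordif_topology p)
      (Inl ` Q \<union> {\<eta>\<in>gromov_boundary p. \<exists>R. \<forall>x. ereal R < ext_gromov_product p \<eta> (Inl x) \<longrightarrow> x \<in> Q})" (is "openin _ ?U")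
      by (rule openin_bordif_extension)
    moreover have "\<xi> \<in> ?U"
    proof -
      have "\<forall>x. ereal (R + 2 * \<delta> + 2) < ext_gromov_product p \<xi> (Inl x) \<longrightarrow> x \<in> Q" by (auto simp: Q_def)
      then show ?thesis using \<xi> by blast
    qed
    moreover have "\<forall>x. Inl x \<in> ?U \<longrightarrow> P x" using QP by (auto simp: gromov_boundary_def)
    ultimately show ?L using ev by blast
  qed
qed

lemma representatives_ext_large:
  assumes \<xi>: "\<xi> \<in> gromov_boundary p" and u: "u \<in> representatives \<xi>"
  shows "\<exists>N. \<forall>i\<ge>N. ereal R < ext_gromov_product p \<xi> (Inl (u i))"
proof -
  obtain N where N: "\<forall>i\<ge>N. \<forall>j\<ge>N. R + 1 \<le> prd (u i) (u j)"
    using representatives_converge[OF assms] converges_to_infinity_iff by blast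
  have "ereal R < ext_gromov_product p \<xi> (Inl (u i))" if "i \<ge> N" for i
    by (rule ext_gromov_product_gtI[of u \<xi> "\<lambda>_. u i" _ R "R + 1" N]) (use N that u in auto)
  then show ?thesis by blast
qed

lemma tends_to_boundary_neq_bot:
  assumes \<xi>: "\<xi> \<in> gromov_boundary p" shows "tends_to_boundary p \<xi> \<noteq> bot"
proof -
  obtain u where u: "u \<in> representatives \<xi>"
    using representatives_nonempty \<xi> boundary_in_bordification by blast
  show ?thesis
    unfolding trivial_limit_def eventually_tends_to_boundary[OF \<xi>]
    using representatives_ext_large[OF \<xi> u] by blast
qed

section \<open>Busemann functions\<close>

text \<open>Finite at every boundary point by \<open>busemann_near\<close>, so the conversion from
  \<open>ereal\<close> loses nothing there.\<close>

definition bus :: "'a bordif \<Rightarrow> 'a \<Rightarrow> real" where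
  "bus \<xi> x = real_of_ereal (busemann p \<xi> x p)"

text \<open>The Gromov product of a boundary point and a point of the space, up to a multiple of \<open>\<delta>\<close>.\<close>

definition bprd :: "'a bordif \<Rightarrow> 'a \<Rightarrow> real" where
  "bprd \<xi> x = (dist p x - bus \<xi> x) / 2"

lemma bus_eq: "bus \<xi> x = dist p x - 2 * bprd \<xi> x"
  by (simp add: bprd_def field_simps)

text \<open>The function under the upper limit is \<open>dist p x - 2 * prd x z\<close>. Points
  \<open>z\<close> close to \<xi> have mutual products of at least \<open>dist p x\<close>, which no
  product with \<open>x\<close> exceeds; so \<open>prd x z\<close> is constant up to \<delta>, and
  the upper limit is near each of the values.\<close>

lemma busemann_near:
  assumes \<xi>: "\<xi> \<in> gromov_boundary p"
  shows "busemann p \<xi> x p = ereal (bus \<xi> x)"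
    and "ereal (dist p x + 3 * \<delta>) < ext_gromov_product p \<xi> (Inl z) \<Longrightarrow> \<bar>prd x z - bprd \<xi> x\<bar> \<le> \<delta>"
proof -
  \<comment> \<open>Passing to a representative costs \<open>2 * \<delta>\<close> and comparing two
    far points one more \<delta>, which leaves \<open>dist p x\<close>.\<close>
  define R where "R = dist p x + 3 * \<delta>"
  define far where "far = {z. ereal R < ext_gromov_product p \<xi> (Inl z)}"
  let ?F = "tends_to_boundary p \<xi>"
  have value_eq: "dist x z - dist p z = dist p x - 2 * prd x z" for z
    by (simp add: gromov_product_def field_simps)
  have close: "\<bar>prd x z - prd x z'\<bar> \<le> \<delta>" if z: "z \<in> far" and z': "z' \<in> far" for z z'
  proof -
    obtain u where u: "u \<in> representatives \<xi>"
      using representatives_nonempty \<xi> boundary_in_bordification by blast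
    obtain N where N: "\<And>i. i \<ge> N \<Longrightarrow> R - 2 * \<delta> \<le> prd (u i) z"
      using z ext_point_gtD[OF _ boundary_in_bordification[OF \<xi>] u] unfolding far_def by blast
    obtain M where M: "\<And>i. i \<ge> M \<Longrightarrow> R - 2 * \<delta> \<le> prd (u i) z'"
      using z' ext_point_gtD[OF _ boundary_in_bordification[OF \<xi>] u] unfolding far_def by blast
    have "dist p x \<le> prd z z'"
      using N[of "max N M"] M[of "max N M"] hyperbolic[of p z "u (max N M)" z']
      by (simp add: R_def gromov_product_commute)
    then show ?thesis
      using hyperbolic[of p x z z'] hyperbolic[of p x z' z] gromov_product_le_left[of p x z]
        gromov_product_le_left[of p x z'] gromov_product_commute[of p z z']
      by linarith
  qed
  have ev: "\<forall>\<^sub>F z in ?F. z \<in> far"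
    unfolding eventually_tends_to_boundary[OF \<xi>] far_def by blast
  have bounds: "ereal (dist p x - 2 * prd x z - 2 * \<delta>) \<le> busemann p \<xi> x p"
    "busemann p \<xi> x p \<le> ereal (dist p x - 2 * prd x z + 2 * \<delta>)" if z: "z \<in> far" for z
  proof -
    have "\<forall>\<^sub>F w in ?F. ereal (dist x w - dist p w) \<le> ereal (dist p x - 2 * prd x z + 2 * \<delta>)"
      using ev by eventually_elim (use close[OF z] in \<open>simp add: value_eq abs_le_iff\<close>, force)
    then show "busemann p \<xi> x p \<le> ereal (dist p x - 2 * prd x z + 2 * \<delta>)"
      unfolding busemann_def by (rule Limsup_bounded)
    have "\<forall>\<^sub>F w in ?F. ereal (dist p x - 2 * prd x z - 2 * \<delta>) \<le> ereal (dist x w - dist p w)"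
      using ev by eventually_elim (use close[OF z] in \<open>simp add: value_eq abs_le_iff\<close>, force)
    then show "ereal (dist p x - 2 * prd x z - 2 * \<delta>) \<le> busemann p \<xi> x p"
      unfolding busemann_def by (rule le_Limsup[OF tends_to_boundary_neq_bot[OF \<xi>]])
  qed
  obtain z where z: "z \<in> far"
    using eventually_happens[OF ev] tends_to_boundary_neq_bot[OF \<xi>] by blast
  show fin: "busemann p \<xi> x p = ereal (bus \<xi> x)"
    unfolding bus_def using bounds[OF z] by (cases "busemann p \<xi> x p") auto
  show "\<bar>prd x z - bprd \<xi> x\<bar> \<le> \<delta>" if "ereal (dist p x + 3 * \<delta>) < ext_gromov_product p \<xi> (Inl z)" for z
  proof -
    have "z \<in> far" using that by (simp add: far_def R_def)
    from bounds[OF this] show ?thesis unfolding fin by (simp add: bus_eq abs_le_iff)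
  qed
qed

lemma bprd_near:
  assumes \<xi>: "\<xi> \<in> gromov_boundary p" and u: "u \<in> representatives \<xi>"
  shows "\<exists>N. \<forall>i\<ge>N. \<bar>prd x (u i) - bprd \<xi> x\<bar> \<le> \<delta>"
  using representatives_ext_large[OF assms] busemann_near(2)[OF \<xi>] by meson

text \<open>A finite set cannot tell \<xi> from a suitable point \<open>z\<close> far away. This is
  the device that reduces inequalities for \<open>bprd\<close> to the four point inequality.\<close>

lemma bprd_approx:
  assumes \<xi>: "\<xi> \<in> gromov_boundary p" and S: "finite S"
  shows "\<exists>z. T \<le> dist p z \<and> (\<forall>x\<in>S. \<bar>prd x z - bprd \<xi> x\<bar> \<le> \<delta>)"
proof -
  obtain u where u: "u \<in> representatives \<xi>"
    using representatives_nonempty \<xi> boundary_in_bordification by blast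
  have "\<forall>\<^sub>F i in sequentially. \<forall>x\<in>S. \<bar>prd x (u i) - bprd \<xi> x\<bar> \<le> \<delta>"
    using S bprd_near[OF \<xi> u] by (intro eventually_ball_finite) (auto simp: eventually_sequentially)
  moreover have "\<forall>\<^sub>F i in sequentially. T \<le> dist p (u i)"
  proof -
    obtain N where N: "\<forall>i\<ge>N. \<forall>j\<ge>N. T \<le> prd (u i) (u j)"
      using representatives_converge[OF \<xi> u] converges_to_infinity_iff by blast
    then have "T \<le> dist p (u i)" if "i \<ge> N" for i
      using that gromov_product_self[of p "u i"] by metis
    then show ?thesis by (auto simp: eventually_sequentially)
  qed
  ultimately have "\<forall>\<^sub>F i in sequentially. T \<le> dist p (u i) \<and> (\<forall>x\<in>S. \<bar>prd x (u i) - bprd \<xi> x\<bar> \<le> \<delta>)"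
    by eventually_elim simp
  then show ?thesis by (auto simp: eventually_sequentially)
qed

lemma prd_ge_min_bprd:
  assumes \<xi>: "\<xi> \<in> gromov_boundary p"
  shows "min (bprd \<xi> x) (bprd \<xi> y) - 2 * \<delta> \<le> prd x y"
proof -
  obtain z where "\<bar>prd x z - bprd \<xi> x\<bar> \<le> \<delta>" "\<bar>prd y z - bprd \<xi> y\<bar> \<le> \<delta>"
    using bprd_approx[OF \<xi>, of "{x, y}" 0] by auto
  then show ?thesis using hyperbolic[of p x z y] gromov_product_commute[of p z y] by linarith
qed

lemma bprd_ge_min:
  assumes \<xi>: "\<xi> \<in> gromov_boundary p"
  shows "min (prd x y) (bprd \<xi> y) - 3 * \<delta> \<le> bprd \<xi> x"
proof -
  obtain z where "\<bar>prd x z - bprd \<xi> x\<bar> \<le> \<delta>" "\<bar>prd y z - bprd \<xi> y\<bar> \<le> \<delta>"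
    using bprd_approx[OF \<xi>, of "{x, y}" 0] by auto
  then show ?thesis using hyperbolic[of p x y z] delta_nonneg by linarith
qed

lemma bus_Lipschitz:
  assumes \<xi>: "\<xi> \<in> gromov_boundary p"
  shows "\<bar>bus \<xi> x - bus \<xi> y\<bar> \<le> dist x y + 4 * \<delta>"
proof -
  obtain z where z: "\<bar>prd x z - bprd \<xi> x\<bar> \<le> \<delta>" "\<bar>prd y z - bprd \<xi> y\<bar> \<le> \<delta>"
    using bprd_approx[OF \<xi>, of "{x, y}" 0] by auto
  have "\<bar>dist x z - dist y z\<bar> \<le> dist x y"
    using dist_triangle[of x z y] dist_triangle[of y z x] by (simp add: abs_le_iff dist_commute)
  then show ?thesis using z by (simp add: gromov_product_def bus_eq abs_le_iff field_simps)
qed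

lemma limitin_boundary:
  assumes \<xi>: "\<xi> \<in> gromov_boundary p" and lim: "filterlim (\<lambda>n. bprd \<xi> (y n)) at_top sequentially"
  shows "limitin (bordif_topology p) (\<lambda>n. Inl (y n)) \<xi> sequentially"
  unfolding limitin_def
proof (intro conjI allI impI)
  show "\<xi> \<in> topspace (bordif_topology p)" using boundary_in_bordification[OF \<xi>] by simp
  fix U assume U: "openin (bordif_topology p) U \<and> \<xi> \<in> U"
  then obtain R where R: "{\<eta>\<in>bordification p. ext_gromov_product p \<xi> \<eta> > ereal R} \<subseteq> U"
    using \<xi> unfolding openin_bordif_topology by blast
  obtain u where u: "u \<in> representatives \<xi>"
    using representatives_nonempty \<xi> boundary_in_bordification by blast
  have "\<forall>\<^sub>F n in sequentially. R + 1 + \<delta> \<le> bprd \<xi> (y n)" using lim by (simp add: filterlim_at_top)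
  then show "\<forall>\<^sub>F n in sequentially. Inl (y n) \<in> U"
  proof eventually_elim
    case (elim n)
    obtain N where N: "\<forall>i\<ge>N. \<bar>prd (y n) (u i) - bprd \<xi> (y n)\<bar> \<le> \<delta>" using bprd_near[OF \<xi> u] by blast
    have "ereal R < ext_gromov_product p \<xi> (Inl (y n))"
    proof (rule ext_gromov_product_gtI[of u \<xi> "\<lambda>_. y n" _ R "R + 1" N])
      show "R + 1 \<le> prd (u i) (y n)" if "i \<ge> N" for i
        using N[rule_format, OF that] elim by (simp add: abs_le_iff gromov_product_commute)
    qed (use u in auto)
    then show ?case using R by auto
  qed
qed

section \<open>Measurability\<close>

lemma sets_bordif_borel: "openin (bordif_topology p) U \<Longrightarrow> U \<in> sets (bordif_borel p)"
  unfolding bordif_borel_def by (subst sets_measure_of) (auto simp: openin_bordif_topology)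

lemma space_bordif_borel [simp]: "space (bordif_borel p) = bordification p"
  unfolding bordif_borel_def by (rule space_measure_of) (auto simp: openin_bordif_topology)

lemma range_Inl_borel: "range Inl \<in> sets (bordif_borel p)"
proof -
  have "Inl -` (range Inl :: 'a bordif set) = UNIV" by blast
  then show ?thesis
    by (intro sets_bordif_borel, unfold openin_bordif_topology) (auto simp: gromov_boundary_def)
qed

lemma gromov_boundary_borel: "gromov_boundary p \<in> sets (bordif_borel p)"
proof -
  have "gromov_boundary p = space (bordif_borel p) - range Inl"
    by (auto simp: bordification_def gromov_boundary_def)
  then show ?thesis using range_Inl_borel by (metis sets.compl_sets)
qed

text \<open>An upper limit is upper semicontinuous: if the values at points of the space in an open
  \<open>U\<close> are at most \<open>L'\<close>, so is the Busemann function at every boundary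
  point in \<open>U\<close>. The gap between \<open>L'\<close> and \<open>L\<close> keeps the
  inequality strict, and the set is relatively open.\<close>

lemma bus_less_borel: "{\<xi>\<in>gromov_boundary p. bus \<xi> y < L} \<in> sets (bordif_borel p)"
proof -
  define \<U> where "\<U> = {U. openin (bordif_topology p) U \<and> (\<exists>L'<L. \<forall>z. Inl z \<in> U \<longrightarrow> dist y z - dist p z \<le> L')}"
  have "openin (bordif_topology p) (\<Union>\<U>)" by (rule openin_Union) (simp add: \<U>_def)
  moreover have "{\<xi>\<in>gromov_boundary p. bus \<xi> y < L} = gromov_boundary p \<inter> \<Union>\<U>"
  proof (intro equalityI subsetI)
    fix \<xi> assume "\<xi> \<in> {\<xi>\<in>gromov_boundary p. bus \<xi> y < L}"
    then have \<xi>: "\<xi> \<in> gromov_boundary p" "bus \<xi> y < L" by auto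
    obtain L' where L': "bus \<xi> y < L'" "L' < L" using \<xi>(2) dense by blast
    have "Limsup (tends_to_boundary p \<xi>) (\<lambda>z. ereal (dist y z - dist p z)) < ereal L'"
      using busemann_near(1)[OF \<xi>(1), of y] L' by (simp add: busemann_def)
    then have "\<forall>\<^sub>F z in tends_to_boundary p \<xi>. ereal (dist y z - dist p z) < ereal L'"
      by (rule Limsup_lessD)
    then obtain U where U: "openin (bordif_topology p) U" "\<xi> \<in> U" "\<forall>z. Inl z \<in> U \<longrightarrow> dist y z - dist p z \<le> L'"
      unfolding tends_to_boundary_def eventually_filtercomap eventually_nhdsin
      using boundary_in_bordification[OF \<xi>(1)] by (auto simp: less_imp_le)
    show "\<xi> \<in> gromov_boundary p \<inter> \<Union>\<U>" using U \<xi> L' unfolding \<U>_def by blast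
  next
    fix \<xi> assume "\<xi> \<in> gromov_boundary p \<inter> \<Union>\<U>"
    then obtain U L' where \<xi>: "\<xi> \<in> gromov_boundary p" "\<xi> \<in> U" and U: "openin (bordif_topology p) U"
      and L': "L' < L" "\<forall>z. Inl z \<in> U \<longrightarrow> dist y z - dist p z \<le> L'"
      unfolding \<U>_def by blast
    have "\<forall>\<^sub>F z in tends_to_boundary p \<xi>. ereal (dist y z - dist p z) \<le> ereal L'"
      unfolding tends_to_boundary_def eventually_filtercomap eventually_nhdsin
      using boundary_in_bordification[OF \<xi>(1)] U \<xi> L' by auto
    then have "busemann p \<xi> y p \<le> ereal L'" unfolding busemann_def by (rule Limsup_bounded)
    then show "\<xi> \<in> {\<xi>\<in>gromov_boundary p. bus \<xi> y < L}"
      using \<xi> L' by (simp add: busemann_near(1))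
  qed
  ultimately show ?thesis using sets_bordif_borel gromov_boundary_borel by auto
qed

lemma bus_le_borel: "{\<xi>\<in>gromov_boundary p. bus \<xi> y \<le> L} \<in> sets (bordif_borel p)"
proof -
  have "{\<xi>\<in>gromov_boundary p. bus \<xi> y \<le> L} = (\<Inter>n. {\<xi>\<in>gromov_boundary p. bus \<xi> y < L + 1 / real (Suc n)})"
  proof (intro equalityI subsetI)
    fix \<xi> assume *: "\<xi> \<in> (\<Inter>n. {\<xi>\<in>gromov_boundary p. bus \<xi> y < L + 1 / real (Suc n)})"
    then have "bus \<xi> y - L < 1 / real (Suc n)" for n by (auto simp: algebra_simps)
    then have "bus \<xi> y - L \<le> 0" by (meson nat_approx_posE less_asym not_le)
    then show "\<xi> \<in> {\<xi>\<in>gromov_boundary p. bus \<xi> y \<le> L}" using * by auto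
  qed (auto intro: le_less_trans)
  then show ?thesis using bus_less_borel by auto
qed

end

section \<open>Continuous functions on the bordification\<close>

text \<open>Frink's metrization argument: a chain from \<open>c a\<close> to \<open>c b\<close> is cut at the edge in the middle of its length.\<close>

lemma frink_chain_bound:
  fixes w :: "'b \<Rightarrow> 'b \<Rightarrow> real"
  assumes nonneg: "\<And>x y. 0 \<le> w x y" and refl: "\<And>x. w x x = 0"
    and three: "\<And>x y z t. w x t \<le> 2 * max (w x y) (max (w y z) (w z t))"
  shows "a \<le> b \<Longrightarrow> w (c a) (c b) \<le> 2 * (\<Sum>i=a..<b. w (c i) (c (Suc i)))"
proof (induction "b - a" arbitrary: a b rule: less_induct)
  case less
  show ?case
  proof (cases "a = b")
    case True
    then show ?thesis by (simp add: refl)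
  next
    case False
    define s where "s i j = (\<Sum>i=i..<j. w (c i) (c (Suc i)))" for i j
    \<comment> \<open>The last index whose initial sum is at most half of the total. By maximality
      the sum after the next edge is at most half as well, so the induction hypothesis bounds both
      outer terms by the total.\<close>
    define M where "M = {m\<in>{a..<b}. s a m \<le> s a b / 2}"
    have s0: "0 \<le> s i j" for i j by (simp add: s_def sum_nonneg nonneg)
    have "finite M" by (simp add: M_def)
    moreover have "a \<in> M" using False less.prems s0[of a b] by (simp add: M_def s_def)
    ultimately have "Max M \<in> M" and max: "\<And>m. m \<in> M \<Longrightarrow> m \<le> Max M" by (auto intro: Max_in)
    define m where "m = Max M"
    have m: "a \<le> m" "m < b" "s a m \<le> s a b / 2" using \<open>Max M \<in> M\<close> by (auto simp: M_def m_def)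
    have split: "s a b = s a m + w (c m) (c (Suc m)) + s (Suc m) b"
    proof -
      have "s a b = s a m + s m b" unfolding s_def using m by (simp add: sum.atLeastLessThan_concat)
      also have "s m b = w (c m) (c (Suc m)) + s (Suc m) b" unfolding s_def using m by (simp add: sum.atLeast_Suc_lessThan)
      finally show ?thesis by simp
    qed
    have right: "s (Suc m) b \<le> s a b / 2"
    proof (cases "Suc m = b")
      case True
      then show ?thesis using s0[of a b] by (simp add: s_def)
    next
      case False
      then have "Suc m \<notin> M" using max[of "Suc m"] by (auto simp: m_def)
      then have "s a b / 2 < s a (Suc m)" using m False by (simp add: M_def)
      also have "s a (Suc m) = s a m + w (c m) (c (Suc m))" unfolding s_def using m by simp
      finally show ?thesis using split by simp
    qed
    have "w (c a) (c m) \<le> 2 * s a m" using less.hyps[of m a] m by (simp add: s_def)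
    moreover have "w (c (Suc m)) (c b) \<le> 2 * s (Suc m) b" using less.hyps[of b "Suc m"] m by (simp add: s_def)
    moreover have "w (c m) (c (Suc m)) \<le> s a b" using split s0[of a m] s0[of "Suc m" b] by simp
    ultimately have "max (w (c a) (c m)) (max (w (c m) (c (Suc m))) (w (c (Suc m)) (c b))) \<le> s a b"
      using right m by simp
    then show ?thesis
      using three[of "c a" "c b" "c m" "c (Suc m)"] unfolding s_def[of a b, symmetric] by linarith
  qed
qed

text \<open>\<open>C x\<close> is the infimum of the lengths of chains from \<open>x\<close> to
  \<open>S\<close>. Chains give it the triangle inequality that \<open>w\<close> lacks, and
  \<open>frink_chain_bound\<close> keeps it at least half of the \<open>w\<close>-distance to
  \<open>S\<close>.\<close>

lemma frink_cost:
  fixes w :: "'b \<Rightarrow> 'b \<Rightarrow> real"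
  assumes nonneg: "\<And>x y. 0 \<le> w x y" and refl: "\<And>x. w x x = 0"
    and three: "\<And>x y z t. w x t \<le> 2 * max (w x y) (max (w y z) (w z t))"
    and S: "s \<in> S"
  obtains C :: "'b \<Rightarrow> real" where "\<And>x. 0 \<le> C x" "\<And>x. x \<in> S \<Longrightarrow> C x = 0" "\<And>x y. C x \<le> w x y + C y"
    "\<And>x \<tau>. (\<And>y. y \<in> S \<Longrightarrow> \<tau> \<le> w x y) \<Longrightarrow> \<tau> \<le> 2 * C x"
proof -
  define K where "K x = {(\<Sum>i=0..<n. w (c i) (c (Suc i))) |c n. c (0::nat) = x \<and> c n \<in> S}" for x
  define C where "C x = Inf (K x)" for x
  have K0: "0 \<le> k" if "k \<in> K x" for k x using that by (auto simp: K_def intro!: sum_nonneg nonneg)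
  have bdd: "bdd_below (K x)" for x using K0 by (rule bdd_belowI)
  have cons: "w x y + k \<in> K x" if k: "k \<in> K y" for x y k
  proof -
    obtain c n where c: "k = (\<Sum>i=0..<n. w (c i) (c (Suc i)))" "c 0 = y" "c n \<in> S"
      using k by (auto simp: K_def)
    let ?c = "case_nat x c"
    have "(\<Sum>i=0..<Suc n. w (?c i) (?c (Suc i))) = w x y + k"
      unfolding sum.atLeast0_lessThan_Suc_shift using c by simp
    moreover have "?c 0 = x" "?c (Suc n) \<in> S" using c by simp_all
    ultimately show ?thesis unfolding K_def by (intro CollectI exI[of _ ?c] exI[of _ "Suc n"]) simp
  qed
  have inS: "0 \<in> K x" if "x \<in> S" for x
    unfolding K_def by (intro CollectI exI[of _ "\<lambda>_. x"] exI[of _ "0::nat"]) (use that in simp)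
  have ne: "K x \<noteq> {}" for x using cons[OF inS[OF S], of x] by blast
  show ?thesis
  proof (rule that[of C])
    show "0 \<le> C x" for x unfolding C_def using K0 by (rule cInf_greatest[OF ne])
    show "C x = 0" if "x \<in> S" for x
      unfolding C_def using inS[OF that] K0 bdd by (intro antisym cInf_lower cInf_greatest[OF ne])
    show "C x \<le> w x y + C y" for x y
    proof -
      have "C x - w x y \<le> k" if "k \<in> K y" for k
        using cInf_lower[OF cons[OF that] bdd, of x] by (simp add: C_def)
      then have "C x - w x y \<le> C y" unfolding C_def[of y] by (rule cInf_greatest[OF ne])
      then show ?thesis by simp
    qed
    show "\<tau> \<le> 2 * C x" if \<tau>: "\<And>y. y \<in> S \<Longrightarrow> \<tau> \<le> w x y" for x \<tau>
    proof -
      have "\<tau> / 2 \<le> k" if k: "k \<in> K x" for k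
      proof -
        obtain c n where c: "k = (\<Sum>i=0..<n. w (c i) (c (Suc i)))" "c 0 = x" "c n \<in> S"
          using k by (auto simp: K_def)
        have "w (c 0) (c n) \<le> 2 * k" unfolding c(1) by (rule frink_chain_bound[OF nonneg refl three]) simp
        then show ?thesis using \<tau>[OF c(3)] c(2) by simp
      qed
      then have "\<tau> / 2 \<le> C x" unfolding C_def by (rule cInf_greatest[OF ne])
      then show ?thesis by simp
    qed
  qed
qed

context hyperbolic_space
begin

lemma continuous_bordif_borel:
  assumes "continuous_map (bordif_topology p) euclideanreal f"
  shows "f \<in> borel_measurable (bordif_borel p)"
proof (rule borel_measurableI)
  fix S :: "real set" assume "open S"
  then have "openin (bordif_topology p) {x \<in> topspace (bordif_topology p). f x \<in> S}"
    using assms by (simp add: continuous_map_def)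
  moreover have "{x \<in> topspace (bordif_topology p). f x \<in> S} = f -` S \<inter> space (bordif_borel p)" by auto
  ultimately show "f -` S \<inter> space (bordif_borel p) \<in> sets (bordif_borel p)"
    using sets_bordif_borel by metis
qed

text \<open>The hypothesis \<open>unif\<close> is uniform continuity at infinity: it makes the
  values along a representative Cauchy, the limit independent of the representative, and the
  extension continuous there.\<close>

lemma bordif_extension:
  fixes F :: "'a \<Rightarrow> real"
  assumes cont: "continuous_on UNIV F"
    and unif: "\<And>e. 0 < e \<Longrightarrow> \<exists>R. \<forall>x y. R < prd x y \<longrightarrow> \<bar>F x - F y\<bar> \<le> e"
  obtains f where "continuous_map (bordif_topology p) euclideanreal f" "\<And>x. f (Inl x) = F x"
    "\<And>\<xi> u. \<xi> \<in> bordification p \<Longrightarrow> u \<in> representatives \<xi> \<Longrightarrow> (\<lambda>i. F (u i)) \<longlonglongrightarrow> f \<xi>"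
proof -
  have bdry: "\<exists>l. \<forall>u\<in>representatives \<xi>. (\<lambda>i. F (u i)) \<longlonglongrightarrow> l" if \<xi>: "\<xi> \<in> gromov_boundary p" for \<xi>
  proof -
    have close: "\<exists>N. \<forall>i\<ge>N. \<forall>j\<ge>N. \<bar>F (u i) - F (v j)\<bar> \<le> e"
      if u: "u \<in> representatives \<xi>" and v: "v \<in> representatives \<xi>" and "0 < e" for u v e
    proof -
      obtain R where R: "\<And>x y. R < prd x y \<Longrightarrow> \<bar>F x - F y\<bar> \<le> e" using unif \<open>0 < e\<close> by blast
      obtain N where "\<forall>i\<ge>N. \<forall>j\<ge>N. R + 1 \<le> prd (u i) (v j)"
        using representatives_close[OF \<xi> u v] by blast
      then have "\<forall>i\<ge>N. \<forall>j\<ge>N. \<bar>F (u i) - F (v j)\<bar> \<le> e" using R by (smt (verit, best))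
      then show ?thesis by blast
    qed
    obtain u where u: "u \<in> representatives \<xi>"
      using representatives_nonempty \<xi> boundary_in_bordification by blast
    have "Cauchy (\<lambda>i. F (u i))"
    proof (rule metric_CauchyI)
      fix e :: real assume "0 < e"
      then obtain N where "\<forall>i\<ge>N. \<forall>j\<ge>N. \<bar>F (u i) - F (u j)\<bar> \<le> e / 2" using close[OF u u, of "e / 2"] by auto
      then have "\<forall>i\<ge>N. \<forall>j\<ge>N. dist (F (u i)) (F (u j)) < e"
        using \<open>0 < e\<close> by (auto simp: dist_real_def intro: le_less_trans[of _ "e / 2"])
      then show "\<exists>M. \<forall>m\<ge>M. \<forall>n\<ge>M. dist (F (u m)) (F (u n)) < e" by blast
    qed
    then obtain l where l: "(\<lambda>i. F (u i)) \<longlonglongrightarrow> l" by (auto simp: Cauchy_convergent_iff convergent_def)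
    have "(\<lambda>i. F (v i)) \<longlonglongrightarrow> l" if v: "v \<in> representatives \<xi>" for v
    proof (rule Lim_transform[OF l], rule LIMSEQ_I)
      fix e :: real assume "0 < e"
      then obtain N where "\<forall>i\<ge>N. \<forall>j\<ge>N. \<bar>F (u i) - F (v j)\<bar> \<le> e / 2" using close[OF u v, of "e / 2"] by auto
      then have "\<forall>i\<ge>N. norm (F (v i) - F (u i) - 0) < e"
        using \<open>0 < e\<close> by (auto simp: abs_minus_commute intro: le_less_trans[of _ "e / 2"])
      then show "\<exists>no. \<forall>n\<ge>no. norm (F (v n) - F (u n) - 0) < e" by blast
    qed
    then show ?thesis by blast
  qed
  define f where "f \<eta> = (case \<eta> of Inl x \<Rightarrow> F x | Inr X \<Rightarrow> (SOME l. \<forall>u\<in>X. (\<lambda>i. F (u i)) \<longlonglongrightarrow> l))" for \<eta> :: "'a bordif"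
  have lim: "(\<lambda>i. F (u i)) \<longlonglongrightarrow> f \<xi>" if "\<xi> \<in> bordification p" "u \<in> representatives \<xi>" for \<xi> u
  proof (cases "\<xi> \<in> gromov_boundary p")
    case True
    then obtain X where X: "\<xi> = Inr X" by (auto simp: gromov_boundary_def)
    have "\<forall>u\<in>X. (\<lambda>i. F (u i)) \<longlonglongrightarrow> f \<xi>"
      unfolding f_def X using someI_ex[OF bdry[OF True]] by (simp add: X)
    then show ?thesis using that X by simp
  next
    case False
    with that(1) obtain x where "\<xi> = Inl x" by (auto simp: bordification_def)
    then show ?thesis using that(2) by (simp add: f_def)
  qed
  have "continuous_map (bordif_topology p) euclideanreal f"
    unfolding continuous_map_def
  proof (intro conjI allI impI)
    show "f \<in> topspace (bordif_topology p) \<rightarrow> topspace euclideanreal" by simp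
    fix V :: "real set" assume "openin euclideanreal V"
    then have V: "open V" by simp
    show "openin (bordif_topology p) {x \<in> topspace (bordif_topology p). f x \<in> V}"
      unfolding openin_bordif_topology
    proof (intro conjI ballI)
      have "Inl -` {x \<in> topspace (bordif_topology p). f x \<in> V} = F -` V" by (auto simp: f_def)
      then show "open (Inl -` {x \<in> topspace (bordif_topology p). f x \<in> V})"
        using cont V by (simp add: continuous_on_open_vimage)
      fix \<xi> assume "\<xi> \<in> {x \<in> topspace (bordif_topology p). f x \<in> V} \<inter> gromov_boundary p"
      then have \<xi>: "\<xi> \<in> gromov_boundary p" "\<xi> \<in> bordification p" "f \<xi> \<in> V" by auto
      obtain e where e: "0 < e" "\<And>y. dist y (f \<xi>) < e \<Longrightarrow> y \<in> V" using V \<xi>(3) by (auto simp: open_dist)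
      obtain R where R: "\<And>x y. R < prd x y \<Longrightarrow> \<bar>F x - F y\<bar> \<le> e / 2" using unif[of "e / 2"] e by auto
      have "f \<eta> \<in> V" if \<eta>: "\<eta> \<in> bordification p" and near: "ereal (R + 2 * \<delta> + 1) < ext_gromov_product p \<xi> \<eta>" for \<eta>
      proof (rule e(2))
        obtain u v where u: "u \<in> representatives \<xi>" and v: "v \<in> representatives \<eta>"
          using representatives_nonempty \<xi>(2) \<eta> by blast
        obtain N where N: "\<And>i j. i \<ge> N \<Longrightarrow> j \<ge> N \<Longrightarrow> R + 2 * \<delta> + 1 - 2 * \<delta> \<le> prd (u i) (v j)"
          using ext_gromov_product_gtD[OF near \<xi>(2) \<eta> u v] by blast
        have "\<bar>F (v i) - F (u i)\<bar> \<le> e / 2" if "i \<ge> N" for i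
          using R[of "u i" "v i"] N[OF that that] by (simp add: abs_minus_commute)
        then have "\<exists>N. \<forall>i\<ge>N. \<bar>F (v i) - F (u i)\<bar> \<le> e / 2" by blast
        moreover have "(\<lambda>i. \<bar>F (v i) - F (u i)\<bar>) \<longlonglongrightarrow> \<bar>f \<eta> - f \<xi>\<bar>"
          by (intro tendsto_intros lim u v \<eta> \<xi>)
        ultimately have "\<bar>f \<eta> - f \<xi>\<bar> \<le> e / 2" by (intro LIMSEQ_le_const2) auto
        then show "dist (f \<eta>) (f \<xi>) < e" using e by (simp add: dist_real_def)
      qed
      then show "\<exists>R. {\<eta> \<in> bordification p. ereal R < ext_gromov_product p \<xi> \<eta>} \<subseteq> {x \<in> topspace (bordif_topology p). f x \<in> V}"
        by (intro exI[of _ "R + 2 * \<delta> + 1"]) auto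
    qed auto
  qed
  then show ?thesis by (rule that[of f]) (use lim in \<open>auto simp: f_def\<close>)
qed

text \<open>Three links lose \<open>2 * \<delta>\<close> in the product, and \<epsilon> is so small
  that this costs a factor of at most 2. The diagonal gets the value 0 separately, because
  \<open>prd x x = dist p x\<close> is finite.\<close>

lemma prd_quasi_ultrametric:
  obtains \<epsilon> where "0 < \<epsilon>"
    "\<And>x y z t. (if x = t then 0 else exp (- \<epsilon> * prd x t)) \<le>
      2 * max (if x = y then 0 else exp (- \<epsilon> * prd x y))
        (max (if y = z then 0 else exp (- \<epsilon> * prd y z)) (if z = t then 0 else exp (- \<epsilon> * prd z t)))"
proof -
  define \<epsilon> where "\<epsilon> = ln 2 / (2 * \<delta> + 1)"
  have \<epsilon>: "0 < \<epsilon>" "\<epsilon> * (2 * \<delta>) \<le> ln 2" using delta_nonneg by (simp_all add: \<epsilon>_def field_simps)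
  have scale: "exp (- \<epsilon> * b) \<le> 2 * exp (- \<epsilon> * a)" if "a - 2 * \<delta> \<le> b" for a b
  proof -
    have "\<epsilon> * (a - 2 * \<delta>) \<le> \<epsilon> * b" using \<epsilon>(1) that by (intro mult_left_mono) auto
    then have "- \<epsilon> * b \<le> ln 2 + - \<epsilon> * a" using \<epsilon>(2) by (simp add: algebra_simps)
    then have "exp (- \<epsilon> * b) \<le> exp (ln 2 + - \<epsilon> * a)" by (rule exp_le_cancel_iff[THEN iffD2])
    also have "\<dots> = 2 * exp (- \<epsilon> * a)" unfolding exp_add by simp
    finally show ?thesis .
  qed
  define w where "w x y = (if x = y then 0 else exp (- \<epsilon> * prd x y))" for x y
  have w0: "0 \<le> w x y" for x y by (simp add: w_def)
  have two: "w x z \<le> 2 * max (w x y) (w y z)" for x y z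
  proof (cases "x = z \<or> x = y \<or> y = z")
    case True
    then show ?thesis using w0[of x z] w0[of x y] by (auto simp: w_def le_max_iff_disj)
  next
    case False
    have "prd x y - 2 * \<delta> \<le> prd x z \<or> prd y z - 2 * \<delta> \<le> prd x z"
      using hyperbolic[of p x y z] delta_nonneg by linarith
    then have "w x z \<le> 2 * w x y \<or> w x z \<le> 2 * w y z" using scale False by (auto simp: w_def)
    then show ?thesis by auto
  qed
  have "w x t \<le> 2 * max (w x y) (max (w y z) (w z t))" for x y z t
  proof (cases "x = t \<or> x = y \<or> y = z \<or> z = t")
    case True
    then show ?thesis using w0[of x t] two[of y t z] two[of x t y] two[of x z y] by (auto simp: w_def[of x x] w_def[of t t])
  next
    case False
    have "prd x y - 2 * \<delta> \<le> prd x t \<or> prd y z - 2 * \<delta> \<le> prd x t \<or> prd z t - 2 * \<delta> \<le> prd x t"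
      using hyperbolic3[of p x y z t] by linarith
    then have "w x t \<le> 2 * w x y \<or> w x t \<le> 2 * w y z \<or> w x t \<le> 2 * w z t" using scale False by (auto simp: w_def)
    then show ?thesis by auto
  qed
  then show ?thesis using that[OF \<epsilon>(1)] unfolding w_def by blast
qed

text \<open>\<open>F0\<close> falls from 1 on \<open>S\<close> with the chain cost to
  \<open>S\<close>. If \<open>prd x z < t - \<delta>\<close>, hyperbolicity keeps the products of
  \<open>x\<close> with all of \<open>S\<close> below \<open>t\<close>, so the cost is at least
  \<tau> and \<open>F0\<close> vanishes; the further loss of 1 pays for continuity.\<close>

lemma prd_cutoff:
  assumes t: "t \<le> dist p z"
  obtains F :: "'a \<Rightarrow> real" where "continuous_on UNIV F" "\<And>e. 0 < e \<Longrightarrow> \<exists>R. \<forall>x y. R < prd x y \<longrightarrow> \<bar>F x - F y\<bar> \<le> e"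
    "\<And>x. 0 \<le> F x" "\<And>x. F x \<le> 1" "\<And>x. t \<le> prd x z \<Longrightarrow> F x = 1" "\<And>x. prd x z < t - \<delta> - 1 \<Longrightarrow> F x = 0"
proof -
  obtain \<epsilon> where \<epsilon>: "0 < \<epsilon>" and three: "\<And>x y z t. (if x = t then 0 else exp (- \<epsilon> * prd x t)) \<le>
      2 * max (if x = y then 0 else exp (- \<epsilon> * prd x y))
        (max (if y = z then 0 else exp (- \<epsilon> * prd y z)) (if z = t then 0 else exp (- \<epsilon> * prd z t)))"
    using prd_quasi_ultrametric by metis
  define w where "w x y = (if x = y then 0 else exp (- \<epsilon> * prd x y))" for x y
  define S where "S = {x. t \<le> prd x z}"
  have "z \<in> S" using t by (simp add: S_def)
  obtain C where C: "\<And>x. 0 \<le> C x" "\<And>x. x \<in> S \<Longrightarrow> C x = 0" "\<And>x y. C x \<le> w x y + C y"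
    "\<And>x \<tau>. (\<And>y. y \<in> S \<Longrightarrow> \<tau> \<le> w x y) \<Longrightarrow> \<tau> \<le> 2 * C x"
    by (rule frink_cost[of w, OF _ _ _ \<open>z \<in> S\<close>]) (use three in \<open>auto simp: w_def\<close>)
  define \<tau> where "\<tau> = exp (- \<epsilon> * t) / 2"
  have \<tau>: "0 < \<tau>" by (simp add: \<tau>_def)
  define F0 where "F0 x = max 0 (1 - C x / \<tau>)" for x
  have F0: "0 \<le> F0 x" "F0 x \<le> 1" for x using C(1)[of x] \<tau> by (auto simp: F0_def)
  have F0S: "F0 x = 1" if "t \<le> prd x z" for x using C(2)[of x] that by (simp add: F0_def S_def)
  have F0_zero: "F0 x = 0" if x: "prd x z < t - \<delta>" for x
  proof -
    have "exp (- \<epsilon> * t) \<le> w x y" if "y \<in> S" for y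
    proof -
      have "prd x y < t" "x \<noteq> y" using hyperbolic[of p x y z] that x delta_nonneg by (auto simp: S_def)
      then show ?thesis using \<epsilon> by (simp add: w_def)
    qed
    then have "\<tau> \<le> C x" using C(4)[of "exp (- \<epsilon> * t)" x] by (simp add: \<tau>_def)
    then show ?thesis using \<tau> by (simp add: F0_def)
  qed
  have F0_diff: "F0 x \<le> F0 y + w y x / \<tau>" for x y
  proof -
    have "C y / \<tau> \<le> (w y x + C x) / \<tau>" using C(3)[of y x] \<tau> by (intro divide_right_mono) auto
    moreover have "0 \<le> w y x / \<tau>" using \<tau> by (simp add: w_def)
    ultimately show ?thesis by (simp add: F0_def add_divide_distrib)
  qed
  \<comment> \<open>\<open>F0\<close> varies little at infinity but may be discontinuous; the supremum makes it Lipschitz.\<close>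
  define F where "F x = (SUP y. F0 y - dist x y)" for x
  have bdd: "bdd_above (range (\<lambda>y. F0 y - dist x y))" for x
    by (rule bdd_aboveI2[of _ _ 1]) (use F0 in \<open>smt (verit) zero_le_dist\<close>)
  have upper: "F0 y - dist x y \<le> F x" for x y unfolding F_def using bdd by (intro cSUP_upper) auto
  have F_ge: "F0 x \<le> F x" for x using upper[of x x] by simp
  have F_le: "F x \<le> k" if "\<And>y. F0 y - dist x y \<le> k" for x k unfolding F_def using that by (intro cSUP_least) auto
  have Lip: "\<bar>F x - F y\<bar> \<le> dist x y" for x y
  proof -
    have "F a \<le> F b + dist a b" for a b
    proof (rule F_le)
      show "F0 c - dist a c \<le> F b + dist a b" for c
        using upper[of c b] dist_triangle[of b c a] by (simp add: dist_commute)
    qed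
    from this[of x y] this[of y x] show ?thesis by (simp add: dist_commute abs_le_iff)
  qed
  show ?thesis
  proof (rule that[of F])
    show "continuous_on UNIV F"
      unfolding continuous_on_iff
      using Lip by (metis dist_commute dist_real_def order_le_less_trans)
    show "0 \<le> F x" for x using F_ge[of x] F0[of x] by simp
    show "F x \<le> 1" for x by (rule F_le) (use F0 in \<open>smt (verit) zero_le_dist\<close>)
    then show "F x = 1" if "t \<le> prd x z" for x using F_ge[of x] F0S[OF that] by (simp add: antisym)
    show "F x = 0" if x: "prd x z < t - \<delta> - 1" for x
    proof (rule antisym)
      show "F x \<le> 0"
      proof (rule F_le)
        fix y
        show "F0 y - dist x y \<le> 0"
        proof (cases "dist x y < 1")
          case True
          then have "prd y z < t - \<delta>"
            using gromov_product_Lipschitz[of p z x y] x by (simp add: gromov_product_commute)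
          then show ?thesis using F0_zero by simp
        next
          case False
          then show ?thesis using F0[of y] by simp
        qed
      qed
      show "0 \<le> F x" using F_ge[of x] F0[of x] by simp
    qed
    fix e :: real assume e: "0 < e"
    have "((\<lambda>R. exp (- \<epsilon> * (R - 1)) / \<tau>) \<longlongrightarrow> 0) at_top"
      using \<epsilon> \<tau> by real_asymp
    then have "\<forall>\<^sub>F R in at_top. exp (- \<epsilon> * (R - 1)) / \<tau> < e / 2"
      using e by (intro order_tendstoD) auto
    then obtain R where R: "exp (- \<epsilon> * (R - 1)) / \<tau> < e / 2" by (auto simp: eventually_at_top_linorder)
    have small: "w x y / \<tau> \<le> e / 2" if "R - 1 \<le> prd x y" for x y
    proof -
      have "w x y \<le> exp (- \<epsilon> * (R - 1))" using \<epsilon> that by (simp add: w_def)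
      then have "w x y / \<tau> \<le> exp (- \<epsilon> * (R - 1)) / \<tau>" using \<tau> by (intro divide_right_mono) auto
      then show ?thesis using R by linarith
    qed
    \<comment> \<open>In the supremum only points within distance 1 of \<open>x\<close> can beat
      \<open>F0 x\<close>. Far from \<open>p\<close> these have a large product with
      \<open>x\<close>, so \<open>F0\<close> hardly differs there.\<close>
    have near: "F x \<le> F0 x + e / 2" if x: "R < dist p x" for x
    proof (rule F_le)
      fix y
      show "F0 y - dist x y \<le> F0 x + e / 2"
      proof (cases "dist x y < 1")
        case True
        then have "R - 1 \<le> prd x y" using gromov_product_Lipschitz[of p x x y] x by simp
        then show ?thesis using small[of x y] F0_diff[of y x] zero_le_dist[of x y] by linarith
      next
        case False
        then show ?thesis using F0[of y] F0[of x] e by simp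
      qed
    qed
    have "\<bar>F x - F y\<bar> \<le> e" if xy: "R < prd x y" for x y
    proof -
      have "R < dist p x" "R < dist p y"
        using xy gromov_product_le_left[of p x y] gromov_product_le_right[of p x y] by auto
      then have "F x \<le> F0 x + e / 2" "F y \<le> F0 y + e / 2" using near by auto
      moreover have "F0 x \<le> F0 y + e / 2" "F0 y \<le> F0 x + e / 2"
        using F0_diff[of x y] F0_diff[of y x] small[of x y] small[of y x] xy gromov_product_commute[of p x y]
        by linarith+
      ultimately show ?thesis using F_ge[of x] F_ge[of y] by (simp add: abs_le_iff)
    qed
    then show "\<exists>R. \<forall>x y. R < prd x y \<longrightarrow> \<bar>F x - F y\<bar> \<le> e" by blast
  qed
qed

end

section \<open>Counting orbit points\<close>

lemma summable_on_finite_sum: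
  fixes f :: "'i \<Rightarrow> 'b \<Rightarrow> real"
  assumes "finite A" "\<And>z. z \<in> A \<Longrightarrow> f z summable_on S"
  shows "(\<lambda>g. \<Sum>z\<in>A. f z g) summable_on S"
    and "infsum (\<lambda>g. \<Sum>z\<in>A. f z g) S = (\<Sum>z\<in>A. infsum (f z) S)"
  using assms by (induction A rule: finite_induct) (simp_all add: summable_on_add infsum_add)

text \<open>Cocompactness enters as the density constant \<open>D\<close> of the orbit of
  \<open>p\<close>.\<close>

locale hyperbolic_action = hyperbolic_space p \<delta> + group G
  for p :: "'a::metric_space" and \<delta> :: real and G :: "('g, 'm) monoid_scheme" (structure) +
  fixes \<phi> :: "'g \<Rightarrow> 'a \<Rightarrow> 'a" and D :: real
  assumes proper_space: "proper_metric TYPE('a)" and geodesic: "geodesic_metric TYPE('a)"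
    and isometric: "isometric_action G \<phi>" and proper_act: "proper_action G \<phi>"
    and dense: "\<And>x. \<exists>g\<in>carrier G. dist x (\<phi> g p) \<le> D"
begin

lemma action: "group_action G UNIV \<phi>"
  using isometric by (simp add: isometric_action_def)

lemma act_dist: "g \<in> carrier G \<Longrightarrow> dist (\<phi> g x) (\<phi> g y) = dist x y"
  using isometric by (simp add: isometric_action_def)

lemma act_mult: "g \<in> carrier G \<Longrightarrow> h \<in> carrier G \<Longrightarrow> \<phi> (g \<otimes> h) x = \<phi> g (\<phi> h x)"
  using group_action.composition_rule[OF action, of x g h] by simp

lemma act_one: "\<phi> \<one> x = x"
  using group_action.id_eq_one[OF action] by (metis UNIV_I restrict_apply')

lemma act_inv: "g \<in> carrier G \<Longrightarrow> \<phi> (inv g) (\<phi> g x) = x"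
  using act_mult[of "inv g" g x] by (simp add: act_one)

lemma act_inv': "g \<in> carrier G \<Longrightarrow> \<phi> g (\<phi> (inv g) x) = x"
  using act_mult[of g "inv g" x] by (simp add: act_one)

lemma act_gromov_product:
  "g \<in> carrier G \<Longrightarrow> gromov_product (\<phi> g q) (\<phi> g x) (\<phi> g y) = gromov_product q x y"
  by (simp add: gromov_product_def act_dist)

lemma D_nonneg: "0 \<le> D"
  using dense[of p] zero_le_dist order_trans by blast

definition orb :: "'a set" where "orb = (\<lambda>g. \<phi> g p) ` carrier G"

definition cnt :: "real \<Rightarrow> nat" where "cnt r = card (orb \<inter> cball p r)"

definition omega :: real where "omega = growth_rate G \<phi> p"

lemma base_in_orb: "p \<in> orb"
  unfolding orb_def using act_one[of p] by (metis image_eqI one_closed)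

lemma act_orb: "g \<in> carrier G \<Longrightarrow> z \<in> orb \<Longrightarrow> \<phi> g z \<in> orb"
  unfolding orb_def by (auto simp: act_mult[symmetric] simp del: act_mult)

lemma orb_dense: "\<exists>z\<in>orb. dist x z \<le> D"
  using dense[of x] by (auto simp: orb_def)

lemma finite_act_ball: "finite {g\<in>carrier G. dist x (\<phi> g y) \<le> r}"
proof -
  define K where "K = cball x (max r (dist x y))"
  have "compact K" using proper_space by (simp add: K_def proper_metric_def)
  then have "finite {g\<in>carrier G. \<phi> g ` K \<inter> K \<noteq> {}}" using proper_act by (simp add: proper_action_def)
  moreover have "{g\<in>carrier G. dist x (\<phi> g y) \<le> r} \<subseteq> {g\<in>carrier G. \<phi> g ` K \<inter> K \<noteq> {}}"
  proof clarify
    fix g assume "dist x (\<phi> g y) \<le> r" and disj: "\<phi> g ` K \<inter> K = {}"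
    then have "\<phi> g y \<in> K" "y \<in> K" by (simp_all add: K_def)
    then show False using disj by blast
  qed
  ultimately show ?thesis by (rule finite_subset[rotated])
qed

lemma finite_orb_ball: "finite (orb \<inter> cball x r)"
proof -
  have "orb \<inter> cball x r \<subseteq> (\<lambda>g. \<phi> g p) ` {g\<in>carrier G. dist x (\<phi> g p) \<le> r}"
    by (auto simp: orb_def)
  then show ?thesis using finite_act_ball finite_surj by blast
qed

lemma card_orb_ball:
  assumes "z \<in> orb" shows "card (orb \<inter> cball z r) = cnt r"
proof -
  obtain g where g: "g \<in> carrier G" "z = \<phi> g p" using assms by (auto simp: orb_def)
  have "bij_betw (\<phi> g) (orb \<inter> cball p r) (orb \<inter> cball z r)"
  proof (rule bij_betw_byWitness[of _ "\<phi> (inv g)"])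
    show "\<phi> g ` (orb \<inter> cball p r) \<subseteq> orb \<inter> cball z r"
      using g by (auto simp: act_orb act_dist)
    show "\<phi> (inv g) ` (orb \<inter> cball z r) \<subseteq> orb \<inter> cball p r"
      using g act_dist[of "inv g" "\<phi> g p"] by (auto simp: act_orb act_inv)
  qed (use g in \<open>auto simp: act_inv act_inv'\<close>)
  then show ?thesis unfolding cnt_def by (metis bij_betw_same_card)
qed

lemma cnt_mono: "r \<le> r' \<Longrightarrow> cnt r \<le> cnt r'"
  unfolding cnt_def by (intro card_mono finite_orb_ball) auto

lemma cnt_ge_1: "0 \<le> r \<Longrightarrow> 1 \<le> cnt r"
  unfolding cnt_def using finite_orb_ball base_in_orb
  by (simp add: Suc_le_eq card_gt_0_iff) (metis Int_iff centre_in_cball empty_iff)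

text \<open>The only place where geodesics enter: the point at distance \<open>t\<close> from
  \<open>p\<close> on a geodesic to \<open>x\<close> is replaced by an orbit point within
  \<open>D\<close>.\<close>

lemma orb_between:
  assumes "0 \<le> t" "t \<le> dist p x"
  obtains z where "z \<in> orb" "\<bar>dist p z - t\<bar> \<le> D" "dist z x \<le> dist p x - t + D" "t - D \<le> prd x z"
proof -
  obtain c :: "real \<Rightarrow> 'a" where c: "c 0 = p" "c (dist p x) = x"
    "\<And>s t. s \<in> {0..dist p x} \<Longrightarrow> t \<in> {0..dist p x} \<Longrightarrow> dist (c s) (c t) = \<bar>s - t\<bar>"
    using geodesic unfolding geodesic_metric_def by metis
  obtain z where z: "z \<in> orb" "dist (c t) z \<le> D" using orb_dense by blast
  have 1: "dist p (c t) = t" "dist (c t) x = dist p x - t"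
    using c(3)[of 0 t] c(3)[of t "dist p x"] c(1,2) assms by auto
  have 2: "\<bar>dist p z - t\<bar> \<le> D" using z 1 dist_triangle[of p z "c t"] dist_triangle[of p "c t" z]
    by (simp add: dist_commute abs_le_iff)
  have 3: "dist z x \<le> dist p x - t + D" using z 1 dist_triangle[of z x "c t"] by (simp add: dist_commute)
  have "t - D \<le> prd x z" using 2 3 by (simp add: gromov_product_def dist_commute abs_le_iff)
  then show ?thesis using that z 2 3 by blast
qed

lemma cnt_submult:
  assumes "0 \<le> a" "0 \<le> b" shows "cnt (a + b) \<le> cnt (a + D) * cnt (b + D)"
proof -
  have "orb \<inter> cball p (a + b) \<subseteq> (\<Union>z\<in>orb \<inter> cball p (a + D). orb \<inter> cball z (b + D))"
  proof
    fix x assume x: "x \<in> orb \<inter> cball p (a + b)"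
    obtain z where "z \<in> orb" "\<bar>dist p z - min a (dist p x)\<bar> \<le> D" "dist z x \<le> dist p x - min a (dist p x) + D"
      using orb_between[of "min a (dist p x)" x] assms by auto
    then show "x \<in> (\<Union>z\<in>orb \<inter> cball p (a + D). orb \<inter> cball z (b + D))"
      using x assms by (intro UN_I[of z]) auto
  qed
  then have "cnt (a + b) \<le> card (\<Union>z\<in>orb \<inter> cball p (a + D). orb \<inter> cball z (b + D))"
    unfolding cnt_def by (intro card_mono finite_UN_I finite_orb_ball)
  also have "\<dots> \<le> (\<Sum>z\<in>orb \<inter> cball p (a + D). card (orb \<inter> cball z (b + D)))"
    by (rule card_UN_le) (rule finite_orb_ball)
  also have "\<dots> = cnt (a + D) * cnt (b + D)" by (simp add: card_orb_ball) (simp add: cnt_def)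
  finally show ?thesis .
qed

text \<open>Both radii in \<open>cnt_submult\<close> grow by \<open>D\<close>. Adding twice the
  rounded \<open>D\<close> to every radius absorbs this and makes the counts
  submultiplicative.\<close>

definition offset :: nat where "offset = 2 * nat \<lceil>D\<rceil>"

lemma cnt_offset_submult: "cnt (real (n + m + offset)) \<le> cnt (real (n + offset)) * cnt (real (m + offset))"
proof -
  define k where "k = nat \<lceil>D\<rceil>"
  have k: "D \<le> real k" unfolding k_def by linarith
  have "cnt (real (n + m + offset)) = cnt (real (n + k) + real (m + k))" by (simp add: offset_def k_def algebra_simps)
  also have "\<dots> \<le> cnt (real (n + k) + D) * cnt (real (m + k) + D)" by (rule cnt_submult) auto
  also have "\<dots> \<le> cnt (real (n + offset)) * cnt (real (m + offset))"
    using k by (intro mult_mono cnt_mono) (auto simp: offset_def k_def)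
  finally show ?thesis .
qed

lemma cnt_offset_power: "cnt (real (m * j + i + offset)) \<le> cnt (real (m + offset)) ^ j * cnt (real (i + offset))"
proof (induction j)
  case 0
  then show ?case by simp
next
  case (Suc j)
  have "cnt (real (m * Suc j + i + offset)) = cnt (real (m + (m * j + i) + offset))" by (simp add: algebra_simps)
  also have "\<dots> \<le> cnt (real (m + offset)) * cnt (real (m * j + i + offset))" by (rule cnt_offset_submult)
  also have "\<dots> \<le> cnt (real (m + offset)) * (cnt (real (m + offset)) ^ j * cnt (real (i + offset)))"
    using Suc by (rule mult_left_mono) simp
  finally show ?case by (simp add: mult.assoc)
qed

lemma growth_set: "{\<phi> g p |g. g \<in> carrier G \<and> dist p (\<phi> g p) \<le> r} = orb \<inter> cball p r"
  by (auto simp: orb_def)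

text \<open>Fekete's argument with division of \<open>n\<close> by \<open>m\<close>. As each single
  count bounds the upper limit, reading the inequality backwards yields \<open>cnt_lower\<close>,
  without subexponential loss.\<close>

lemma limsup_growth_le:
  assumes m: "0 < m"
  shows "limsup (\<lambda>n. ereal (1 / real n * ln (real (cnt (real n))))) \<le> ereal (ln (real (cnt (real (m + offset)))) / real m)"
proof -
  let ?r = "real (cnt (real (m + offset)))"
  have r1: "1 \<le> ?r" using cnt_ge_1[of "real (m + offset)"] by simp
  have le: "1 / real n * ln (real (cnt (real n))) \<le> ln ?r / real m + ln ?r / real n" if n: "0 < n" for n
  proof -
    have "cnt (real n) \<le> cnt (real (m * (n div m) + n mod m + offset))" by (intro cnt_mono) simp
    also have "\<dots> \<le> cnt (real (m + offset)) ^ (n div m) * cnt (real (n mod m + offset))" by (rule cnt_offset_power)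
    also have "\<dots> \<le> cnt (real (m + offset)) ^ (n div m) * cnt (real (m + offset))"
      using m by (intro mult_left_mono cnt_mono) (auto intro: less_imp_le)
    finally have "real (cnt (real n)) \<le> ?r ^ Suc (n div m)"
      by (metis mult.commute of_nat_le_iff of_nat_power power_Suc)
    then have "ln (real (cnt (real n))) \<le> ln (?r ^ Suc (n div m))"
      using cnt_ge_1[of "real n"] r1 by (subst ln_le_cancel_iff) auto
    also have "\<dots> = real (Suc (n div m)) * ln ?r" using r1 by (subst ln_realpow) auto
    also have "\<dots> \<le> (real n / real m + 1) * ln ?r"
    proof (rule mult_right_mono)
      have "real (n div m) * real m \<le> real n"
        by (metis div_times_less_eq_dividend of_nat_le_iff of_nat_mult)
      then show "real (Suc (n div m)) \<le> real n / real m + 1" using m by (simp add: field_simps)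
    qed (use r1 in simp)
    finally show ?thesis using n m by (simp add: field_simps)
  qed
  have "limsup (\<lambda>n. ereal (1 / real n * ln (real (cnt (real n))))) \<le> limsup (\<lambda>n. ereal (ln ?r / real m + ln ?r / real n))"
    by (rule Limsup_mono) (use le in \<open>auto simp: eventually_sequentially intro!: exI[of _ 1]\<close>)
  also have "\<dots> = ereal (ln ?r / real m)"
  proof (rule lim_imp_Limsup)
    have "(\<lambda>n. ln ?r / real m + ln ?r / real n) \<longlonglongrightarrow> ln ?r / real m + 0"
      by (intro tendsto_add tendsto_const lim_const_over_n)
    then show "(\<lambda>n. ereal (ln ?r / real m + ln ?r / real n)) \<longlonglongrightarrow> ereal (ln ?r / real m)" by simp
  qed simp
  finally show ?thesis .
qed

lemma limsup_growth: "limsup (\<lambda>n. ereal (1 / real n * ln (real (cnt (real n))))) = ereal omega"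
  and omega_nonneg: "0 \<le> omega"
proof -
  let ?l = "limsup (\<lambda>n. ereal (1 / real n * ln (real (cnt (real n)))))"
  have "\<forall>\<^sub>F n in sequentially. 0 \<le> ereal (1 / real n * ln (real (cnt (real n))))"
    using cnt_ge_1 by (intro always_eventually allI) (simp add: zero_ereal_def)
  then have l0: "0 \<le> ?l" by (intro le_Limsup) simp
  have "?l \<le> ereal (ln (real (cnt (real (1 + offset)))) / real 1)" by (rule limsup_growth_le) simp
  then obtain l where l: "?l = ereal l" using l0 by (cases ?l) auto
  have "omega = real_of_ereal ?l" unfolding omega_def growth_rate_def growth_set cnt_def ..
  then show "?l = ereal omega" "0 \<le> omega" using l l0 by simp_all
qed

lemma cnt_lower:
  assumes "0 \<le> t" shows "exp (omega * (t - 1 - real offset)) \<le> real (cnt t)"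
proof (cases "offset \<le> nat \<lfloor>t\<rfloor>")
  case True
  define m where "m = nat \<lfloor>t\<rfloor> - offset"
  have le: "exp (omega * real m) \<le> real (cnt (real (m + offset)))"
  proof (cases "m = 0")
    case True
    then show ?thesis using cnt_ge_1[of "real offset"] by simp
  next
    case False
    have r: "1 \<le> real (cnt (real (m + offset)))" using cnt_ge_1[of "real (m + offset)"] by simp
    have "omega \<le> ln (real (cnt (real (m + offset)))) / real m"
      using limsup_growth_le[of m] False unfolding limsup_growth by simp
    then have "omega * real m \<le> ln (real (cnt (real (m + offset))))" using False by (simp add: field_simps)
    then show ?thesis using r by (metis exp_le_cancel_iff exp_ln less_le_trans zero_less_one)
  qed
  have "omega * (t - 1 - real offset) \<le> omega * real m"
  proof (rule mult_left_mono[OF _ omega_nonneg])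
    show "t - 1 - real offset \<le> real m" using True assms unfolding m_def by linarith
  qed
  then have "exp (omega * (t - 1 - real offset)) \<le> exp (omega * real m)" by simp
  also note le
  also have "real (cnt (real (m + offset))) \<le> real (cnt t)"
    using True assms by (intro of_nat_mono cnt_mono) (simp add: m_def)
  finally show ?thesis .
next
  case False
  then have "t - 1 - real offset \<le> 0" by linarith
  then have "exp (omega * (t - 1 - real offset)) \<le> 1" using omega_nonneg by (simp add: mult_nonneg_nonpos)
  also have "1 \<le> real (cnt t)" using cnt_ge_1[OF assms] by simp
  finally show ?thesis .
qed

lemma cnt_upper_weak:
  assumes s: "omega < s"
  obtains C where "0 < C" "\<And>t. 0 \<le> t \<Longrightarrow> real (cnt t) \<le> C * exp (s * t)"
proof -
  have s0: "0 < s" using omega_nonneg s by simp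
  have "limsup (\<lambda>n. ereal (1 / real n * ln (real (cnt (real n))))) < ereal s"
    unfolding limsup_growth using s by simp
  then have "\<forall>\<^sub>F n in sequentially. ereal (1 / real n * ln (real (cnt (real n)))) < ereal s" by (rule Limsup_lessD)
  then obtain N where N: "\<And>n. n \<ge> N \<Longrightarrow> 1 / real n * ln (real (cnt (real n))) < s"
    by (auto simp: eventually_sequentially)
  define C where "C = real (cnt (real N)) * exp s"
  have "real (cnt (real n)) \<le> real (cnt (real N)) * exp (s * real n)" for n
  proof (cases "n \<ge> N \<and> n > 0")
    case True
    then have "ln (real (cnt (real n))) \<le> s * real n" using N[of n] by (simp add: field_simps)
    then have "real (cnt (real n)) \<le> exp (s * real n)"
      using cnt_ge_1[of "real n"] by (metis exp_ge_zero exp_le_cancel_iff exp_ln less_le_trans of_nat_0_le_iff of_nat_0_less_iff zero_less_one)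
    also have "\<dots> \<le> real (cnt (real N)) * exp (s * real n)" using cnt_ge_1[of "real N"] by simp
    finally show ?thesis .
  next
    case False
    then have "cnt (real n) \<le> cnt (real N)" by (intro cnt_mono) auto
    then have "real (cnt (real n)) * 1 \<le> real (cnt (real N)) * exp (s * real n)"
      using s0 by (intro mult_mono) auto
    then show ?thesis by simp
  qed
  then have "real (cnt t) \<le> C * exp (s * t)" if "0 \<le> t" for t
  proof -
    have "real (cnt t) \<le> real (cnt (real (nat \<lceil>t\<rceil>)))" by (intro of_nat_mono cnt_mono) linarith
    also have "\<dots> \<le> real (cnt (real N)) * exp (s * real (nat \<lceil>t\<rceil>))" by fact
    also have "\<dots> \<le> real (cnt (real N)) * exp (s * (1 + t))"
      using s0 that by (intro mult_left_mono iffD2[OF exp_le_cancel_iff] mult_left_mono) (auto, linarith)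
    finally show ?thesis by (simp add: C_def exp_add algebra_simps)
  qed
  moreover have "0 < C" using cnt_ge_1[of "real N"] by (simp add: C_def)
  ultimately show ?thesis by (rule that[rotated])
qed

section \<open>The Poincare series\<close>

definition wt :: "real \<Rightarrow> 'g \<Rightarrow> real" where "wt s g = exp (- s * dist p (\<phi> g p))"

definition stab :: nat where "stab = card {g\<in>carrier G. \<phi> g p = p}"

text \<open>Multiplying by \<open>inv (h \<otimes> k)\<close> on the left and \<open>k\<close> on
  the right maps the elements taking \<open>x\<close> to \<open>y\<close> injectively into the
  stabiliser of \<open>p\<close>. It links sums over group elements, as in the Poincare series, to
  \<open>cnt\<close>, which counts points.\<close>

lemma card_act_eq: "finite {g\<in>carrier G. \<phi> g x = y}" "x \<in> orb \<Longrightarrow> card {g\<in>carrier G. \<phi> g x = y} \<le> stab"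
proof -
  have fin: "finite {g\<in>carrier G. \<phi> g x = y}" for x y
    by (rule finite_subset[OF _ finite_act_ball[of y x 0]]) auto
  then show "finite {g\<in>carrier G. \<phi> g x = y}" .
  show "card {g\<in>carrier G. \<phi> g x = y} \<le> stab" if x: "x \<in> orb"
  proof (cases "{g\<in>carrier G. \<phi> g x = y} = {}")
    case False
    then obtain h where h: "h \<in> carrier G" "\<phi> h x = y" by blast
    obtain k where k: "k \<in> carrier G" "x = \<phi> k p" using x by (auto simp: orb_def)
    let ?f = "\<lambda>g. inv (h \<otimes> k) \<otimes> (g \<otimes> k)"
    have "inj_on ?f {g\<in>carrier G. \<phi> g x = y}"
    proof (rule inj_onI)
      fix g g' assume gg: "g \<in> {g \<in> carrier G. \<phi> g x = y}" "g' \<in> {g \<in> carrier G. \<phi> g x = y}"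
        and "?f g = ?f g'"
      then have "g \<otimes> k = g' \<otimes> k" using gg h k by simp
      then show "g = g'" using gg k by simp
    qed
    moreover have "?f ` {g\<in>carrier G. \<phi> g x = y} \<subseteq> {g\<in>carrier G. \<phi> g p = p}"
    proof clarify
      fix g assume g: "g \<in> carrier G" "y = \<phi> g x"
      have "\<phi> (?f g) p = \<phi> (inv (h \<otimes> k)) (\<phi> g x)" using g h k by (simp add: act_mult)
      also have "\<phi> g x = \<phi> (h \<otimes> k) p" using g h k by (simp add: act_mult)
      finally show "?f g \<in> carrier G \<and> \<phi> (?f g) p = p" using g h k by (simp add: act_inv)
    qed
    ultimately show ?thesis unfolding stab_def using fin[of p p] by (intro card_inj_on_le) auto
  next
    case True
    then show ?thesis by (simp only: True card.empty)
  qed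
qed

lemma card_act_ball: "card {g\<in>carrier G. dist p (\<phi> g p) \<le> r} \<le> stab * cnt r"
proof -
  have "{g\<in>carrier G. dist p (\<phi> g p) \<le> r} = (\<Union>z\<in>orb \<inter> cball p r. {g\<in>carrier G. \<phi> g p = z})"
    by (auto simp: orb_def)
  then have "card {g\<in>carrier G. dist p (\<phi> g p) \<le> r} \<le> (\<Sum>z\<in>orb \<inter> cball p r. card {g\<in>carrier G. \<phi> g p = z})"
    using card_UN_le[OF finite_orb_ball] by simp
  also have "\<dots> \<le> of_nat (card (orb \<inter> cball p r)) * stab"
    using card_act_eq(2)[OF base_in_orb] by (intro sum_bounded_above) auto
  finally show ?thesis by (simp add: cnt_def mult.commute)
qed

lemma wt_pos: "0 < wt s g" and wt_nonneg: "0 \<le> wt s g" by (simp_all add: wt_def)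

text \<open>With \<open>s'\<close> strictly between \<open>omega\<close> and \<open>s\<close>, level
  \<open>k\<close> holds at most a multiple of \<open>exp (s' * k)\<close> elements, each of weight
  at most \<open>exp (- s * k)\<close>: a geometric series of ratio \<open>q\<close>.\<close>

lemma wt_summable:
  assumes s: "omega < s" shows "wt s summable_on carrier G"
proof -
  define s' where "s' = (omega + s) / 2"
  have s': "omega < s'" "s' < s" "0 < s" using s omega_nonneg by (auto simp: s'_def)
  obtain C where C: "0 < C" "\<And>t. 0 \<le> t \<Longrightarrow> real (cnt t) \<le> C * exp (s' * t)" using cnt_upper_weak[OF s'(1)] by blast
  define q where "q = exp (s' - s)"
  have q: "0 < q" "q < 1" using s' by (auto simp: q_def)
  define B where "B = real stab * C * exp s' / (1 - q)"
  have "sum (wt s) F \<le> B" if F: "F \<subseteq> carrier G" "finite F" for F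
  proof -
    define lev where "lev g = nat \<lfloor>dist p (\<phi> g p)\<rfloor>" for g
    have level: "sum (wt s) {g\<in>F. lev g = k} \<le> real stab * C * exp s' * q ^ k" for k
    proof -
      have "sum (wt s) {g\<in>F. lev g = k} \<le> real (card {g\<in>F. lev g = k}) * exp (- s * real k)"
      proof (rule sum_bounded_above)
        fix g assume "g \<in> {g\<in>F. lev g = k}"
        then have "real k \<le> dist p (\<phi> g p)" by (auto simp: lev_def)
        then show "wt s g \<le> exp (- s * real k)" using s' by (simp add: wt_def)
      qed
      also have "card {g\<in>F. lev g = k} \<le> card {g\<in>carrier G. dist p (\<phi> g p) \<le> 1 + real k}"
        using F by (intro card_mono finite_act_ball) (auto simp: lev_def, linarith)
      also have "\<dots> \<le> stab * cnt (1 + real k)" by (rule card_act_ball)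
      also have "real (stab * cnt (1 + real k)) \<le> real stab * (C * exp (s' * (1 + real k)))"
        using C(2)[of "1 + real k"] by (simp add: mult_left_mono)
      also have "real stab * (C * exp (s' * (1 + real k))) * exp (- s * real k) = real stab * C * exp s' * q ^ k"
        by (simp add: q_def exp_of_nat_mult[symmetric] exp_add[symmetric] algebra_simps mult_exp_exp)
      finally show ?thesis by simp
    qed
    have "sum (wt s) F = (\<Sum>k\<in>lev ` F. sum (wt s) {g\<in>F. lev g = k})" by (rule sum.image_gen[OF F(2)])
    also have "\<dots> \<le> (\<Sum>k\<in>lev ` F. real stab * C * exp s' * q ^ k)" using level by (rule sum_mono)
    also have "\<dots> = real stab * C * exp s' * (\<Sum>k\<in>lev ` F. q ^ k)" by (simp add: sum_distrib_left)
    also have "\<dots> \<le> real stab * C * exp s' * (1 / (1 - q))"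
    proof (intro mult_left_mono)
      have "(\<Sum>k\<in>lev ` F. q ^ k) \<le> (\<Sum>k. q ^ k)" using q F by (intro sum_le_suminf) (auto intro: summable_geometric)
      also have "\<dots> = 1 / (1 - q)" using q by (intro suminf_geometric) auto
      finally show "(\<Sum>k\<in>lev ` F. q ^ k) \<le> 1 / (1 - q)" .
    qed (use C in auto)
    finally show ?thesis by (simp add: B_def)
  qed
  then have "bdd_above (sum (wt s) ` {F. F \<subseteq> carrier G \<and> finite F})" by (intro bdd_aboveI2[of _ _ B]) auto
  then show ?thesis using wt_nonneg by (intro nonneg_bdd_above_summable_on) auto
qed

definition poin :: "real \<Rightarrow> real" where "poin s = infsum (wt s) (carrier G)"

lemma poin_eq: "poincare_series G \<phi> p s = poin s"
  by (simp add: poincare_series_def poin_def wt_def[abs_def])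

lemma wt_summable_sub: "omega < s \<Longrightarrow> A \<subseteq> carrier G \<Longrightarrow> wt s summable_on A"
  using wt_summable summable_on_subset_banach by blast

lemma sum_wt_le_poin: "omega < s \<Longrightarrow> F \<subseteq> carrier G \<Longrightarrow> finite F \<Longrightarrow> sum (wt s) F \<le> poin s"
  unfolding poin_def using wt_summable wt_nonneg by (intro finite_sum_le_infsum) auto

lemma poin_pos: "omega < s \<Longrightarrow> 0 < poin s"
  using sum_wt_le_poin[of s "{\<one>}"] wt_pos[of s \<one>] by simp

lemma poin_translate:
  assumes k: "k \<in> carrier G" shows "infsum (\<lambda>g. wt s (k \<otimes> g)) (carrier G) = poin s"
    and "omega < s \<Longrightarrow> (\<lambda>g. wt s (k \<otimes> g)) summable_on carrier G"
proof -
  have bij: "bij_betw ((\<otimes>) k) (carrier G) (carrier G)"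
    by (rule bij_betw_byWitness[of _ "(\<otimes>) (inv k)"]) (use k in \<open>auto simp: m_assoc[symmetric]\<close>)
  show "infsum (\<lambda>g. wt s (k \<otimes> g)) (carrier G) = poin s"
    unfolding poin_def using infsum_reindex_bij_betw[OF bij, of "wt s"] by simp
  show "(\<lambda>g. wt s (k \<otimes> g)) summable_on carrier G" if "omega < s"
    using summable_on_reindex_bij_betw[OF bij, of "wt s"] wt_summable[OF that] by simp
qed

section \<open>Shadows of orbit points and purely exponential growth\<close>

definition orbit_shadow :: "'a \<Rightarrow> real \<Rightarrow> 'g set" where
  "orbit_shadow z r = {g\<in>carrier G. dist p z - r \<le> prd (\<phi> g p) z}"

lemma orbit_shadow_subset: "orbit_shadow z r \<subseteq> carrier G" by (auto simp: orbit_shadow_def)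

text \<open>Points of the shadow are closer to \<open>z = \<phi> k p\<close> than to
  \<open>p\<close> by at least \<open>dist p z - 2 * r\<close>; the weights translated by
  \<open>inv k\<close>, summed over the whole group, give the full series again.\<close>

lemma orbit_shadow_upper:
  assumes z: "z \<in> orb" and s: "omega < s"
  shows "infsum (wt s) (orbit_shadow z r) \<le> exp (2 * s * r - s * dist p z) * poin s"
proof -
  obtain k where k: "k \<in> carrier G" "z = \<phi> k p" using z by (auto simp: orb_def)
  let ?c = "exp (2 * s * r - s * dist p z)"
  have "infsum (wt s) (orbit_shadow z r) \<le> infsum (\<lambda>g. ?c * wt s (inv k \<otimes> g)) (carrier G)"
  proof (rule infsum_mono_neutral)
    show "wt s summable_on orbit_shadow z r" using wt_summable_sub[OF s orbit_shadow_subset] .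
    show "(\<lambda>g. ?c * wt s (inv k \<otimes> g)) summable_on carrier G"
      using poin_translate(2)[of "inv k" s] k s by (intro summable_on_cmult_right) auto
    show "wt s g \<le> ?c * wt s (inv k \<otimes> g)" if "g \<in> orbit_shadow z r \<inter> carrier G" for g
    proof -
      have g: "g \<in> carrier G" "dist p z - r \<le> prd (\<phi> g p) z" using that by (auto simp: orbit_shadow_def)
      have "dist p (\<phi> (inv k \<otimes> g) p) = dist (\<phi> k p) (\<phi> k (\<phi> (inv k \<otimes> g) p))" using k by (simp add: act_dist)
      also have "\<dots> = dist z (\<phi> g p)" using k g by (simp add: act_mult act_inv')
      also have "\<dots> \<le> dist p (\<phi> g p) - dist p z + 2 * r"
        using g(2) by (simp add: gromov_product_def dist_commute field_simps)
      finally have "s * dist p (\<phi> (inv k \<otimes> g) p) \<le> s * (dist p (\<phi> g p) - dist p z + 2 * r)"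
        using omega_nonneg s by (intro mult_left_mono) auto
      then show ?thesis unfolding wt_def exp_add[symmetric] by (simp add: algebra_simps)
    qed
  qed (auto simp: orbit_shadow_def wt_nonneg)
  also have "\<dots> = ?c * poin s"
    using k by (simp add: infsum_cmult_right' poin_translate(1))
  finally show ?thesis .
qed

text \<open>The complement of the pulled back shadow lies in the shadow of a single orbit point at distance about \<open>r\<close>.\<close>

lemma orbit_shadow_lower:
  assumes om: "0 < omega"
  obtains r where "0 \<le> r" "\<And>z s. z \<in> orb \<Longrightarrow> omega < s \<Longrightarrow> exp (- s * dist p z) / 2 * poin s \<le> infsum (wt s) (orbit_shadow z r)"
proof -
  define e where "e = 2 * (2 * D + \<delta>)"
  \<comment> \<open>The shadow of \<open>v\<close> with parameter \<open>2 * D + \<delta>\<close>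
    has an upper bound with factor \<open>exp (s * e)\<close>. With
    \<open>dist p v \<ge> r - D\<close> this choice leaves at most half of the series, for every
    \<open>s > omega\<close>.\<close>
  define r where "r = D + e + ln 2 / omega"
  have e0: "0 \<le> e" using D_nonneg delta_nonneg by (simp add: e_def)
  have r0: "0 \<le> r" using D_nonneg om e0 by (simp add: r_def)
  have main: "exp (- s * dist p z) / 2 * poin s \<le> infsum (wt s) (orbit_shadow z r)" if z: "z \<in> orb" and s: "omega < s" for z s
  proof -
    obtain k where k: "k \<in> carrier G" "z = \<phi> k p" using z by (auto simp: orb_def)
    have s0: "0 < s" using om s by simp
    define y where "y = \<phi> (inv k) p"
    define B where "B = {g\<in>carrier G. r < prd (\<phi> g p) y}"
    have B: "B \<subseteq> carrier G" by (auto simp: B_def)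
    \<comment> \<open>Change of base from \<open>z\<close> to \<open>p\<close>: after pulling back
      by \<open>k\<close>, missing the shadow of \<open>z\<close> means having a product greater
      than \<open>r\<close> with \<open>y\<close>, which defines \<open>B\<close>.\<close>
    have prd_shift: "prd (\<phi> (k \<otimes> g) p) z = dist p z - prd (\<phi> g p) y" if g: "g \<in> carrier G" for g
    proof -
      have "gromov_product z p (\<phi> (k \<otimes> g) p) = prd y (\<phi> g p)"
        using act_gromov_product[of k p y "\<phi> g p"] k g by (simp add: act_mult act_inv' y_def)
      then show ?thesis
        using gromov_product_change_base[of z p "\<phi> (k \<otimes> g) p"] by (simp add: gromov_product_commute)
    qed
    have half: "infsum (wt s) B \<le> poin s / 2"
    proof (cases "r < dist p y")
      case True
      then obtain v where v: "v \<in> orb" "\<bar>dist p v - r\<bar> \<le> D" "r - D \<le> prd y v"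
        using orb_between[of r y] r0 by auto
      have "B \<subseteq> orbit_shadow v (2 * D + \<delta>)"
      proof
        fix g assume "g \<in> B"
        then have "g \<in> carrier G" "r < prd (\<phi> g p) y" by (auto simp: B_def)
        moreover have "dist p v \<le> r + D" using v by (simp add: abs_le_iff)
        ultimately show "g \<in> orbit_shadow v (2 * D + \<delta>)"
          using hyperbolic[of p "\<phi> g p" y v] v D_nonneg by (auto simp: orbit_shadow_def)
      qed
      then have "infsum (wt s) B \<le> infsum (wt s) (orbit_shadow v (2 * D + \<delta>))"
        using s B orbit_shadow_subset wt_nonneg by (intro infsum_mono_neutral wt_summable_sub) auto
      also have "\<dots> \<le> exp (2 * s * (2 * D + \<delta>) - s * dist p v) * poin s" by (rule orbit_shadow_upper[OF v(1) s])
      also have "\<dots> \<le> exp (- ln 2) * poin s"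
      proof (intro mult_right_mono iffD2[OF exp_le_cancel_iff])
        have "ln 2 = omega * (ln 2 / omega)" using om by simp
        also have "\<dots> \<le> s * (ln 2 / omega)" using om s by (intro mult_right_mono) auto
        also have "\<dots> \<le> s * (dist p v - e)"
          using v s0 by (intro mult_left_mono) (auto simp: r_def abs_le_iff)
        finally show "2 * s * (2 * D + \<delta>) - s * dist p v \<le> - ln 2" by (simp add: e_def algebra_simps)
        show "0 \<le> poin s" using poin_pos[OF s] by simp
      qed
      also have "\<dots> = poin s / 2" by (simp add: exp_minus)
      finally show ?thesis .
    next
      case False
      have "\<not> r < prd x y" for x using False gromov_product_le_right[of p x y] by linarith
      then have "B = {}" by (auto simp: B_def)
      then show ?thesis using poin_pos[OF s] by simp
    qed
    have "poin s = infsum (wt s) (carrier G - B) + infsum (wt s) B"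
      unfolding poin_def using infsum_Diff[OF wt_summable[OF s] wt_summable_sub[OF s B] B] by simp
    then have rest: "poin s / 2 \<le> infsum (wt s) (carrier G - B)" using half by simp
    have "exp (- s * dist p z) / 2 * poin s = exp (- s * dist p z) * (poin s / 2)" by simp
    also have "\<dots> \<le> exp (- s * dist p z) * infsum (wt s) (carrier G - B)"
      using rest by (intro mult_left_mono) auto
    also have "\<dots> = infsum (\<lambda>g. exp (- s * dist p z) * wt s g) (carrier G - B)" by (simp add: infsum_cmult_right')
    also have "\<dots> \<le> infsum (\<lambda>g. wt s (k \<otimes> g)) (carrier G - B)"
    proof (rule infsum_mono)
      show "(\<lambda>g. exp (- s * dist p z) * wt s g) summable_on carrier G - B"
        using wt_summable_sub[OF s] by (intro summable_on_cmult_right) auto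
      show "(\<lambda>g. wt s (k \<otimes> g)) summable_on carrier G - B"
        by (rule summable_on_subset_banach[OF poin_translate(2)[OF k(1) s]]) auto
      show "exp (- s * dist p z) * wt s g \<le> wt s (k \<otimes> g)" if "g \<in> carrier G - B" for g
      proof -
        have "dist p (\<phi> (k \<otimes> g) p) \<le> dist p z + dist p (\<phi> g p)"
          using dist_triangle[of p "\<phi> (k \<otimes> g) p" z] k that act_dist[of k p "\<phi> g p"] by (simp add: act_mult)
        then have "s * dist p (\<phi> (k \<otimes> g) p) \<le> s * (dist p z + dist p (\<phi> g p))"
          using s0 by (intro mult_left_mono) auto
        then show ?thesis unfolding wt_def exp_add[symmetric] by (simp add: algebra_simps)
      qed
    qed
    also have "\<dots> = infsum (wt s) ((\<otimes>) k ` (carrier G - B))"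
    proof -
      have "inj_on ((\<otimes>) k) (carrier G - B)" using k by (intro inj_onI) auto
      then show ?thesis by (simp add: infsum_reindex o_def)
    qed
    also have "\<dots> \<le> infsum (wt s) (orbit_shadow z r)"
    proof (rule infsum_mono_neutral)
      show "wt s summable_on (\<otimes>) k ` (carrier G - B)" using k by (intro wt_summable_sub[OF s]) auto
      show "wt s summable_on orbit_shadow z r" using wt_summable_sub[OF s orbit_shadow_subset] .
      show "wt s g \<le> 0" if g: "g \<in> (\<otimes>) k ` (carrier G - B) - orbit_shadow z r" for g
      proof -
        obtain g' where g': "g = k \<otimes> g'" "g' \<in> carrier G" "g' \<notin> B" using g by blast
        then have "prd (\<phi> g' p) y \<le> r" by (simp add: B_def)
        then have "g \<in> orbit_shadow z r" using prd_shift[OF g'(2)] g' k by (simp add: orbit_shadow_def)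
        then show ?thesis using g by blast
      qed
    qed (use wt_nonneg in auto)
    finally show ?thesis .
  qed
  show ?thesis by (rule that[OF r0 main])
qed

text \<open>Two such points have a mutual product close to both of their distances, so they are
  boundedly close to each other. Invariance of the counts makes the bound independent of
  \<open>x\<close>.\<close>

lemma shadow_multiplicity:
  "finite {z\<in>orb. a \<le> dist p z \<and> dist p z \<le> b \<and> dist p z - r \<le> prd x z}" (is "finite ?A")
  "card {z\<in>orb. a \<le> dist p z \<and> dist p z \<le> b \<and> dist p z - r \<le> prd x z} \<le> cnt (b - a + 2 * r + 2 * \<delta>)"
proof -
  have "?A \<subseteq> orb \<inter> cball p b" by auto
  then show "finite ?A" using finite_orb_ball finite_subset by blast
  show "card ?A \<le> cnt (b - a + 2 * r + 2 * \<delta>)"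
  proof (cases "?A = {}")
    case False
    then obtain z where z: "z \<in> ?A" by blast
    have "?A \<subseteq> orb \<inter> cball z (b - a + 2 * r + 2 * \<delta>)"
    proof
      fix z' assume z': "z' \<in> ?A"
      have "min (dist p z) (dist p z') - r - \<delta> \<le> prd z z'"
        using hyperbolic[of p z x z'] z z' gromov_product_commute[of p z x] by auto
      then have "dist z z' \<le> b - a + 2 * r + 2 * \<delta>"
        using z z' dist_eq_gromov_product[of z z' p] by (auto simp: min_def split: if_splits)
      then show "z' \<in> orb \<inter> cball z (b - a + 2 * r + 2 * \<delta>)" using z' by simp
    qed
    then have "card ?A \<le> card (orb \<inter> cball z (b - a + 2 * r + 2 * \<delta>))" by (intro card_mono finite_orb_ball)
    then show ?thesis using z card_orb_ball by auto
  next
    case True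
    then show ?thesis by (simp only: True card.empty)
  qed
qed

text \<open>Each point of a unit annulus shadows at least \<open>exp (- s * b) / 2\<close> of the
  series, and no element lies in more than \<open>N\<close> of these shadows. The factor
  \<open>poin s\<close> cancels, so the bound passes to the limit as \<open>s\<close> decreases to
  \<open>omega\<close>.\<close>

lemma cnt_upper:
  assumes om: "0 < omega"
  obtains C where "0 < C" "\<And>t. 0 \<le> t \<Longrightarrow> real (cnt t) \<le> C * exp (omega * t)"
proof -
  obtain r where r: "0 \<le> r" "\<And>z s. z \<in> orb \<Longrightarrow> omega < s \<Longrightarrow> exp (- s * dist p z) / 2 * poin s \<le> infsum (wt s) (orbit_shadow z r)"
    using orbit_shadow_lower[OF om] by blast
  define N where "N = real (cnt (1 + 2 * r + 2 * \<delta>))"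
  have annulus: "real (card A) \<le> 2 * N * exp (omega * b)"
    if A: "A \<subseteq> orb" "\<And>z. z \<in> A \<Longrightarrow> b - 1 \<le> dist p z \<and> dist p z \<le> b" and b: "0 \<le> b" for A b
  proof -
    have "A \<subseteq> orb \<inter> cball p b" using A by auto
    then have fin: "finite A" using finite_orb_ball finite_subset by blast
    have "real (card A) \<le> 2 * N * exp (s * b)" if s: "omega < s" for s
    proof -
      have ind: "(\<lambda>g. wt s g * indicator (orbit_shadow z r) g) summable_on carrier G"
        and ind_eq: "infsum (wt s) (orbit_shadow z r) = infsum (\<lambda>g. wt s g * indicator (orbit_shadow z r) g) (carrier G)" for z
      proof -
        show "infsum (wt s) (orbit_shadow z r) = infsum (\<lambda>g. wt s g * indicator (orbit_shadow z r) g) (carrier G)"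
          using orbit_shadow_subset by (intro infsum_cong_neutral) (auto simp: indicator_def)
        show "(\<lambda>g. wt s g * indicator (orbit_shadow z r) g) summable_on carrier G"
          using orbit_shadow_subset wt_summable_sub[OF s orbit_shadow_subset[of z r]]
          by (subst summable_on_cong_neutral[of "orbit_shadow z r" "carrier G" "wt s"]) (auto simp: indicator_def)
      qed
      have "(exp (- s * b) / 2 * poin s) * real (card A) \<le> (\<Sum>z\<in>A. infsum (wt s) (orbit_shadow z r))"
      proof -
        have "exp (- s * b) / 2 * poin s \<le> infsum (wt s) (orbit_shadow z r)" if "z \<in> A" for z
        proof -
          have "s * dist p z \<le> s * b" using A that om s by (intro mult_left_mono) auto
          then have "exp (- s * b) / 2 * poin s \<le> exp (- s * dist p z) / 2 * poin s"
            using poin_pos[OF s] by (intro mult_right_mono) auto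
          then show ?thesis using r(2)[of z s] A that s by force
        qed
        then show ?thesis using sum_bounded_below[of A "exp (- s * b) / 2 * poin s" "\<lambda>z. infsum (wt s) (orbit_shadow z r)"]
            by (simp only: mult.commute)
      qed
      also have "\<dots> = infsum (\<lambda>g. \<Sum>z\<in>A. wt s g * indicator (orbit_shadow z r) g) (carrier G)"
        unfolding ind_eq by (rule summable_on_finite_sum(2)[OF fin ind, symmetric])
      also have "\<dots> \<le> infsum (\<lambda>g. N * wt s g) (carrier G)"
      proof (rule infsum_mono)
        show "(\<lambda>g. \<Sum>z\<in>A. wt s g * indicator (orbit_shadow z r) g) summable_on carrier G" by (rule summable_on_finite_sum(1)[OF fin ind])
        show "(\<lambda>g. N * wt s g) summable_on carrier G" using wt_summable[OF s] by (rule summable_on_cmult_right)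
        fix g assume g: "g \<in> carrier G"
        have "(\<Sum>z\<in>A. wt s g * indicator (orbit_shadow z r) g) = wt s g * real (card {z\<in>A. g \<in> orbit_shadow z r})"
          using fin by (simp add: sum_distrib_left[symmetric] indicator_def sum.If_cases Int_def)
        also have "card {z\<in>A. g \<in> orbit_shadow z r} \<le> card {z\<in>orb. b - 1 \<le> dist p z \<and> dist p z \<le> b \<and> dist p z - r \<le> prd (\<phi> g p) z}"
          using A by (intro card_mono shadow_multiplicity) (auto simp: orbit_shadow_def)
        also have "\<dots> \<le> cnt (b - (b - 1) + 2 * r + 2 * \<delta>)" by (rule shadow_multiplicity)
        finally show "(\<Sum>z\<in>A. wt s g * indicator (orbit_shadow z r) g) \<le> N * wt s g"
          using wt_nonneg by (simp add: N_def mult.commute mult_right_mono)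
      qed
      also have "\<dots> = N * poin s" by (simp add: infsum_cmult_right' poin_def)
      finally show ?thesis using poin_pos[OF s] by (simp add: field_simps exp_minus)
    qed
    then have "\<forall>\<^sub>F s in at_right omega. real (card A) \<le> 2 * N * exp (s * b)"
      by (rule eventually_mono[OF eventually_at_right_less])
    moreover have "((\<lambda>s. 2 * N * exp (s * b)) \<longlongrightarrow> 2 * N * exp (omega * b)) (at_right omega)"
      by (intro tendsto_intros)
    ultimately show ?thesis by (intro tendsto_le[OF _ _ tendsto_const]) auto
  qed
  \<comment> \<open>The annulus bounds summed as a geometric series; the summand 1 also covers the
    ball of radius 0, which holds only \<open>p\<close>.\<close>
  define C where "C = 2 * N / (1 - exp (- omega)) + 1"
  have q: "0 < 1 - exp (- omega)" using om by simp
  have N0: "0 \<le> N" by (simp add: N_def)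
  have C1: "1 \<le> C" using N0 q by (simp add: C_def)
  have step: "2 * N + C * exp (- omega) \<le> C"
  proof -
    have "C * (1 - exp (- omega)) = 2 * N + (1 - exp (- omega))" using q by (simp add: C_def field_simps)
    then show ?thesis using q unfolding right_diff_distrib by linarith
  qed
  have nat_bound: "real (cnt (real n)) \<le> C * exp (omega * real n)" for n
  proof (induction n)
    case 0
    have "orb \<inter> cball p 0 \<subseteq> {p}" by auto
    then have "cnt 0 \<le> 1" unfolding cnt_def using card_mono[of "{p}"] by force
    then show ?case using C1 by simp
  next
    case (Suc n)
    let ?A = "{z\<in>orb. real (Suc n) - 1 \<le> dist p z \<and> dist p z \<le> real (Suc n)}"
    have finA: "finite ?A" by (rule finite_subset[OF _ finite_orb_ball[of p "real (Suc n)"]]) auto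
    have "cnt (real (Suc n)) \<le> card ((orb \<inter> cball p (real n)) \<union> ?A)"
      unfolding cnt_def using finA finite_orb_ball by (intro card_mono) auto
    also have "\<dots> \<le> cnt (real n) + card ?A" unfolding cnt_def by (rule card_Un_le)
    finally have "real (cnt (real (Suc n))) \<le> real (cnt (real n)) + real (card ?A)" by linarith
    also have "\<dots> \<le> C * exp (omega * real n) + 2 * N * exp (omega * real (Suc n))"
      using Suc annulus[of ?A "real (Suc n)"] by auto
    also have "\<dots> = (2 * N + C * exp (- omega)) * exp (omega * real (Suc n))"
      by (simp add: algebra_simps exp_add[symmetric] mult_exp_exp)
    also have "\<dots> \<le> C * exp (omega * real (Suc n))" using step by (intro mult_right_mono) auto
    finally show ?case .
  qed
  have "real (cnt t) \<le> (C * exp omega) * exp (omega * t)" if "0 \<le> t" for t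
  proof -
    have "real (cnt t) \<le> real (cnt (real (nat \<lceil>t\<rceil>)))" by (intro of_nat_mono cnt_mono) linarith
    also have "\<dots> \<le> C * exp (omega * real (nat \<lceil>t\<rceil>))" by (rule nat_bound)
    also have "\<dots> \<le> C * exp (omega * (1 + t))"
      using om that C1 by (intro mult_left_mono iffD2[OF exp_le_cancel_iff] mult_left_mono) (auto, linarith)
    finally show ?thesis by (simp add: exp_add algebra_simps)
  qed
  then show ?thesis using that[of "C * exp omega"] C1 by simp
qed

text \<open>The upper and lower bounds on \<open>cnt\<close> have different constants;
  \<open>K\<close> is so large that the ball of radius \<open>t - K\<close> takes at most half of
  the lower bound for radius \<open>t\<close>.\<close>

lemma cnt_annulus:
  assumes om: "0 < omega"
  obtains K c where "0 < K" "0 < c" "\<And>t. K \<le> t \<Longrightarrow> c * exp (omega * t) \<le> real (cnt t) - real (cnt (t - K))"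
proof -
  obtain C where C: "0 < C" "\<And>t. 0 \<le> t \<Longrightarrow> real (cnt t) \<le> C * exp (omega * t)" using cnt_upper[OF om] by blast
  define c where "c = exp (- omega * (1 + real offset)) / 2"
  define K where "K = max 1 (ln (C / c) / omega)"
  have c: "0 < c" by (simp add: c_def)
  have "ln (C / c) \<le> omega * K" using om by (simp add: K_def field_simps max_def)
  then have "exp (ln (C / c)) \<le> exp (omega * K)" by simp
  then have CK: "C * exp (- omega * K) \<le> c" using C c by (simp add: exp_minus field_simps)
  have "c * exp (omega * t) \<le> real (cnt t) - real (cnt (t - K))" if t: "K \<le> t" for t
  proof -
    have "real (cnt (t - K)) \<le> C * exp (omega * (t - K))" using C t by simp
    also have "\<dots> = (C * exp (- omega * K)) * exp (omega * t)" by (simp add: algebra_simps mult_exp_exp exp_add[symmetric])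
    also have "\<dots> \<le> c * exp (omega * t)" using CK by (intro mult_right_mono) auto
    finally have 1: "real (cnt (t - K)) \<le> c * exp (omega * t)" .
    have "2 * c * exp (omega * t) = exp (omega * (t - 1 - real offset))"
      by (simp add: c_def algebra_simps mult_exp_exp exp_add[symmetric])
    also have "\<dots> \<le> real (cnt t)" using t by (intro cnt_lower) (simp add: K_def)
    finally show ?thesis using 1 by simp
  qed
  then show ?thesis using that[of K c] c by (simp add: K_def)
qed

text \<open>Every annulus of width \<open>K\<close> contributes at least \<open>c\<close> at the
  exponent \<open>omega\<close>. A finite partial sum beyond \<open>M\<close> is continuous in
  \<open>s\<close>, so it stays beyond \<open>M\<close> near \<open>omega\<close>.\<close>

lemma poin_at_top:
  assumes om: "0 < omega" and s: "\<And>i. omega < s i" "s \<longlonglongrightarrow> omega"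
  shows "filterlim (\<lambda>i. poin (s i)) at_top sequentially"
  unfolding filterlim_at_top
proof
  fix M :: real
  obtain K c where K: "0 < K" "0 < c" "\<And>t. K \<le> t \<Longrightarrow> c * exp (omega * t) \<le> real (cnt t) - real (cnt (t - K))"
    using cnt_annulus[OF om] by blast
  define B where "B n = orb \<inter> cball p (real n * K)" for n
  have B: "finite (B n)" for n unfolding B_def by (rule finite_orb_ball)
  have big: "real n * c \<le> (\<Sum>z\<in>B n. exp (- omega * dist p z))" for n
  proof (induction n)
    case 0
    then show ?case by (simp add: sum_nonneg)
  next
    case (Suc n)
    let ?t = "real (Suc n) * K"
    have "real n * K \<le> ?t" using K(1) by simp
    then have sub: "B n \<subseteq> B (Suc n)" unfolding B_def by auto
    have "real (card (B (Suc n) - B n)) = real (cnt ?t) - real (cnt (?t - K))"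
    proof -
      have "B n = orb \<inter> cball p (?t - K)" by (simp add: B_def algebra_simps)
      then show ?thesis using card_Diff_subset[OF B sub] card_mono[OF B sub] by (simp add: cnt_def B_def)
    qed
    then have crd: "c * exp (omega * ?t) \<le> real (card (B (Suc n) - B n))" using K(3)[of ?t] K(1) by (simp add: algebra_simps)
    have "c \<le> real (card (B (Suc n) - B n)) * exp (- omega * ?t)"
      using mult_right_mono[OF crd, of "exp (- omega * ?t)"] by (simp add: mult.assoc mult_exp_exp)
    also have "\<dots> \<le> (\<Sum>z\<in>B (Suc n) - B n. exp (- omega * dist p z))"
      using om by (intro sum_bounded_below) (auto simp: B_def)
    finally have "c \<le> (\<Sum>z\<in>B (Suc n) - B n. exp (- omega * dist p z))" .
    moreover have "(\<Sum>z\<in>B (Suc n). exp (- omega * dist p z)) =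
        (\<Sum>z\<in>B (Suc n) - B n. exp (- omega * dist p z)) + (\<Sum>z\<in>B n. exp (- omega * dist p z))"
      by (rule sum.subset_diff[OF sub B])
    ultimately show ?case using Suc by (simp add: algebra_simps)
  qed
  obtain n where n: "M < real n * c" using K(2) reals_Archimedean3 by blast
  define gz where "gz z = (SOME g. g \<in> carrier G \<and> \<phi> g p = z)" for z
  have gz: "gz z \<in> carrier G" "\<phi> (gz z) p = z" if "z \<in> orb" for z
    using someI_ex[of "\<lambda>g. g \<in> carrier G \<and> \<phi> g p = z"] that by (auto simp: gz_def orb_def)
  define F where "F = gz ` B n"
  have inj: "inj_on gz (B n)" by (rule inj_onI) (metis B_def IntD1 gz(2))
  have F: "F \<subseteq> carrier G" "finite F" using gz B by (auto simp: F_def B_def)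
  have "sum (wt omega) F = (\<Sum>z\<in>B n. exp (- omega * dist p z))"
    unfolding F_def sum.reindex[OF inj] using gz by (intro sum.cong) (auto simp: wt_def B_def)
  then have "M < sum (wt omega) F" using big[of n] n by simp
  moreover have "(\<lambda>i. sum (wt (s i)) F) \<longlonglongrightarrow> sum (wt omega) F"
    unfolding wt_def by (intro tendsto_intros s)
  ultimately have "\<forall>\<^sub>F i in sequentially. M < sum (wt (s i)) F" by (intro order_tendstoD)
  then show "\<forall>\<^sub>F i in sequentially. M \<le> poin (s i)"
    by eventually_elim (use sum_wt_le_poin[OF s(1) F] in \<open>meson less_imp_le order_trans\<close>)
qed

end

section \<open>Non-elementary groups have exponential growth\<close>

context hyperbolic_action
begin

fun word_prod :: "'g list \<Rightarrow> 'g" where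
  "word_prod [] = \<one>"
| "word_prod (f # u) = f \<otimes> word_prod u"

lemma word_prod_closed: "set u \<subseteq> carrier G \<Longrightarrow> word_prod u \<in> carrier G"
  by (induction u) auto

lemma word_prod_append:
  "set u \<subseteq> carrier G \<Longrightarrow> set v \<subseteq> carrier G \<Longrightarrow> word_prod (u @ v) = word_prod u \<otimes> word_prod v"
  by (induction u) (auto simp: word_prod_closed m_assoc)

lemma word_prod_take_Suc:
  assumes "set w \<subseteq> carrier G" "i < length w"
  shows "word_prod (take (Suc i) w) = word_prod (take i w) \<otimes> w ! i"
proof -
  have "set (take i w) \<subseteq> carrier G" using assms(1) set_take_subset[of i w] by blast
  moreover have "w ! i \<in> carrier G" using assms by auto
  ultimately show ?thesis
    unfolding take_Suc_conv_app_nth[OF assms(2)] by (simp add: word_prod_append)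
qed

text \<open>\<open>words F ok e n\<close>: the words of length \<open>n\<close> that may follow the letter \<open>e\<close>.\<close>

fun words :: "'g set \<Rightarrow> ('g \<Rightarrow> 'g \<Rightarrow> bool) \<Rightarrow> 'g \<Rightarrow> nat \<Rightarrow> 'g list set" where
  "words F ok e 0 = {[]}"
| "words F ok e (Suc n) = (\<Union>f\<in>{f\<in>F. ok e f}. (#) f ` words F ok f n)"

lemma words_props:
  assumes "w \<in> words F ok e n"
  shows "set w \<subseteq> F" "length w = n" "\<And>i. Suc i < n \<Longrightarrow> ok (w ! i) (w ! Suc i)" "w \<noteq> [] \<Longrightarrow> ok e (hd w)"
proof -
  have "set w \<subseteq> F \<and> length w = n \<and> (\<forall>i. Suc i < n \<longrightarrow> ok (w ! i) (w ! Suc i)) \<and> (w \<noteq> [] \<longrightarrow> ok e (hd w))"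
    using assms
  proof (induction n arbitrary: e w)
    case 0
    then show ?case by simp
  next
    case (Suc n)
    then obtain f u where w: "w = f # u" "f \<in> F" "ok e f" "u \<in> words F ok f n" by auto
    have u: "set u \<subseteq> F" "length u = n" "\<And>i. Suc i < n \<Longrightarrow> ok (u ! i) (u ! Suc i)" "u \<noteq> [] \<Longrightarrow> ok f (hd u)"
      using Suc.IH[OF w(4)] by auto
    have "ok (w ! i) (w ! Suc i)" if "Suc i < Suc n" for i
      using that u w by (cases i) (auto simp: hd_conv_nth)
    then show ?case using u w by auto
  qed
  then show "set w \<subseteq> F" "length w = n" "\<And>i. Suc i < n \<Longrightarrow> ok (w ! i) (w ! Suc i)" "w \<noteq> [] \<Longrightarrow> ok e (hd w)"
    by auto
qed

lemma card_words:
  assumes F: "finite F" and two: "\<And>e. e \<in> F \<Longrightarrow> 2 \<le> card {f\<in>F. ok e f}"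
  shows "e \<in> F \<Longrightarrow> finite (words F ok e n) \<and> 2 ^ n \<le> card (words F ok e n)"
proof (induction n arbitrary: e)
  case 0
  then show ?case by simp
next
  case (Suc n)
  have fin: "finite {f\<in>F. ok e f}" using F by simp
  have "card (words F ok e (Suc n)) = (\<Sum>f\<in>{f\<in>F. ok e f}. card ((#) f ` words F ok f n))"
    unfolding words.simps using fin Suc.IH by (intro card_UN_disjoint) auto
  also have "\<dots> = (\<Sum>f\<in>{f\<in>F. ok e f}. card (words F ok f n))"
    by (intro sum.cong card_image) auto
  finally have eq: "card (words F ok e (Suc n)) = (\<Sum>f\<in>{f\<in>F. ok e f}. card (words F ok f n))" .
  have "2 * 2 ^ n \<le> card {f\<in>F. ok e f} * 2 ^ n" using two[OF Suc.prems] by (rule mult_right_mono) simp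
  also have "\<dots> \<le> (\<Sum>f\<in>{f\<in>F. ok e f}. card (words F ok f n))"
    using Suc.IH sum_bounded_below[of "{f\<in>F. ok e f}" "2 ^ n" "\<lambda>f. card (words F ok f n)"] by simp
  finally show ?case using eq fin Suc.IH by auto
qed

text \<open>Three distinguishable directions at the base point leave, after every step, at least two ways to go on
  without turning back, so that the orbit contains a free binary tree.\<close>

lemma omega_pos_if_three_directions:
  assumes K: "0 \<le> K" and F: "F \<subseteq> carrier G" "card F = 3"
    and sep: "\<And>f f'. f \<in> F \<Longrightarrow> f' \<in> F \<Longrightarrow> f \<noteq> f' \<Longrightarrow> prd (\<phi> f p) (\<phi> f' p) \<le> K"
    and far: "\<And>f. f \<in> F \<Longrightarrow> 2 * K + 4 * \<delta> + 1 \<le> dist p (\<phi> f p)"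
  shows "0 < omega"
proof -
  define a where "a = K + \<delta>"
  define l where "l = 2 * K + 4 * \<delta> + 1"
  have al: "0 \<le> a" "2 * a + 2 * \<delta> < l" using K delta_nonneg by (auto simp: a_def l_def)
  \<comment> \<open>Seen from the vertex reached by the letter \<open>e\<close>, the previous vertex
    is \<open>\<phi> (inv e) p\<close>; \<open>f\<close> is allowed if it does not lead back towards
    it.\<close>
  define ok where "ok e f \<longleftrightarrow> prd (\<phi> (inv e) p) (\<phi> f p) \<le> a" for e f
  have finF: "finite F" using F by (intro card_ge_0_finite) simp
  have two: "2 \<le> card {f\<in>F. ok e f}" if "e \<in> F" for e
  proof -
    \<comment> \<open>Two forbidden letters would both point towards
      \<open>\<phi> (inv e) p\<close>, hence towards each other, against \<open>sep\<close>.\<close>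
    have "card {f\<in>F. \<not> ok e f} \<le> 1"
    proof (rule ccontr)
      assume "\<not> ?thesis"
      then obtain f f' where f: "f \<in> F" "f' \<in> F" "f \<noteq> f'" "\<not> ok e f" "\<not> ok e f'"
        using finF by (auto simp: card_le_Suc0_iff_eq)
      then show False
        using hyperbolic[of p "\<phi> f p" "\<phi> (inv e) p" "\<phi> f' p"] sep[of f f']
        by (auto simp: ok_def a_def gromov_product_commute)
    qed
    moreover have "card F = card {f\<in>F. ok e f} + card {f\<in>F. \<not> ok e f}"
      using finF by (subst card_Un_disjoint[symmetric]) (auto intro: arg_cong[of _ _ card])
    ultimately show ?thesis using F by simp
  qed
  have turn: "gromov_product (\<phi> q p) (\<phi> (q \<otimes> f) p) (\<phi> (q \<otimes> inv e) p) \<le> a"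
    if "q \<in> carrier G" "e \<in> F" "f \<in> F" "ok e f" for q e f
  proof -
    have "gromov_product (\<phi> q p) (\<phi> (q \<otimes> f) p) (\<phi> (q \<otimes> inv e) p) = prd (\<phi> f p) (\<phi> (inv e) p)"
      using that F act_gromov_product[of q p "\<phi> f p" "\<phi> (inv e) p"] by (simp add: act_mult subset_iff)
    then show ?thesis using that by (simp add: ok_def gromov_product_commute)
  qed
  \<comment> \<open>The endpoint of a word lies in the direction of its first letter. Letters can
    thus be recovered one at a time, which gives injectivity.\<close>
  have first: "l - a - \<delta> \<le> prd (\<phi> (word_prod w) p) (\<phi> (hd w) p)" if w: "w \<in> words F ok e (Suc n)" for w e n
  proof -
    note wp = words_props[OF w]
    have wG: "set w \<subseteq> carrier G" using wp(1) F by blast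
    define pt where "pt i = \<phi> (word_prod (take i w)) p" for i
    have qG: "word_prod (take i w) \<in> carrier G" for i
      using wG set_take_subset[of i w] by (intro word_prod_closed) blast
    have nth: "w ! i \<in> F" if "i < Suc n" for i using wp(1,2) that by (auto simp: subset_iff)
    have step: "l \<le> dist (pt i) (pt (Suc i))" if "i < Suc n" for i
    proof -
      have "pt (Suc i) = \<phi> (word_prod (take i w)) (\<phi> (w ! i) p)"
        unfolding pt_def using that wp(2) nth[OF that] F
        by (subst word_prod_take_Suc[OF wG]) (auto intro!: act_mult qG)
      then have "dist (pt i) (pt (Suc i)) = dist p (\<phi> (w ! i) p)" using qG by (simp add: pt_def act_dist)
      then show ?thesis using far[OF nth[OF that]] by (simp add: l_def)
    qed
    have bend: "gromov_product (pt (Suc i)) (pt (Suc (Suc i))) (pt i) \<le> a" if "Suc i < Suc n" for i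
    proof -
      let ?q = "word_prod (take (Suc i) w)"
      have iF: "w ! i \<in> F" "w ! Suc i \<in> F" using nth that by auto
      then have iG: "w ! i \<in> carrier G" "w ! Suc i \<in> carrier G" using F by auto
      have "pt (Suc (Suc i)) = \<phi> (?q \<otimes> w ! Suc i) p"
        unfolding pt_def using that wp(2) by (subst word_prod_take_Suc[OF wG]) auto
      moreover have "pt i = \<phi> (?q \<otimes> inv (w ! i)) p"
      proof -
        have "?q \<otimes> inv (w ! i) = word_prod (take i w)"
          using that wp(2) iG qG[of i] by (subst word_prod_take_Suc[OF wG]) (auto simp: m_assoc)
        then show ?thesis by (simp add: pt_def)
      qed
      ultimately show ?thesis
        using turn[OF qG iF(1,2)] wp(3)[OF that] by (simp add: pt_def)
    qed
    \<comment> \<open>The path is run backwards: \<open>local_quasi_geodesic\<close> controls the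
      turn at the last vertex but one, and the first letter is wanted.\<close>
    define f where "f i = pt (Suc n - i)" for i
    have "gromov_product (f (Suc n - 1)) (f 0) (f (Suc n)) \<le> a + \<delta>"
    proof (rule local_quasi_geodesic(2)[OF al])
      show "l \<le> dist (f i) (f (Suc i))" if "i < Suc n" for i
        using step[of "n - i"] that by (simp add: f_def dist_commute Suc_diff_le)
      show "gromov_product (f (Suc i)) (f i) (f (Suc (Suc i))) \<le> a" if "Suc i < Suc n" for i
        using bend[of "n - Suc i"] that by (simp add: f_def Suc_diff_le Suc_diff_Suc)
    qed simp
    moreover have "f (Suc n) = p" by (simp add: f_def pt_def act_one)
    moreover have "f (Suc n - 1) = \<phi> (hd w) p"
    proof -
      have "w \<noteq> []" using wp(2) by auto
      then have "take 1 w = [hd w]" by (cases w) auto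
      moreover have "hd w \<in> carrier G" using \<open>w \<noteq> []\<close> wG by auto
      ultimately show ?thesis by (simp add: f_def pt_def)
    qed
    moreover have "f 0 = \<phi> (word_prod w) p" using wp(2) by (simp add: f_def pt_def)
    moreover have "l \<le> dist p (\<phi> (hd w) p)" using far wp(1,2) by (cases w) (auto simp: l_def)
    ultimately show ?thesis
      using gromov_product_change_base[of p "\<phi> (hd w) p" "\<phi> (word_prod w) p"]
      by (simp add: gromov_product_commute dist_commute)
  qed
  have inj: "inj_on (\<lambda>w. \<phi> (word_prod w) p) (words F ok e n)" for e n
  proof (induction n arbitrary: e)
    case 0
    then show ?case by simp
  next
    case (Suc n)
    show ?case
    proof (rule inj_onI)
      fix w w' assume w: "w \<in> words F ok e (Suc n)" and w': "w' \<in> words F ok e (Suc n)"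
        and eq: "\<phi> (word_prod w) p = \<phi> (word_prod w') p"
      obtain f u where u: "w = f # u" "f \<in> F" "u \<in> words F ok f n" using w by auto
      obtain f' u' where u': "w' = f' # u'" "f' \<in> F" "u' \<in> words F ok f' n" using w' by auto
      have "set u \<subseteq> carrier G" "set u' \<subseteq> carrier G" using words_props(1) u(3) u'(3) F by blast+
      then have G: "f \<in> carrier G" "f' \<in> carrier G" "word_prod u \<in> carrier G" "word_prod u' \<in> carrier G"
        using u u' F word_prod_closed by auto
      show "w = w'"
      proof (cases "f = f'")
        case True
        have "\<phi> f (\<phi> (word_prod u) p) = \<phi> f (\<phi> (word_prod u') p)"
          using eq u u' G True by (simp add: act_mult)
        then have "\<phi> (word_prod u) p = \<phi> (word_prod u') p" using act_inv G(1) by metis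
        then have "u = u'" using inj_onD[OF Suc.IH[of f]] u u' True by simp
        then show ?thesis using u u' True by simp
      next
        case False
        have "l - a - \<delta> \<le> prd (\<phi> (word_prod w) p) (\<phi> f p)" "l - a - \<delta> \<le> prd (\<phi> (word_prod w) p) (\<phi> f' p)"
          using first[OF w] first[OF w'] u u' eq by simp_all
        then have "l - a - 2 * \<delta> \<le> prd (\<phi> f p) (\<phi> f' p)"
          using hyperbolic[of p "\<phi> f p" "\<phi> (word_prod w) p" "\<phi> f' p"] by (simp add: gromov_product_commute)
        also have "\<dots> \<le> K" using sep u u' False by simp
        finally show ?thesis using K delta_nonneg by (simp add: l_def a_def)
      qed
    qed
  qed
  define L where "L = Max ((\<lambda>f. dist p (\<phi> f p)) ` F)"
  have L: "dist p (\<phi> f p) \<le> L" if "f \<in> F" for f using finF that by (simp add: L_def)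
  have len: "dist p (\<phi> (word_prod w) p) \<le> real n * L" if "w \<in> words F ok e n" for w e n
    using that
  proof (induction n arbitrary: e w)
    case 0
    then show ?case by (simp add: act_one)
  next
    case (Suc n)
    then obtain f u where u: "w = f # u" "f \<in> F" "u \<in> words F ok f n" by auto
    have G: "f \<in> carrier G" "word_prod u \<in> carrier G"
      using u words_props(1)[OF u(3)] F by (auto intro!: word_prod_closed)
    have "dist p (\<phi> (word_prod w) p) \<le> dist p (\<phi> f p) + dist (\<phi> f p) (\<phi> f (\<phi> (word_prod u) p))"
      using u G dist_triangle by (simp add: act_mult)
    also have "\<dots> \<le> L + real n * L" using L[OF u(2)] Suc.IH[OF u(3)] G by (simp add: act_dist)
    finally show ?case by (simp add: algebra_simps)
  qed
  obtain e where e: "e \<in> F" using F by (metis card.empty ex_in_conv zero_neq_numeral)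
  have Lpos: "0 < L" using L[OF e] far[OF e] K delta_nonneg by linarith
  have grow: "2 ^ n \<le> cnt (real n * L)" for n
  proof -
    have "2 ^ n \<le> card (words F ok e n)" using card_words[of F ok e n, OF finF two e] by blast
    also have "\<dots> = card ((\<lambda>w. \<phi> (word_prod w) p) ` words F ok e n)" using inj by (rule card_image[symmetric])
    also have "\<dots> \<le> card (orb \<inter> cball p (real n * L))"
    proof (rule card_mono[OF finite_orb_ball], rule image_subsetI)
      fix w assume w: "w \<in> words F ok e n"
      then have "word_prod w \<in> carrier G" using words_props(1)[OF w] F by (intro word_prod_closed) auto
      then show "\<phi> (word_prod w) p \<in> orb \<inter> cball p (real n * L)" using len[OF w] by (simp add: orb_def)
    qed
    finally show ?thesis by (simp add: cnt_def)
  qed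
  show ?thesis
  proof (rule ccontr)
    assume "\<not> 0 < omega"
    \<comment> \<open>Half the exponential rate of the tree, so that
      \<open>2 ^ n = q ^ n * q ^ n\<close> outgrows \<open>C * q ^ n\<close>.\<close>
    then have "omega < ln 2 / (2 * L)" using Lpos omega_nonneg by simp
    then obtain C where C: "0 < C" "\<And>t. 0 \<le> t \<Longrightarrow> real (cnt t) \<le> C * exp (ln 2 / (2 * L) * t)"
      using cnt_upper_weak by blast
    define q :: real where "q = exp (ln 2 / 2)"
    have q: "1 < q" "q * q = 2" unfolding q_def by (simp_all add: exp_add[symmetric])
    have "q ^ n \<le> C" for n
    proof -
      have "q ^ n * q ^ n = 2 ^ n" using q by (simp add: power_mult_distrib[symmetric])
      also have "(2::real) ^ n \<le> real (cnt (real n * L))" using grow[of n] by (metis of_nat_le_iff of_nat_numeral of_nat_power)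
      also have "\<dots> \<le> C * exp (ln 2 / (2 * L) * (real n * L))" by (rule C(2)) (use Lpos in simp)
      also have "ln 2 / (2 * L) * (real n * L) = real n * (ln 2 / 2)" using Lpos by simp
      also have "exp (real n * (ln 2 / 2)) = q ^ n" unfolding q_def by (rule exp_of_nat_mult)
      finally show ?thesis using q by simp
    qed
    moreover obtain n where "C < q ^ n" using real_arch_pow[OF q(1)] by blast
    ultimately show False by (metis not_le)
  qed
qed

section \<open>Hyperbolic elements and the virtually cyclic alternative\<close>

lemma far_orbit_point:
  assumes "infinite (carrier G)" shows "\<exists>g\<in>carrier G. T \<le> dist p (\<phi> g p)"
proof (rule ccontr)
  assume "\<not> ?thesis"
  then have "carrier G = {g\<in>carrier G. dist p (\<phi> g p) \<le> T}" by force
  then show False using assms finite_act_ball by metis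
qed

text \<open>A long geodesic from \<open>p\<close> to an orbit point is translated so that an orbit
  point near its midpoint becomes \<open>p\<close>; the two ends then lie in opposite
  directions.\<close>

lemma opposite_orbit_points:
  assumes "infinite (carrier G)"
  obtains a b where "a \<in> carrier G" "b \<in> carrier G" "T \<le> dist p (\<phi> a p)" "T \<le> dist p (\<phi> b p)"
    "prd (\<phi> a p) (\<phi> b p) \<le> D"
proof -
  obtain g where g: "g \<in> carrier G" "2 * (\<bar>T\<bar> + D) \<le> dist p (\<phi> g p)" using far_orbit_point[OF assms] by blast
  define x where "x = \<phi> g p"
  obtain z where z: "z \<in> orb" "\<bar>dist p z - dist p x / 2\<bar> \<le> D" "dist z x \<le> dist p x - dist p x / 2 + D"
    using orb_between[of "dist p x / 2" x] by auto
  obtain k where k: "k \<in> carrier G" "z = \<phi> k p" using z by (auto simp: orb_def)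
  have pk: "\<phi> (inv k) z = p" using k by (simp add: act_inv)
  have 1: "dist p (\<phi> (inv k) p) = dist z p" using act_dist[of "inv k" z p] k pk by simp
  have 2: "dist p (\<phi> (inv k \<otimes> g) p) = dist z x" using act_dist[of "inv k" z x] k g pk by (simp add: x_def act_mult)
  have 3: "prd (\<phi> (inv k) p) (\<phi> (inv k \<otimes> g) p) = gromov_product z p x"
    using act_gromov_product[of "inv k" z p x] k g pk by (simp add: x_def act_mult)
  show ?thesis
  proof (rule that[of "inv k" "inv k \<otimes> g"])
    have half: "\<bar>T\<bar> + D \<le> dist p x / 2" using g by (simp add: x_def)
    show "T \<le> dist p (\<phi> (inv k) p)"
      using 1 z(2) half abs_ge_self[of T] dist_commute[of z p] by linarith
    show "T \<le> dist p (\<phi> (inv k \<otimes> g) p)"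
      using 2 z(2) half abs_ge_self[of T] dist_triangle[of p x z] by linarith
    show "prd (\<phi> (inv k) p) (\<phi> (inv k \<otimes> g) p) \<le> D"
      using z(2,3) dist_commute[of z p] dist_eq_gromov_product[of p x z] unfolding 3 by linarith
  qed (use k g in auto)
qed

text \<open>If neither of two elements with opposite translation directions is hyperbolic, both behave like reflections
  and their product is a hyperbolic element.\<close>

lemma hyperbolic_element:
  assumes inf: "infinite (carrier G)"
  obtains g where "g \<in> carrier G" "T \<le> dist p (\<phi> g p)" "prd (\<phi> g p) (\<phi> (inv g) p) \<le> D + 3 * \<delta> + 1"
proof -
  define \<kappa> where "\<kappa> = D + 3 * \<delta> + 1"
  obtain a b where ab: "a \<in> carrier G" "b \<in> carrier G"
    and far: "\<bar>T\<bar> + 2 * D + 4 * \<delta> + 1 \<le> dist p (\<phi> a p)" "\<bar>T\<bar> + 2 * D + 4 * \<delta> + 1 \<le> dist p (\<phi> b p)"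
    and opp: "prd (\<phi> a p) (\<phi> b p) \<le> D"
    using opposite_orbit_points[OF inf] by metis
  show ?thesis
  proof (cases "prd (\<phi> a p) (\<phi> (inv a) p) \<le> \<kappa> \<or> prd (\<phi> b p) (\<phi> (inv b) p) \<le> \<kappa>")
    case True
    then show ?thesis using that ab far D_nonneg delta_nonneg by (force simp: \<kappa>_def)
  next
    case False
    \<comment> \<open>\<open>inv a\<close> points in the direction of \<open>a\<close>, which is
      opposite to \<open>b\<close>; likewise with the roles exchanged. So the path from
      \<open>\<phi> (inv a) p\<close> through \<open>p\<close> to \<open>\<phi> b p\<close> hardly
      turns at \<open>p\<close>.\<close>
    have 1: "prd (\<phi> (inv a) p) (\<phi> b p) \<le> D + \<delta>"
      using hyperbolic[of p "\<phi> a p" "\<phi> (inv a) p" "\<phi> b p"] False opp delta_nonneg by (auto simp: \<kappa>_def min_def split: if_splits)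
    have 2: "prd (\<phi> a p) (\<phi> (inv b) p) \<le> D + \<delta>"
      using hyperbolic[of p "\<phi> a p" "\<phi> (inv b) p" "\<phi> b p"] False opp delta_nonneg
        gromov_product_commute[of p "\<phi> b p" "\<phi> (inv b) p"] by (auto simp: \<kappa>_def min_def split: if_splits)
    \<comment> \<open>\<open>g\<close> moves \<open>p\<close> almost as far as both steps together.
      \<open>\<phi> g p\<close> lies in the direction of \<open>a\<close> and
      \<open>\<phi> (inv g) p\<close> in that of \<open>inv b\<close>, and fact \<open>2\<close>
      says that these are opposite.\<close>
    define g where "g = a \<otimes> b"
    have g: "g \<in> carrier G" using ab by (simp add: g_def)
    have inv_len: "dist p (\<phi> (inv h) p) = dist p (\<phi> h p)" if "h \<in> carrier G" for h
      using act_dist[of h "\<phi> (inv h) p" p] that by (simp add: act_inv' dist_commute)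
    have len: "dist p (\<phi> g p) = dist (\<phi> (inv a) p) (\<phi> b p)"
      using act_dist[of a "\<phi> (inv a) p" "\<phi> b p"] ab by (simp add: g_def act_mult act_inv')
    then have glen: "dist p (\<phi> a p) + dist p (\<phi> b p) - 2 * (D + \<delta>) \<le> dist p (\<phi> g p)"
      using dist_eq_gromov_product[of "\<phi> (inv a) p" "\<phi> b p" p] 1 inv_len ab by simp
    have "dist (\<phi> g p) (\<phi> a p) = dist p (\<phi> b p)"
      using ab act_dist[of a "\<phi> b p" p] by (simp add: g_def act_mult dist_commute)
    then have 3: "dist p (\<phi> a p) - (D + \<delta>) \<le> prd (\<phi> a p) (\<phi> g p)"
      using glen by (simp add: gromov_product_def dist_commute)
    have "dist (\<phi> (inv g) p) (\<phi> (inv b) p) = dist p (\<phi> a p)"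
      using ab act_dist[of "inv b" "\<phi> (inv a) p" p] inv_len by (simp add: g_def inv_mult_group act_mult dist_commute)
    then have 4: "dist p (\<phi> b p) - (D + \<delta>) \<le> prd (\<phi> (inv g) p) (\<phi> (inv b) p)"
      using glen inv_len g ab by (simp add: gromov_product_def)
    have "prd (\<phi> g p) (\<phi> (inv g) p) \<le> D + 3 * \<delta> + 1"
      using hyperbolic3[of p "\<phi> a p" "\<phi> g p" "\<phi> (inv g) p" "\<phi> (inv b) p"] 2 3 4 far
      by (auto simp: min_def split: if_splits)
    moreover have "T \<le> dist p (\<phi> g p)" using glen far D_nonneg delta_nonneg abs_ge_self[of T] by argo
    ultimately show ?thesis using that g by blast
  qed
qed

text \<open>All turns along the powers of \<open>g\<close> are translates of the turn at
  \<open>p\<close>. The second bound runs the path backwards, as for words.\<close>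

lemma power_quasi_geodesic:
  assumes g: "g \<in> carrier G" and turn: "prd (\<phi> g p) (\<phi> (inv g) p) \<le> \<kappa>" and \<kappa>: "0 \<le> \<kappa>"
    and len: "2 * \<kappa> + 2 * \<delta> < dist p (\<phi> g p)"
  shows "real n * (dist p (\<phi> g p) - 2 * \<kappa> - 2 * \<delta>) \<le> dist p (\<phi> (g [^] n) p)"
    and "0 < n \<Longrightarrow> dist p (\<phi> g p) - \<kappa> - \<delta> \<le> prd (\<phi> g p) (\<phi> (g [^] n) p)"
proof -
  define pt where "pt i = \<phi> (g [^] (i::nat)) p" for i
  have step: "dist (pt i) (pt (Suc i)) = dist p (\<phi> g p)" for i
    using g by (simp add: pt_def act_mult act_dist)
  have bend: "gromov_product (pt (Suc i)) (pt i) (pt (Suc (Suc i))) = prd (\<phi> g p) (\<phi> (inv g) p)" for i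
  proof -
    have "pt i = \<phi> (g [^] Suc i) (\<phi> (inv g) p)" using g by (simp add: pt_def act_mult act_inv')
    moreover have "pt (Suc (Suc i)) = \<phi> (g [^] Suc i) (\<phi> g p)" using g by (simp add: pt_def act_mult)
    moreover have "pt (Suc i) = \<phi> (g [^] Suc i) p" by (simp add: pt_def)
    ultimately show ?thesis using g act_gromov_product[of "g [^] Suc i" p "\<phi> (inv g) p" "\<phi> g p"]
      by (metis gromov_product_commute nat_pow_closed)
  qed
  have p0: "pt 0 = p" by (simp add: pt_def act_one)
  show "real n * (dist p (\<phi> g p) - 2 * \<kappa> - 2 * \<delta>) \<le> dist p (\<phi> (g [^] n) p)"
    using local_quasi_geodesic(1)[OF \<kappa> len, of n pt] step bend turn p0 by (simp add: pt_def)
  show "dist p (\<phi> g p) - \<kappa> - \<delta> \<le> prd (\<phi> g p) (\<phi> (g [^] n) p)" if n: "0 < n"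
  proof -
    define f where "f i = pt (n - i)" for i
    have "gromov_product (f (n - 1)) (f 0) (f n) \<le> \<kappa> + \<delta>"
    proof (rule local_quasi_geodesic(2)[OF \<kappa> len _ _ n])
      show "dist p (\<phi> g p) \<le> dist (f i) (f (Suc i))" if "i < n" for i
        using step[of "n - Suc i"] that by (simp add: f_def dist_commute Suc_diff_Suc)
      show "gromov_product (f (Suc i)) (f i) (f (Suc (Suc i))) \<le> \<kappa>" if "Suc i < n" for i
        using bend[of "n - Suc (Suc i)"] that turn by (simp add: f_def gromov_product_commute Suc_diff_Suc)
    qed
    moreover have "f n = p" "f 0 = \<phi> (g [^] n) p" "f (n - 1) = \<phi> g p"
      using n g by (simp_all add: f_def pt_def act_one)
    ultimately show ?thesis
      using gromov_product_change_base[of p "\<phi> g p" "\<phi> (g [^] n) p"]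
      by (simp add: gromov_product_commute dist_commute)
  qed
qed

lemma omega_pos:
  assumes ne: "\<not> elementary_group G"
  shows "0 < omega"
proof (rule ccontr)
  assume om: "\<not> 0 < omega"
  have inf: "infinite (carrier G)" using ne by (auto simp: elementary_group_def)
  define \<kappa> where "\<kappa> = D + 3 * \<delta> + 1"
  have \<kappa>: "0 \<le> \<kappa>" using D_nonneg delta_nonneg by (simp add: \<kappa>_def)
  obtain g where g: "g \<in> carrier G" "2 * \<kappa> + 6 * \<delta> + 4 \<le> dist p (\<phi> g p)" "prd (\<phi> g p) (\<phi> (inv g) p) \<le> \<kappa>"
    using hyperbolic_element[OF inf] unfolding \<kappa>_def by metis
  define l where "l = dist p (\<phi> g p)"
  have l: "2 * \<kappa> + 6 * \<delta> + 4 \<le> l" using g by (simp add: l_def)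
  have inv_len: "dist p (\<phi> (inv g) p) = l"
    using act_dist[of g "\<phi> (inv g) p" p] g by (simp add: act_inv' dist_commute l_def)
  have turn': "prd (\<phi> (inv g) p) (\<phi> (inv (inv g)) p) \<le> \<kappa>" using g by (simp add: gromov_product_commute)
  have len: "2 * \<kappa> + 2 * \<delta> < dist p (\<phi> g p)" "2 * \<kappa> + 2 * \<delta> < dist p (\<phi> (inv g) p)"
    using l inv_len delta_nonneg by (simp_all add: l_def)
  note q1 = power_quasi_geodesic[OF g(1,3) \<kappa> len(1)]
  note q2 = power_quasi_geodesic[OF _ turn' \<kappa> len(2), unfolded inv_len]
  define e where "e = l - 2 * \<kappa> - 2 * \<delta>"
  have e: "0 < e" using l delta_nonneg by (simp add: e_def)
  \<comment> \<open>Large enough to bound \<open>prd u v\<close> and to exceed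
    \<open>l - \<kappa> - \<delta>\<close>, so that a product with \<open>u\<close> above
    \<open>K\<close> would put \<open>x\<close> too far in the direction of
    \<open>\<phi> g p\<close>.\<close>
  define K where "K = l + \<kappa> + 2 * \<delta>"
  have K: "0 \<le> K" using \<kappa> l delta_nonneg by (simp add: K_def)
  define \<rho> where "\<rho> = 2 * K + 4 * \<delta> + 1"
  obtain n where n: "0 < n" "\<rho> \<le> real n * e"
  proof -
    obtain m where "\<rho> < real m * e" using e reals_Archimedean3 by blast
    moreover have "real m * e \<le> real (Suc m) * e" using e by simp
    ultimately show ?thesis using that[of "Suc m"] by simp
  qed
  \<comment> \<open>Powers of \<open>g\<close> instead of \<open>g\<close> itself: the three
    directions have to reach distance \<rho>, which is larger than \<open>l\<close>.\<close>
  define u where "u = \<phi> (g [^] n) p"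
  define v where "v = \<phi> (inv g [^] n) p"
  have uv_far: "\<rho> \<le> dist p u" "\<rho> \<le> dist p v"
    using q1(1)[of n] q2(1)[of n] n g by (simp_all add: u_def v_def e_def l_def)
  have ug: "l - \<kappa> - \<delta> \<le> prd (\<phi> g p) u" and vg: "l - \<kappa> - \<delta> \<le> prd (\<phi> (inv g) p) v"
    using q1(2)[OF n(1)] q2(2)[OF _ n(1)] g by (simp_all add: u_def v_def l_def)
  have uv: "prd u v \<le> \<kappa> + 2 * \<delta>"
    using hyperbolic3[of p "\<phi> g p" u v "\<phi> (inv g) p"] ug vg g(3) l gromov_product_commute[of p v "\<phi> (inv g) p"] delta_nonneg
    by (auto simp: min_def split: if_splits)
  \<comment> \<open>If neither \<open>g\<close> nor its inverse brings \<open>x\<close> closer to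
    \<open>p\<close> by more than 1, then \<open>x\<close> lies in neither of the directions
    \<open>u\<close> and \<open>v\<close>; far from \<open>p\<close> it would be a third
    one.\<close>
  have near_base: "dist p x \<le> \<rho>"
    if x: "x \<in> orb" "dist p x \<le> dist (\<phi> g p) x + 1" "dist p x \<le> dist (\<phi> (inv g) p) x + 1" for x
  proof (rule ccontr)
    assume far: "\<not> dist p x \<le> \<rho>"
    obtain f where f: "f \<in> carrier G" "x = \<phi> f p" using x by (auto simp: orb_def)
    have xg: "prd x (\<phi> g p) \<le> (l + 1) / 2" "prd x (\<phi> (inv g) p) \<le> (l + 1) / 2"
      using x inv_len by (simp_all add: gromov_product_def dist_commute l_def)
    have small: "prd x u \<le> K"
    proof (rule ccontr)
      assume "\<not> ?thesis"
      then have "min K (l - \<kappa> - \<delta>) - \<delta> \<le> prd x (\<phi> g p)"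
        using hyperbolic[of p x u "\<phi> g p"] ug gromov_product_commute[of p u "\<phi> g p"] by (simp add: min_le_iff_disj min_def split: if_splits)
      then show False using xg(1) l \<kappa> delta_nonneg by (auto simp: K_def min_def split: if_splits)
    qed
    have small': "prd x v \<le> K"
    proof (rule ccontr)
      assume "\<not> ?thesis"
      then have "min K (l - \<kappa> - \<delta>) - \<delta> \<le> prd x (\<phi> (inv g) p)"
        using hyperbolic[of p x v "\<phi> (inv g) p"] vg gromov_product_commute[of p v "\<phi> (inv g) p"] by (simp add: min_le_iff_disj min_def split: if_splits)
      then show False using xg(2) l \<kappa> delta_nonneg by (auto simp: K_def min_def split: if_splits)
    qed
    have uvK: "prd u v \<le> K" using uv l \<kappa> delta_nonneg by (simp add: K_def)
    have big: "K < dist p x" "K < dist p u" "K < dist p v"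
      using far uv_far K delta_nonneg by (simp_all add: \<rho>_def)
    have "x \<noteq> u" "x \<noteq> v" "u \<noteq> v" using small small' uvK big by auto
    then have "f \<noteq> g [^] n" "f \<noteq> inv g [^] n" "g [^] n \<noteq> inv g [^] n" by (auto simp: f u_def v_def)
    then have card: "card {f, g [^] n, inv g [^] n} = 3" by simp
    have "0 < omega"
    proof (rule omega_pos_if_three_directions[OF K _ card])
      show "{f, g [^] n, inv g [^] n} \<subseteq> carrier G" using f g by simp
      show "prd (\<phi> h p) (\<phi> h' p) \<le> K"
        if "h \<in> {f, g [^] n, inv g [^] n}" "h' \<in> {f, g [^] n, inv g [^] n}" "h \<noteq> h'" for h h'
        using that small small' uvK f gromov_product_commute[of p u x] gromov_product_commute[of p v x] gromov_product_commute[of p v u]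
        by (auto simp: u_def v_def)
      show "2 * K + 4 * \<delta> + 1 \<le> dist p (\<phi> h p)" if "h \<in> {f, g [^] n, inv g [^] n}" for h
        using that far uv_far f by (auto simp: u_def v_def \<rho>_def)
    qed
    then show False using om by simp
  qed
  define C where "C = range (\<lambda>j::int. g [^] j)"
  have pw: "g [^] j \<in> carrier G" for j :: int using g by simp
  have near_axis: "\<exists>j::int. dist p (\<phi> (g [^] j \<otimes> f) p) \<le> \<rho>" if f: "f \<in> carrier G" for f
  proof -
    \<comment> \<open>A translate of \<open>f\<close> by a power of \<open>g\<close> that is minimal
      up to 1 is within reach of \<open>near_base\<close>; the slack 1 there spares attaining the
      infimum.\<close>
    define ds where "ds = range (\<lambda>j::int. dist p (\<phi> (g [^] j \<otimes> f) p))"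
    have bdd: "bdd_below ds" unfolding ds_def by (rule bdd_belowI2[of _ 0]) simp
    have "ds \<noteq> {}" by (simp add: ds_def)
    then obtain d where "d \<in> ds" "d < Inf ds + 1" using cInf_lessD[of ds "Inf ds + 1"] by auto
    then obtain j :: int where j: "dist p (\<phi> (g [^] j \<otimes> f) p) < Inf ds + 1" by (auto simp: ds_def)
    define x where "x = \<phi> (g [^] j \<otimes> f) p"
    have min: "dist p x \<le> dist p (\<phi> (g [^] i) x) + 1" for i :: int
    proof -
      have "g [^] i \<otimes> (g [^] j \<otimes> f) = g [^] (i + j) \<otimes> f" using g f pw by (simp add: int_pow_mult m_assoc)
      then have "\<phi> (g [^] i) x = \<phi> (g [^] (i + j) \<otimes> f) p" unfolding x_def using pw f by (simp add: act_mult[symmetric])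
      then have "dist p (\<phi> (g [^] i) x) \<in> ds" by (auto simp: ds_def)
      then have "Inf ds \<le> dist p (\<phi> (g [^] i) x)" using bdd by (rule cInf_lower)
      then show ?thesis using j by (simp add: x_def)
    qed
    have "dist p x \<le> \<rho>"
    proof (rule near_base)
      show "x \<in> orb" unfolding x_def orb_def using pw f by auto
      show "dist p x \<le> dist (\<phi> g p) x + 1"
        using min[of "-1"] act_dist[of g p "\<phi> (inv g) x"] g by (simp add: int_pow_neg act_inv')
      show "dist p x \<le> dist (\<phi> (inv g) p) x + 1"
        using min[of 1] act_dist[of "inv g" p "\<phi> g x"] g by (simp add: act_inv)
    qed
    then show ?thesis unfolding x_def by blast
  qed
  have pos_pow: "g [^] n \<noteq> \<one>" if "0 < n" for n :: nat
  proof
    assume "g [^] n = \<one>"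
    then have "real n * e \<le> 0" using q1(1)[of n] by (simp add: act_one e_def l_def)
    then show False using that e by (simp add: mult_le_0_iff)
  qed
  have inj: "inj (\<lambda>j::int. g [^] j)"
  proof (rule injI)
    have "i \<le> j" if eq: "g [^] i = g [^] j" for i j :: int
    proof (rule ccontr)
      assume "\<not> i \<le> j"
      have "g [^] (i - j) = \<one>" using g eq by (simp add: int_pow_diff)
      moreover have "i - j = int (nat (i - j))" using \<open>\<not> i \<le> j\<close> by simp
      ultimately have "g [^] nat (i - j) = \<one>" by (metis int_pow_int)
      then show False using pos_pow[of "nat (i - j)"] \<open>\<not> i \<le> j\<close> by simp
    qed
    then show "i = j" if "g [^] i = g [^] j" for i j :: int using that by (metis antisym)
  qed
  have sub: "subgroup C G"
  proof (rule subgroupI)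
    show "C \<subseteq> carrier G" "C \<noteq> {}" using pw by (auto simp: C_def)
    show "inv a \<in> C" if "a \<in> C" for a using that g by (auto simp: C_def int_pow_neg[symmetric])
    show "a \<otimes> b \<in> C" if "a \<in> C" "b \<in> C" for a b
      using that g by (auto simp: C_def int_pow_mult[symmetric])
  qed
  have "(\<lambda>j::int. g [^] j) \<in> iso integer_group (G\<lparr>carrier := C\<rparr>)"
    unfolding iso_def hom_def bij_betw_def using inj g
    by (auto simp: C_def int_pow_mult)
  then have "integer_group \<cong> G\<lparr>carrier := C\<rparr>" unfolding is_iso_def by blast
  then have isoC: "G\<lparr>carrier := C\<rparr> \<cong> integer_group" by (rule group.iso_sym[OF group_integer_group])
  \<comment> \<open>Each coset meets the finite set of elements moving \<open>p\<close> by at most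
    \<rho>, so the infinite cyclic group \<open>C\<close> has finite index.\<close>
  have "rcosets C \<subseteq> (\<lambda>f. C #> f) ` {f\<in>carrier G. dist p (\<phi> f p) \<le> \<rho>}"
  proof
    fix X assume "X \<in> rcosets C"
    then obtain f where f: "f \<in> carrier G" "X = C #> f" by (auto simp: RCOSETS_def)
    obtain j :: int where j: "dist p (\<phi> (g [^] j \<otimes> f) p) \<le> \<rho>" using near_axis[OF f(1)] by blast
    have "g [^] j \<otimes> f \<in> C #> f" using f by (auto simp: r_coset_def C_def)
    then have "C #> f = C #> (g [^] j \<otimes> f)" by (rule repr_independence[OF _ f(1) sub])
    then show "X \<in> (\<lambda>f. C #> f) ` {f\<in>carrier G. dist p (\<phi> f p) \<le> \<rho>}" using f j pw by auto
  qed
  then have "finite (rcosets C)" by (rule finite_surj[OF finite_act_ball])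
  then show False using ne sub isoC unfolding elementary_group_def by blast
qed

end

section \<open>Patterson--Sullivan measure of shadows\<close>

lemma (in finite_measure) sum_measure_le_multiplicity:
  assumes A: "finite A" "\<And>z. z \<in> A \<Longrightarrow> S z \<in> sets M"
    and mult: "\<And>x. card {z\<in>A. x \<in> S z} \<le> N"
  shows "(\<Sum>z\<in>A. measure M (S z)) \<le> real N * measure M (\<Union>z\<in>A. S z)"
proof -
  have U: "(\<Union>z\<in>A. S z) \<in> sets M" using A by auto
  have int: "integrable M (indicator B :: _ \<Rightarrow> real)" if "B \<in> sets M" for B
    using that by (simp add: emeasure_eq_measure)
  have "(\<Sum>z\<in>A. measure M (S z)) = (\<integral>x. (\<Sum>z\<in>A. indicator (S z) x) \<partial>M)"
    using A int by (subst Bochner_Integration.integral_sum) (auto simp: sets.Int_space_eq2)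
  also have "\<dots> \<le> (\<integral>x. real N * indicator (\<Union>z\<in>A. S z) x \<partial>M)"
  proof (rule integral_mono)
    show "integrable M (\<lambda>x. \<Sum>z\<in>A. indicator (S z) x :: real)" using A int by (intro Bochner_Integration.integrable_sum) auto
    show "integrable M (\<lambda>x. real N * indicator (\<Union>z\<in>A. S z) x)" using int[OF U] by simp
    fix x
    have "(\<Sum>z\<in>A. indicator (S z) x :: real) = real (card {z\<in>A. x \<in> S z})"
      using A(1) by (simp add: indicator_def sum.If_cases Int_def)
    also have "\<dots> \<le> real N * indicator (\<Union>z\<in>A. S z) x"
    proof (cases "x \<in> (\<Union>z\<in>A. S z)")
      case True
      then show ?thesis using mult[of x] by simp
    next
      case False
      then have "{z\<in>A. x \<in> S z} = {}" by auto
      then show ?thesis by (simp only: card.empty) simp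
    qed
    finally show "(\<Sum>z\<in>A. indicator (S z) x :: real) \<le> real N * indicator (\<Union>z\<in>A. S z) x" .
  qed
  also have "\<dots> = real N * measure M (\<Union>z\<in>A. S z)" using U by (simp add: sets.Int_space_eq2)
  finally show ?thesis .
qed

context hyperbolic_action
begin

definition shadow :: "'a \<Rightarrow> real \<Rightarrow> 'a bordif set" where
  "shadow z r = {\<xi>\<in>gromov_boundary p. dist p z - r \<le> bprd \<xi> z}"

lemma shadow_borel: "shadow z r \<in> sets (bordif_borel p)"
proof -
  have "shadow z r = {\<xi>\<in>gromov_boundary p. bus \<xi> z \<le> dist p z - 2 * (dist p z - r)}"
    by (auto simp: shadow_def bus_eq)
  then show ?thesis using bus_le_borel by simp
qed

text \<open>The ray to \<xi> is replaced by a geodesic to a point \<open>w\<close> that stands in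
  for \<xi> on all orbit points of a ball. The ball is fixed before \<open>z\<close> is found,
  because \<open>w\<close> depends on the finite set.\<close>

lemma shadow_cover:
  assumes \<xi>: "\<xi> \<in> gromov_boundary p" and t: "0 \<le> t"
  obtains z where "z \<in> orb" "\<bar>dist p z - t\<bar> \<le> D" "t - D - \<delta> \<le> bprd \<xi> z"
proof -
  obtain w where w: "t \<le> dist p w" "\<And>x. x \<in> orb \<inter> cball p (t + D) \<Longrightarrow> \<bar>prd x w - bprd \<xi> x\<bar> \<le> \<delta>"
    using bprd_approx[OF \<xi> finite_orb_ball] by metis
  obtain z where z: "z \<in> orb" "\<bar>dist p z - t\<bar> \<le> D" "t - D \<le> prd w z" using orb_between[OF t w(1)] by metis
  then have "\<bar>prd z w - bprd \<xi> z\<bar> \<le> \<delta>" by (intro w(2)) auto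
  then show ?thesis using that[OF z(1,2)] z(3) by (simp add: gromov_product_commute)
qed

lemma boundary_shadow_multiplicity:
  assumes \<xi>: "\<xi> \<in> gromov_boundary p"
  shows "card {z\<in>orb. a \<le> dist p z \<and> dist p z \<le> b \<and> \<xi> \<in> shadow z r} \<le> cnt (b - a + 2 * r + 4 * \<delta>)"
proof -
  obtain w where w: "\<And>x. x \<in> orb \<inter> cball p b \<Longrightarrow> \<bar>prd x w - bprd \<xi> x\<bar> \<le> \<delta>"
    using bprd_approx[OF \<xi> finite_orb_ball, of 0 p b] by blast
  have "{z\<in>orb. a \<le> dist p z \<and> dist p z \<le> b \<and> \<xi> \<in> shadow z r} \<subseteq>
    {z\<in>orb. a \<le> dist p z \<and> dist p z \<le> b \<and> dist p z - (r + \<delta>) \<le> prd w z}"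
  proof clarify
    fix z assume "z \<in> orb" "dist p z \<le> b" "\<xi> \<in> shadow z r"
    then show "dist p z - (r + \<delta>) \<le> prd w z"
      using w[of z] by (simp add: shadow_def gromov_product_commute[of p w z] abs_le_iff)
  qed
  then have "card {z\<in>orb. a \<le> dist p z \<and> dist p z \<le> b \<and> \<xi> \<in> shadow z r} \<le>
    card {z\<in>orb. a \<le> dist p z \<and> dist p z \<le> b \<and> dist p z - (r + \<delta>) \<le> prd w z}"
    by (intro card_mono shadow_multiplicity)
  also have "\<dots> \<le> cnt (b - a + 2 * (r + \<delta>) + 2 * \<delta>)" by (rule shadow_multiplicity)
  finally show ?thesis by (simp add: algebra_simps)
qed

lemma integral_orbital_measure:
  assumes s: "omega < s" and f: "f \<in> borel_measurable (bordif_borel p)"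
    and bound: "\<And>x. \<bar>f (Inl x)\<bar> \<le> (1::real)"
  shows "integral\<^sup>L (orbital_measure G \<phi> p s) f = infsum (\<lambda>g. wt s g * f (Inl (\<phi> g p))) (carrier G) / poin s"
    and "(\<lambda>g. wt s g * f (Inl (\<phi> g p))) summable_on carrier G"
proof -
  have abs: "Infinite_Sum.abs_summable_on (\<lambda>g. wt s g * f (Inl (\<phi> g p))) (carrier G)"
    using wt_summable[OF s]
  proof (rule Infinite_Sum.abs_summable_on_comparison_test')
    show "norm (wt s g * f (Inl (\<phi> g p))) \<le> wt s g" for g
      using bound[of "\<phi> g p"] wt_nonneg[of s g] by (simp add: abs_mult mult_left_le)
  qed
  then show "(\<lambda>g. wt s g * f (Inl (\<phi> g p))) summable_on carrier G"
    by (rule Infinite_Sum.abs_summable_summable)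
  \<comment> \<open>The integral over the counting measure is \<open>infsetsum\<close>, the Poincare
    series is an \<open>infsum\<close>; absolute summability identifies them.\<close>
  have eq: "infsetsum (\<lambda>g. wt s g * f (Inl (\<phi> g p))) (carrier G) = infsum (\<lambda>g. wt s g * f (Inl (\<phi> g p))) (carrier G)"
    using abs abs_summable_equivalent by (intro infsetsum_infsum) blast
  let ?M = "density (count_space (carrier G)) (\<lambda>g. ennreal (wt s g / poin s))"
  have orb_eq: "orbital_measure G \<phi> p s = distr ?M (bordif_borel p) (\<lambda>g. Inl (\<phi> g p))"
    unfolding orbital_measure_def poin_eq wt_def ..
  have meas: "(\<lambda>g. Inl (\<phi> g p)) \<in> measurable ?M (bordif_borel p)" by simp
  have "integral\<^sup>L (orbital_measure G \<phi> p s) f = integral\<^sup>L ?M (\<lambda>g. f (Inl (\<phi> g p)))"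
    unfolding orb_eq by (rule integral_distr[OF meas f])
  also have "\<dots> = integral\<^sup>L (count_space (carrier G)) (\<lambda>g. (wt s g / poin s) *\<^sub>R f (Inl (\<phi> g p)))"
    using wt_nonneg poin_pos[OF s] by (intro integral_density) (auto intro!: divide_nonneg_nonneg simp: less_imp_le)
  also have "\<dots> = integral\<^sup>L (count_space (carrier G)) (\<lambda>g. wt s g * f (Inl (\<phi> g p))) / poin s"
    by simp
  also have "\<dots> = infsum (\<lambda>g. wt s g * f (Inl (\<phi> g p))) (carrier G) / poin s"
    unfolding eq[symmetric] infsetsum_def ..
  finally show "integral\<^sup>L (orbital_measure G \<phi> p s) f = infsum (\<lambda>g. wt s g * f (Inl (\<phi> g p))) (carrier G) / poin s" .
qed

end

locale patterson_sullivan_action = hyperbolic_action +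
  fixes \<mu> :: "'a bordif measure"
  assumes ps: "patterson_sullivan G \<phi> p \<mu>" and omega_positive: "0 < omega"
begin

lemma prob: "prob_space \<mu>" and sets_mu: "sets \<mu> = sets (bordif_borel p)"
  using ps by (auto simp: patterson_sullivan_def)

sublocale prob_space \<mu> by (rule prob)

lemma space_mu: "space \<mu> = bordification p"
  using sets_eq_imp_space_eq[OF sets_mu] by simp

lemma approximating_sequence:
  obtains s :: "nat \<Rightarrow> real" where "\<And>i. omega < s i" "s \<longlonglongrightarrow> omega"
    "\<And>f. continuous_map (bordif_topology p) euclideanreal f \<Longrightarrow>
      (\<lambda>i. integral\<^sup>L (orbital_measure G \<phi> p (s i)) f) \<longlonglongrightarrow> integral\<^sup>L \<mu> f"
  using ps unfolding patterson_sullivan_def omega_def[symmetric] by blast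

lemma integrable_bounded:
  assumes "f \<in> borel_measurable (bordif_borel p)" "\<And>\<xi>. \<xi> \<in> bordification p \<Longrightarrow> 0 \<le> f \<xi> \<and> f \<xi> \<le> (1::real)"
  shows "integrable \<mu> f"
proof (rule integrable_const_bound[where B = 1])
  show "f \<in> borel_measurable \<mu>" using assms(1) sets_mu measurable_cong_sets by blast
  show "AE \<xi> in \<mu>. norm (f \<xi>) \<le> 1" using assms(2) by (intro AE_I2) (auto simp: space_mu)
qed

lemma measure_le_integral:
  assumes "f \<in> borel_measurable (bordif_borel p)" "\<And>\<xi>. \<xi> \<in> bordification p \<Longrightarrow> 0 \<le> f \<xi> \<and> f \<xi> \<le> (1::real)"
    and A: "A \<in> sets \<mu>" "\<And>\<xi>. \<xi> \<in> A \<Longrightarrow> f \<xi> = 1"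
  shows "measure \<mu> A \<le> integral\<^sup>L \<mu> f"
proof -
  have "measure \<mu> A = (\<integral>x. indicator A x \<partial>\<mu>)" using A by (simp add: sets.Int_space_eq2)
  also have "\<dots> \<le> integral\<^sup>L \<mu> f"
  proof (rule integral_mono[OF _ integrable_bounded[OF assms(1,2)]])
    show "integrable \<mu> (indicator A :: _ \<Rightarrow> real)" using A by (simp add: emeasure_eq_measure)
  qed (use A assms(2) in \<open>auto simp: indicator_def space_mu\<close>)
  finally show ?thesis .
qed

lemma integral_le_measure:
  assumes "f \<in> borel_measurable (bordif_borel p)" "\<And>\<xi>. \<xi> \<in> bordification p \<Longrightarrow> 0 \<le> f \<xi> \<and> f \<xi> \<le> (1::real)"
    and A: "A \<in> sets \<mu>" "\<And>\<xi>. \<xi> \<in> bordification p \<Longrightarrow> \<xi> \<notin> A \<Longrightarrow> f \<xi> = 0"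
  shows "integral\<^sup>L \<mu> f \<le> measure \<mu> A"
proof -
  have "integral\<^sup>L \<mu> f \<le> (\<integral>x. indicator A x \<partial>\<mu>)"
  proof (rule integral_mono[OF integrable_bounded[OF assms(1,2)]])
    show "integrable \<mu> (indicator A :: _ \<Rightarrow> real)" using A by (simp add: emeasure_eq_measure)
  qed (use A assms(2) in \<open>auto simp: indicator_def space_mu\<close>)
  also have "\<dots> = measure \<mu> A" using A by (simp add: sets.Int_space_eq2)
  finally show ?thesis .
qed

lemma bordif_extension_bounds:
  assumes F: "\<And>x. 0 \<le> F x" "\<And>x. F x \<le> (1::real)"
    and f: "\<And>\<xi> u. \<xi> \<in> bordification p \<Longrightarrow> u \<in> representatives \<xi> \<Longrightarrow> (\<lambda>i. F (u i)) \<longlonglongrightarrow> f \<xi>"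
    and \<xi>: "\<xi> \<in> bordification p"
  shows "0 \<le> f \<xi> \<and> f \<xi> \<le> 1"
proof -
  obtain u where u: "u \<in> representatives \<xi>" using representatives_nonempty[OF \<xi>] by blast
  show ?thesis using LIMSEQ_le_const[OF f[OF \<xi> u]] LIMSEQ_le_const2[OF f[OF \<xi> u]] F by auto
qed

section \<open>Concentration on the boundary and the shadow estimate for
  \<open>\<mu>\<close>\<close>

lemma ball_event: "Inl ` ball p r \<in> events"
proof -
  have "openin (bordif_topology p) (Inl ` ball p r)"
    unfolding openin_bordif_topology by (auto simp: gromov_boundary_def inj_vimage_image_eq)
  then show ?thesis using sets_bordif_borel by (simp add: sets_mu)
qed

text \<open>A test function vanishing beyond radius \<open>n + 1\<close> sees finitely many group
  elements, each of weight at most 1, while the normalising series tends to infinity.\<close>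

lemma measure_ball_null: "measure \<mu> (Inl ` ball p (real n)) = 0"
proof -
  define F where "F x = max 0 (min 1 (real n + 1 - dist p x))" for x :: 'a
  have F: "0 \<le> F x" "F x \<le> 1" for x by (simp_all add: F_def)
  have F0: "F x = 0" if "real n + 1 < dist p x" for x using that by (simp add: F_def)
  have "continuous_on UNIV F" unfolding F_def by (intro continuous_intros)
  moreover have "\<exists>R. \<forall>x y. R < prd x y \<longrightarrow> \<bar>F x - F y\<bar> \<le> e" if "0 < e" for e
  proof (intro exI[of _ "real n + 1"] allI impI)
    fix x y assume "real n + 1 < prd x y"
    then have "F x = 0" "F y = 0"
      using gromov_product_le_left[of p x y] gromov_product_le_right[of p x y] by (auto intro!: F0)
    then show "\<bar>F x - F y\<bar> \<le> e" using that by simp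
  qed
  ultimately obtain f where f: "continuous_map (bordif_topology p) euclideanreal f" "\<And>x. f (Inl x) = F x"
    "\<And>\<xi> u. \<xi> \<in> bordification p \<Longrightarrow> u \<in> representatives \<xi> \<Longrightarrow> (\<lambda>i. F (u i)) \<longlonglongrightarrow> f \<xi>"
    using bordif_extension[of F] by metis
  have fb: "f \<in> borel_measurable (bordif_borel p)" by (rule continuous_bordif_borel[OF f(1)])
  have f01: "0 \<le> f \<xi> \<and> f \<xi> \<le> 1" if "\<xi> \<in> bordification p" for \<xi>
    using bordif_extension_bounds[OF F f(3) that] .
  obtain s where s: "\<And>i. omega < s i" "s \<longlonglongrightarrow> omega"
    "\<And>f. continuous_map (bordif_topology p) euclideanreal f \<Longrightarrow>
      (\<lambda>i. integral\<^sup>L (orbital_measure G \<phi> p (s i)) f) \<longlonglongrightarrow> integral\<^sup>L \<mu> f"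
    by (rule approximating_sequence) blast
  define B where "B = {g\<in>carrier G. dist p (\<phi> g p) \<le> real n + 1}"
  have B: "finite B" "B \<subseteq> carrier G" unfolding B_def by (auto intro: finite_act_ball)
  have "integral\<^sup>L (orbital_measure G \<phi> p (s i)) f \<le> real (card B) / poin (s i)" for i
  proof -
    have "infsum (\<lambda>g. wt (s i) g * f (Inl (\<phi> g p))) (carrier G) = (\<Sum>g\<in>B. wt (s i) g * f (Inl (\<phi> g p)))"
    proof -
      have "infsum (\<lambda>g. wt (s i) g * f (Inl (\<phi> g p))) (carrier G) = infsum (\<lambda>g. wt (s i) g * f (Inl (\<phi> g p))) B"
        using B by (intro infsum_cong_neutral) (auto simp: f(2) B_def F0)
      then show ?thesis using B by simp
    qed
    also have "\<dots> \<le> (\<Sum>g\<in>B. 1)"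
    proof (rule sum_mono)
      fix g
      have "wt (s i) g \<le> 1" using s(1)[of i] omega_positive by (simp add: wt_def)
      then show "wt (s i) g * f (Inl (\<phi> g p)) \<le> 1" using F wt_nonneg by (simp add: f(2) mult_le_one)
    qed
    finally show ?thesis
      using integral_orbital_measure(1)[OF s(1) fb] F poin_pos[OF s(1)] by (simp add: f(2) divide_right_mono less_imp_le)
  qed
  moreover have "(\<lambda>i. real (card B) / poin (s i)) \<longlonglongrightarrow> 0"
    using poin_at_top[OF omega_positive s(1,2)] by (intro tendsto_divide_0[OF tendsto_const] filterlim_at_top_imp_at_infinity)
  ultimately have "integral\<^sup>L \<mu> f \<le> 0" using LIMSEQ_le[OF s(3)[OF f(1)]] by blast
  moreover have "measure \<mu> (Inl ` ball p (real n)) \<le> integral\<^sup>L \<mu> f"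
  proof (rule measure_le_integral[OF fb f01 ball_event])
    show "f \<xi> = 1" if "\<xi> \<in> Inl ` ball p (real n)" for \<xi> using that by (auto simp: f(2) F_def)
  qed
  ultimately show ?thesis using measure_nonneg[of \<mu> "Inl ` ball p (real n)"] by linarith
qed

lemma measure_range_Inl: "measure \<mu> (range Inl) = 0"
proof -
  have "(\<Union>n. ball p (real n)) = (UNIV :: 'a set)" using reals_Archimedean2 by auto
  then have "(\<Union>n. Inl ` ball p (real n)) = (range Inl :: 'a bordif set)" by (simp add: image_UN[symmetric])
  moreover have "(\<Union>n. Inl ` ball p (real n)) \<in> null_sets \<mu>"
    using ball_event measure_ball_null by (intro null_sets_UN) (auto simp: null_sets_def emeasure_eq_measure)
  ultimately show ?thesis by (metis measure_eq_0_null_sets)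
qed

lemma measure_gromov_boundary: "measure \<mu> (gromov_boundary p) = 1"
proof -
  have ev: "range Inl \<in> events" using range_Inl_borel by (simp add: sets_mu)
  have "gromov_boundary p = space \<mu> - range Inl"
    by (auto simp: space_mu bordification_def gromov_boundary_def)
  then show ?thesis using prob_compl[OF ev] measure_range_Inl by simp
qed

lemma shadow_event: "shadow z r \<in> events"
  using shadow_borel by (simp add: sets_mu)

text \<open>At the boundary the cutoff is evaluated along a representative, on which the product
  with \<open>z\<close> is within \<delta> of \<open>bprd\<close>; this moves both thresholds by
  \<delta>.\<close>

lemma cutoff_extension:
  assumes t: "t \<le> dist p z"
  obtains f :: "'a bordif \<Rightarrow> real" where "continuous_map (bordif_topology p) euclideanreal f"
    "\<And>\<xi>. \<xi> \<in> bordification p \<Longrightarrow> 0 \<le> f \<xi> \<and> f \<xi> \<le> 1"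
    "\<And>x. t \<le> prd x z \<Longrightarrow> f (Inl x) = 1" "\<And>x. prd x z < t - \<delta> - 1 \<Longrightarrow> f (Inl x) = 0"
    "\<And>\<xi>. \<xi> \<in> gromov_boundary p \<Longrightarrow> t + \<delta> \<le> bprd \<xi> z \<Longrightarrow> f \<xi> = 1"
    "\<And>\<xi>. \<xi> \<in> gromov_boundary p \<Longrightarrow> bprd \<xi> z < t - 2 * \<delta> - 1 \<Longrightarrow> f \<xi> = 0"
proof -
  obtain F :: "'a \<Rightarrow> real" where F: "continuous_on UNIV F" "\<And>e. 0 < e \<Longrightarrow> \<exists>R. \<forall>x y. R < prd x y \<longrightarrow> \<bar>F x - F y\<bar> \<le> e"
    "\<And>x. 0 \<le> F x" "\<And>x. F x \<le> 1" "\<And>x. t \<le> prd x z \<Longrightarrow> F x = 1" "\<And>x. prd x z < t - \<delta> - 1 \<Longrightarrow> F x = 0"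
    using prd_cutoff[OF t] by blast
  obtain f where f: "continuous_map (bordif_topology p) euclideanreal f" "\<And>x. f (Inl x) = F x"
    "\<And>\<xi> u. \<xi> \<in> bordification p \<Longrightarrow> u \<in> representatives \<xi> \<Longrightarrow> (\<lambda>i. F (u i)) \<longlonglongrightarrow> f \<xi>"
    using bordif_extension[OF F(1,2)] by metis
  have lim: "f \<xi> = c" if \<xi>: "\<xi> \<in> gromov_boundary p"
    and c: "\<And>x. \<bar>prd z x - bprd \<xi> z\<bar> \<le> \<delta> \<Longrightarrow> F x = c" for \<xi> c
  proof -
    obtain u where u: "u \<in> representatives \<xi>"
      using representatives_nonempty boundary_in_bordification[OF \<xi>] by blast
    obtain N where N: "\<And>i. i \<ge> N \<Longrightarrow> \<bar>prd z (u i) - bprd \<xi> z\<bar> \<le> \<delta>" using bprd_near[OF \<xi> u] by blast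
    then have "\<forall>\<^sub>F i in sequentially. F (u i) = c"
      unfolding eventually_sequentially using c by blast
    then have "(\<lambda>i. F (u i)) \<longlonglongrightarrow> c" by (rule tendsto_eventually)
    then show ?thesis using f(3)[OF boundary_in_bordification[OF \<xi>] u] LIMSEQ_unique by blast
  qed
  show ?thesis
  proof (rule that[OF f(1)])
    show "0 \<le> f \<xi> \<and> f \<xi> \<le> 1" if "\<xi> \<in> bordification p" for \<xi>
      using bordif_extension_bounds[OF F(3,4) f(3) that] .
    show "f \<xi> = 1" if \<xi>: "\<xi> \<in> gromov_boundary p" "t + \<delta> \<le> bprd \<xi> z" for \<xi>
    proof (rule lim[OF \<xi>(1)])
      show "F x = 1" if "\<bar>prd z x - bprd \<xi> z\<bar> \<le> \<delta>" for x
        using that \<xi>(2) gromov_product_commute[of p z x] by (intro F(5)) linarith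
    qed
    show "f \<xi> = 0" if \<xi>: "\<xi> \<in> gromov_boundary p" "bprd \<xi> z < t - 2 * \<delta> - 1" for \<xi>
    proof (rule lim[OF \<xi>(1)])
      show "F x = 0" if "\<bar>prd z x - bprd \<xi> z\<bar> \<le> \<delta>" for x
        using that \<xi>(2) gromov_product_commute[of p z x] by (intro F(6)) linarith
    qed
  qed (use F f(2) in auto)
qed

lemma measure_shadow_upper:
  assumes z: "z \<in> orb" and r: "0 \<le> r"
  shows "measure \<mu> (shadow z r) \<le> exp (2 * omega * (r + 2 * \<delta> + 1)) * exp (- omega * dist p z)"
proof -
  \<comment> \<open>The cutoff is then 1 on \<open>shadow z r\<close> and vanishes at orbit points
    outside the orbit shadow with parameter \<open>r + 2 * \<delta> + 1\<close>.\<close>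
  define t where "t = dist p z - r - \<delta>"
  have "t \<le> dist p z" using r delta_nonneg by (simp add: t_def)
  then obtain f :: "'a bordif \<Rightarrow> real" where f: "continuous_map (bordif_topology p) euclideanreal f"
    "\<And>\<xi>. \<xi> \<in> bordification p \<Longrightarrow> 0 \<le> f \<xi> \<and> f \<xi> \<le> 1" "\<And>x. prd x z < t - \<delta> - 1 \<Longrightarrow> f (Inl x) = 0"
    "\<And>\<xi>. \<xi> \<in> gromov_boundary p \<Longrightarrow> t + \<delta> \<le> bprd \<xi> z \<Longrightarrow> f \<xi> = 1"
    by (rule cutoff_extension) blast
  have fb: "f \<in> borel_measurable (bordif_borel p)" by (rule continuous_bordif_borel[OF f(1)])
  have fI: "0 \<le> f (Inl x)" "f (Inl x) \<le> 1" for x using f(2)[of "Inl x"] by auto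
  have "measure \<mu> (shadow z r) \<le> integral\<^sup>L \<mu> f"
    by (rule measure_le_integral[OF fb f(2) shadow_event]) (auto simp: shadow_def t_def intro: f(4))
  also have "\<dots> \<le> exp (2 * omega * (r + 2 * \<delta> + 1) - omega * dist p z)"
  proof -
    obtain s where s: "\<And>i. omega < s i" "s \<longlonglongrightarrow> omega"
      "\<And>f. continuous_map (bordif_topology p) euclideanreal f \<Longrightarrow>
        (\<lambda>i. integral\<^sup>L (orbital_measure G \<phi> p (s i)) f) \<longlonglongrightarrow> integral\<^sup>L \<mu> f"
      using approximating_sequence by blast
    have "integral\<^sup>L (orbital_measure G \<phi> p (s i)) f \<le> exp (2 * s i * (r + 2 * \<delta> + 1) - s i * dist p z)" for i
    proof -
      have "infsum (\<lambda>g. wt (s i) g * f (Inl (\<phi> g p))) (carrier G) \<le> infsum (wt (s i)) (orbit_shadow z (r + 2 * \<delta> + 1))"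
      proof (rule infsum_mono_neutral)
        show "(\<lambda>g. wt (s i) g * f (Inl (\<phi> g p))) summable_on carrier G"
          using integral_orbital_measure(2)[OF s(1) fb] fI by simp
        show "wt (s i) summable_on orbit_shadow z (r + 2 * \<delta> + 1)" by (rule wt_summable_sub[OF s(1) orbit_shadow_subset])
        show "wt (s i) g * f (Inl (\<phi> g p)) \<le> wt (s i) g" for g
          using fI wt_nonneg by (simp add: mult_left_le)
        show "wt (s i) g * f (Inl (\<phi> g p)) \<le> 0" if "g \<in> carrier G - orbit_shadow z (r + 2 * \<delta> + 1)" for g
        proof -
          have "prd (\<phi> g p) z < t - \<delta> - 1" using that by (auto simp: orbit_shadow_def t_def)
          then show ?thesis using f(3) by simp
        qed
      qed (use orbit_shadow_subset in auto)
      also have "\<dots> \<le> exp (2 * s i * (r + 2 * \<delta> + 1) - s i * dist p z) * poin (s i)" by (rule orbit_shadow_upper[OF z s(1)])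
      finally show ?thesis
        using integral_orbital_measure(1)[OF s(1) fb] fI poin_pos[OF s(1), of i] by (simp add: divide_le_eq)
    qed
    moreover have "(\<lambda>i. exp (2 * s i * (r + 2 * \<delta> + 1) - s i * dist p z)) \<longlonglongrightarrow> exp (2 * omega * (r + 2 * \<delta> + 1) - omega * dist p z)"
      by (intro tendsto_intros s)
    ultimately show ?thesis using LIMSEQ_le[OF s(3)[OF f(1)]] by blast
  qed
  finally show ?thesis by (simp add: exp_diff exp_minus field_simps)
qed

lemma measure_shadow_lower:
  obtains r where "0 \<le> r" "\<And>z. z \<in> orb \<Longrightarrow> exp (- omega * dist p z) / 2 \<le> measure \<mu> (shadow z r)"
proof -
  obtain r where r: "0 \<le> r" "\<And>z s. z \<in> orb \<Longrightarrow> omega < s \<Longrightarrow> exp (- s * dist p z) / 2 * poin s \<le> infsum (wt s) (orbit_shadow z r)"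
    using orbit_shadow_lower[OF omega_positive] by blast
  have "exp (- omega * dist p z) / 2 \<le> measure \<mu> (shadow z (r + 2 * \<delta> + 1))" if z: "z \<in> orb" for z
  proof -
    define t where "t = dist p z - r"
    have "t \<le> dist p z" using r by (simp add: t_def)
    then obtain f :: "'a bordif \<Rightarrow> real" where f: "continuous_map (bordif_topology p) euclideanreal f"
      "\<And>\<xi>. \<xi> \<in> bordification p \<Longrightarrow> 0 \<le> f \<xi> \<and> f \<xi> \<le> 1" "\<And>x. t \<le> prd x z \<Longrightarrow> f (Inl x) = 1"
      "\<And>\<xi>. \<xi> \<in> gromov_boundary p \<Longrightarrow> bprd \<xi> z < t - 2 * \<delta> - 1 \<Longrightarrow> f \<xi> = 0"
      by (rule cutoff_extension) blast
    have fb: "f \<in> borel_measurable (bordif_borel p)" by (rule continuous_bordif_borel[OF f(1)])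
    have fI: "0 \<le> f (Inl x)" "f (Inl x) \<le> 1" for x using f(2)[of "Inl x"] by auto
    have evI: "range Inl \<in> events" using range_Inl_borel by (simp add: sets_mu)
    have "exp (- omega * dist p z) / 2 \<le> integral\<^sup>L \<mu> f"
    proof -
      obtain s where s: "\<And>i. omega < s i" "s \<longlonglongrightarrow> omega"
        "\<And>f. continuous_map (bordif_topology p) euclideanreal f \<Longrightarrow>
          (\<lambda>i. integral\<^sup>L (orbital_measure G \<phi> p (s i)) f) \<longlonglongrightarrow> integral\<^sup>L \<mu> f"
        using approximating_sequence by blast
      have "exp (- s i * dist p z) / 2 \<le> integral\<^sup>L (orbital_measure G \<phi> p (s i)) f" for i
      proof -
        have "exp (- s i * dist p z) / 2 * poin (s i) \<le> infsum (wt (s i)) (orbit_shadow z r)" by (rule r(2)[OF z s(1)])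
        also have "\<dots> \<le> infsum (\<lambda>g. wt (s i) g * f (Inl (\<phi> g p))) (carrier G)"
        proof (rule infsum_mono_neutral)
          show "(\<lambda>g. wt (s i) g * f (Inl (\<phi> g p))) summable_on carrier G"
            using integral_orbital_measure(2)[OF s(1) fb] fI by simp
          show "wt (s i) summable_on orbit_shadow z r" by (rule wt_summable_sub[OF s(1) orbit_shadow_subset])
          show "wt (s i) g \<le> wt (s i) g * f (Inl (\<phi> g p))" if "g \<in> orbit_shadow z r \<inter> carrier G" for g
            using that f(3)[of "\<phi> g p"] by (simp add: orbit_shadow_def t_def)
          show "0 \<le> wt (s i) g * f (Inl (\<phi> g p))" for g using fI wt_nonneg by simp
        qed (use orbit_shadow_subset in auto)
        finally show ?thesis
          using integral_orbital_measure(1)[OF s(1) fb] fI poin_pos[OF s(1), of i] by (simp add: le_divide_eq)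
      qed
      moreover have "(\<lambda>i. exp (- s i * dist p z) / 2) \<longlonglongrightarrow> exp (- omega * dist p z) / 2"
        by (intro tendsto_intros s) simp
      ultimately show ?thesis using LIMSEQ_le[OF _ s(3)[OF f(1)]] by blast
    qed
    \<comment> \<open>The cutoff may be positive inside the space as well, but
      \<open>range Inl\<close> has measure 0.\<close>
    also have "\<dots> \<le> measure \<mu> (shadow z (r + 2 * \<delta> + 1) \<union> range Inl)"
    proof (rule integral_le_measure[OF fb f(2)])
      show "shadow z (r + 2 * \<delta> + 1) \<union> range Inl \<in> events" using shadow_event evI by auto
      show "f \<xi> = 0" if "\<xi> \<in> bordification p" "\<xi> \<notin> shadow z (r + 2 * \<delta> + 1) \<union> range Inl" for \<xi>
        using that by (intro f(4)) (auto simp: bordification_def shadow_def t_def)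
    qed
    also have "\<dots> \<le> measure \<mu> (shadow z (r + 2 * \<delta> + 1)) + measure \<mu> (range Inl)"
      by (rule measure_Un_le[OF shadow_event evI])
    finally show ?thesis by (simp add: measure_range_Inl)
  qed
  then show ?thesis using that[of "r + 2 * \<delta> + 1"] r(1) delta_nonneg by simp
qed

end

section \<open>Horospheric limit points\<close>

locale subgroup_action = patterson_sullivan_action +
  fixes H :: "'b set"
  assumes H: "subgroup H G"
begin

lemma H_carrier: "h \<in> H \<Longrightarrow> h \<in> carrier G"
  using H by (rule subgroup.mem_carrier)

lemma sub_orbit_eq: "sub_orbit G \<phi> H x = (\<lambda>h. \<phi> h x) ` H"
  by (auto simp: sub_orbit_def orbit_def)

definition Hp :: "'a set" where "Hp = (\<lambda>h. \<phi> h p) ` H"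

lemma Hp_orb: "Hp \<subseteq> orb"
  using H_carrier by (auto simp: Hp_def orb_def)

lemma countable_orb: "countable orb"
proof -
  have "orb = (\<Union>n. orb \<inter> cball p (real n))" using real_arch_simple by auto
  then show ?thesis using countable_UN[of UNIV "\<lambda>n. orb \<inter> cball p (real n)"] finite_orb_ball
    by (simp add: countable_finite)
qed

lemma countable_Hp: "countable Hp" using countable_orb Hp_orb countable_subset by blast

lemma finite_Hp_ball: "finite {y\<in>Hp. dist p y \<le> r}"
  by (rule finite_subset[OF _ finite_orb_ball[of p r]]) (use Hp_orb in auto)

text \<open>The union over all \<open>L\<close> is the complement of the small horospheric limit set
  in the boundary: finitely many points of \<open>Hp\<close> below some height have a lowest
  one.\<close>

definition lower :: "real \<Rightarrow> 'a bordif set" where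
  "lower L = {\<xi>\<in>gromov_boundary p. \<forall>y\<in>Hp. - L \<le> bus \<xi> y}"

definition recur :: "real \<Rightarrow> 'a bordif set" where
  "recur L = {\<xi>\<in>gromov_boundary p. infinite {y\<in>Hp. bus \<xi> y \<le> L}}"

lemma recur_mono: "L \<le> L' \<Longrightarrow> recur L \<subseteq> recur L'"
proof
  assume "L \<le> L'"
  then have "{y\<in>Hp. bus \<xi> y \<le> L} \<subseteq> {y\<in>Hp. bus \<xi> y \<le> L'}" for \<xi> by auto
  then show "\<xi> \<in> recur L'" if "\<xi> \<in> recur L" for \<xi>
    using that infinite_super[of "{y\<in>Hp. bus \<xi> y \<le> L}" "{y\<in>Hp. bus \<xi> y \<le> L'}"]
    by (simp add: recur_def)
qed

text \<open>Convergence to \<xi> is automatic: distinct points of \<open>Hp\<close> leave every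
  ball, and at bounded height \<open>bprd\<close>, half of the distance minus the height, tends to
  infinity.\<close>

lemma horoball_approach_iff:
  assumes \<xi>: "\<xi> \<in> gromov_boundary p"
  shows "horoball_approach \<phi> H p \<xi> L \<longleftrightarrow> \<xi> \<in> recur L"
proof
  assume "horoball_approach \<phi> H p \<xi> L"
  then obtain h :: "nat \<Rightarrow> 'b" where h: "range h \<subseteq> H" "inj (\<lambda>n. \<phi> (h n) p)" "\<And>n. \<phi> (h n) p \<in> horoball p \<xi> L"
    unfolding horoball_approach_def by blast
  have "range (\<lambda>n. \<phi> (h n) p) \<subseteq> {y\<in>Hp. bus \<xi> y \<le> L}"
    using h(1,3) by (auto simp: Hp_def horoball_def busemann_near(1)[OF \<xi>])
  moreover have "infinite (range (\<lambda>n. \<phi> (h n) p))" using h(2) by (rule range_inj_infinite)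
  ultimately show "\<xi> \<in> recur L" using \<xi> finite_subset unfolding recur_def by blast
next
  assume "\<xi> \<in> recur L"
  then have "infinite {y\<in>Hp. bus \<xi> y \<le> L}" by (simp add: recur_def)
  then obtain f :: "nat \<Rightarrow> 'a" where f: "inj f" "range f \<subseteq> {y\<in>Hp. bus \<xi> y \<le> L}"
    using infinite_countable_subset by blast
  then have "f n \<in> (\<lambda>h. \<phi> h p) ` H" for n unfolding Hp_def by blast
  then have "\<forall>n. \<exists>h\<in>H. \<phi> h p = f n" by (metis imageE)
  then obtain h where h: "\<And>n. h n \<in> H" "\<And>n. \<phi> (h n) p = f n" by metis
  have "filterlim (\<lambda>n. bprd \<xi> (f n)) at_top sequentially"
    unfolding filterlim_at_top
  proof
    fix R :: real
    have "finite (f -` {y\<in>Hp. dist p y \<le> 2 * R + L})"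
      using f(1) finite_Hp_ball by (intro finite_vimageI)
    then have "\<forall>\<^sub>F n in sequentially. n \<notin> f -` {y\<in>Hp. dist p y \<le> 2 * R + L}"
      by (simp add: cofinite_eq_sequentially[symmetric] eventually_cofinite)
    then show "\<forall>\<^sub>F n in sequentially. R \<le> bprd \<xi> (f n)"
    proof eventually_elim
      case (elim n)
      have "f n \<in> Hp" "bus \<xi> (f n) \<le> L" using f(2) by auto
      then show ?case using elim by (simp add: bprd_def)
    qed
  qed
  then have "limitin (bordif_topology p) (\<lambda>n. Inl (f n)) \<xi> sequentially" by (rule limitin_boundary[OF \<xi>])
  then show "horoball_approach \<phi> H p \<xi> L"
    unfolding horoball_approach_def
  proof (intro exI[of _ h] conjI allI)
    have "bus \<xi> (f n) \<le> L" for n using f(2) by auto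
    then show "\<phi> (h n) p \<in> horoball p \<xi> L" for n by (simp add: h(2) horoball_def busemann_near(1)[OF \<xi>])
  qed (use h f(1) in auto)
qed

lemma approach_limit_set:
  assumes \<xi>: "\<xi> \<in> gromov_boundary p" and app: "horoball_approach \<phi> H p \<xi> L"
  shows "\<xi> \<in> limit_set G \<phi> H p"
proof -
  obtain h :: "nat \<Rightarrow> 'b" where h: "range h \<subseteq> H"
    and lim: "limitin (bordif_topology p) (\<lambda>n. Inl (\<phi> (h n) p)) \<xi> sequentially"
    using app unfolding horoball_approach_def by blast
  have "\<xi> \<in> bordif_topology p derived_set_of (Inl ` sub_orbit G \<phi> H p)"
    unfolding derived_set_of_def
  proof (intro CollectI conjI allI impI)
    show "\<xi> \<in> topspace (bordif_topology p)" using boundary_in_bordification[OF \<xi>] by simp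
    fix T assume "\<xi> \<in> T \<and> openin (bordif_topology p) T"
    then have "\<forall>\<^sub>F n in sequentially. Inl (\<phi> (h n) p) \<in> T" using lim by (simp add: limitin_def)
    then obtain n where "Inl (\<phi> (h n) p) \<in> T" using eventually_happens sequentially_bot by blast
    moreover have "Inl (\<phi> (h n) p) \<noteq> \<xi>" using \<xi> by (auto simp: gromov_boundary_def)
    ultimately show "\<exists>y. y \<noteq> \<xi> \<and> y \<in> Inl ` sub_orbit G \<phi> H p \<and> y \<in> T"
      using h unfolding sub_orbit_eq by (intro exI[of _ "Inl (\<phi> (h n) p)"] conjI imageI) auto
  qed
  then show ?thesis using \<xi> by (simp add: limit_set_def)
qed

lemma horospheric_limit_sets:
  "big_horospheric_limit_set G \<phi> H p = {\<xi>. \<exists>L. \<xi> \<in> recur L}"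
  "small_horospheric_limit_set G \<phi> H p = {\<xi>. \<forall>L. \<xi> \<in> recur L}"
proof -
  have bd: "\<xi> \<in> gromov_boundary p" if "\<xi> \<in> limit_set G \<phi> H p \<or> \<xi> \<in> recur L" for \<xi> L
    using that by (auto simp: recur_def limit_set_def)
  have lim: "\<xi> \<in> limit_set G \<phi> H p \<and> horoball_approach \<phi> H p \<xi> L" if "\<xi> \<in> recur L" for \<xi> L
    using that bd approach_limit_set horoball_approach_iff by metis
  have rec: "\<xi> \<in> recur L" if "\<xi> \<in> limit_set G \<phi> H p" "horoball_approach \<phi> H p \<xi> L" for \<xi> L
    using that bd horoball_approach_iff by metis
  show "big_horospheric_limit_set G \<phi> H p = {\<xi>. \<exists>L. \<xi> \<in> recur L}"
    unfolding big_horospheric_limit_set_def by (intro equalityI subsetI) (use lim rec in blast)+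
  show "small_horospheric_limit_set G \<phi> H p = {\<xi>. \<forall>L. \<xi> \<in> recur L}"
    unfolding small_horospheric_limit_set_def using lim rec by auto
qed

lemma big_eq: "big_horospheric_limit_set G \<phi> H p = (\<Union>n. recur (real n))"
proof -
  have "\<exists>n. \<xi> \<in> recur (real n)" if "\<xi> \<in> recur L" for \<xi> L
    using that recur_mono real_arch_simple[of L] by blast
  then have "(\<exists>L. \<xi> \<in> recur L) \<longleftrightarrow> \<xi> \<in> (\<Union>n. recur (real n))" for \<xi> by auto
  then show ?thesis unfolding horospheric_limit_sets(1) by auto
qed

lemma small_eq: "small_horospheric_limit_set G \<phi> H p = (\<Inter>n. recur (- real n))"
proof -
  have "\<xi> \<in> recur L" if "\<forall>n. \<xi> \<in> recur (- real n)" for \<xi> L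
  proof -
    obtain n where "- L \<le> real n" using real_arch_simple by blast
    then show ?thesis using that recur_mono[of "- real n" L] by auto
  qed
  then have "(\<forall>L. \<xi> \<in> recur L) \<longleftrightarrow> \<xi> \<in> (\<Inter>n. recur (- real n))" for \<xi> by auto
  then show ?thesis unfolding horospheric_limit_sets(2) by auto
qed

lemma bus_le_event: "{\<xi>\<in>gromov_boundary p. bus \<xi> y \<le> L} \<in> events"
  using bus_le_borel by (simp add: sets_mu)

lemma boundary_event: "gromov_boundary p \<in> events"
  using gromov_boundary_borel by (simp add: sets_mu)

text \<open>By local finiteness, infinitely many points of \<open>Hp\<close> in a horoball means one
  beyond every radius; this leaves countable operations on sublevel sets of
  \<open>bus\<close>.\<close>

lemma recur_event: "recur L \<in> events"
proof -
  have "recur L = (\<Inter>n. \<Union>y\<in>{y\<in>Hp. real n \<le> dist p y}. {\<xi>\<in>gromov_boundary p. bus \<xi> y \<le> L})"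
  proof (intro equalityI subsetI)
    fix \<xi> assume \<xi>: "\<xi> \<in> recur L"
    have "\<exists>y\<in>Hp. real n \<le> dist p y \<and> bus \<xi> y \<le> L" for n
    proof (rule ccontr)
      assume "\<not> ?thesis"
      then have "{y\<in>Hp. bus \<xi> y \<le> L} \<subseteq> {y\<in>Hp. dist p y \<le> real n}" by force
      then show False using \<xi> finite_Hp_ball finite_subset by (auto simp: recur_def)
    qed
    then show "\<xi> \<in> (\<Inter>n. \<Union>y\<in>{y\<in>Hp. real n \<le> dist p y}. {\<xi>\<in>gromov_boundary p. bus \<xi> y \<le> L})"
      using \<xi> by (auto simp: recur_def)
  next
    fix \<xi> assume \<xi>: "\<xi> \<in> (\<Inter>n. \<Union>y\<in>{y\<in>Hp. real n \<le> dist p y}. {\<xi>\<in>gromov_boundary p. bus \<xi> y \<le> L})"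
    have "infinite {y\<in>Hp. bus \<xi> y \<le> L}"
    proof
      assume fin: "finite {y\<in>Hp. bus \<xi> y \<le> L}"
      obtain n where n: "\<And>y. y \<in> {y\<in>Hp. bus \<xi> y \<le> L} \<Longrightarrow> dist p y < real n"
      proof -
        have "bdd_above (dist p ` {y\<in>Hp. bus \<xi> y \<le> L})" using fin by simp
        then obtain R where R: "\<And>y. y \<in> {y\<in>Hp. bus \<xi> y \<le> L} \<Longrightarrow> dist p y \<le> R" by (auto simp: bdd_above_def)
        obtain n where "R < real n" using reals_Archimedean2 by blast
        then show ?thesis using R that by (meson le_less_trans)
      qed
      obtain y where "y \<in> Hp" "real n \<le> dist p y" "bus \<xi> y \<le> L" using \<xi> by blast
      then show False using n[of y] by simp
    qed
    then show "\<xi> \<in> recur L" using \<xi> by (auto simp: recur_def)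
  qed
  moreover have "countable {y\<in>Hp. real n \<le> dist p y}" for n
    using countable_Hp by (rule countable_subset[rotated]) auto
  ultimately show ?thesis
    using bus_le_event by (auto intro!: sets.countable_INT sets.countable_UN')
qed

lemma lower_event: "lower L \<in> events"
proof -
  have "lower L = gromov_boundary p - (\<Union>y\<in>Hp. {\<xi>\<in>gromov_boundary p. bus \<xi> y < - L})"
    by (auto simp: lower_def not_less)
  moreover have "(\<Union>y\<in>Hp. {\<xi>\<in>gromov_boundary p. bus \<xi> y < - L}) \<in> events"
    using bus_less_borel countable_Hp by (intro sets.countable_UN') (auto simp: sets_mu)
  ultimately show ?thesis using boundary_event by auto
qed

lemma big_event: "big_horospheric_limit_set G \<phi> H p \<in> events"
  unfolding big_eq using recur_event by auto

lemma small_event: "small_horospheric_limit_set G \<phi> H p \<in> events"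
  unfolding small_eq using recur_event by auto

lemma small_subset_big: "small_horospheric_limit_set G \<phi> H p \<subseteq> big_horospheric_limit_set G \<phi> H p"
  unfolding big_eq small_eq
proof
  fix \<xi> assume "\<xi> \<in> (\<Inter>n. recur (- real n))"
  then have "\<xi> \<in> recur (- real 0)" by blast
  then show "\<xi> \<in> (\<Union>n. recur (real n))" by (intro UN_I[of 0]) auto
qed

section \<open>Almost minimal orbit points\<close>

text \<open>Up to the slack \<open>L\<close>, the orbit points in the Dirichlet domain of
  \<open>H\<close> centred at \<open>p\<close>.\<close>

definition fat :: "real \<Rightarrow> 'a set" where
  "fat L = {z\<in>orb. \<forall>y\<in>Hp. dist p z \<le> dist y z + L}"

definition cover :: "real \<Rightarrow> real \<Rightarrow> real \<Rightarrow> 'a bordif set" where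
  "cover L r n = (\<Union>z\<in>{z\<in>fat L. n \<le> dist p z}. shadow z r)"

lemma cover_event: "cover L r n \<in> events"
  unfolding cover_def
  by (intro sets.countable_UN' countable_subset[OF _ countable_orb]) (auto simp: fat_def intro: shadow_event)

lemma cover_antimono: "n \<le> m \<Longrightarrow> cover L r m \<subseteq> cover L r n"
  by (auto simp: cover_def)

text \<open>For fat \<open>z\<close> the product \<open>prd y z\<close> is at most
  \<open>(dist p y + L) / 2\<close>. Along fat \<open>z\<close> tending to \<xi> this bound passes
  to \<open>bprd \<xi> y\<close> with error \<open>2 * \<delta>\<close>, which is
  \<open>4 * \<delta>\<close> in height.\<close>

lemma cover_Inter: "(\<Inter>n. cover L r (real n)) \<subseteq> lower (L + 4 * \<delta>)"
proof
  fix \<xi> assume \<xi>: "\<xi> \<in> (\<Inter>n. cover L r (real n))"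
  then have bd: "\<xi> \<in> gromov_boundary p" by (auto simp: cover_def shadow_def)
  have "- (L + 4 * \<delta>) \<le> bus \<xi> y" if y: "y \<in> Hp" for y
  proof -
    obtain n where n: "\<bar>r\<bar> + dist p y + \<bar>L\<bar> + 2 * \<delta> + 1 \<le> real n" using real_arch_simple by blast
    have "\<xi> \<in> cover L r (real n)" using \<xi> by blast
    then obtain z where z: "z \<in> fat L" "real n \<le> dist p z" "dist p z - r \<le> bprd \<xi> z"
      by (auto simp: cover_def shadow_def)
    have "dist p z \<le> dist y z + L" using z(1) y by (auto simp: fat_def)
    then have "prd y z \<le> (dist p y + L) / 2" by (simp add: gromov_product_def)
    moreover have "dist p y + \<bar>L\<bar> < bprd \<xi> z - 2 * \<delta>" using z n by linarith
    moreover have "bprd \<xi> y - 2 * \<delta> \<le> prd y z \<or> bprd \<xi> z - 2 * \<delta> \<le> prd y z"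
      using prd_ge_min_bprd[OF bd, of y z] by linarith
    ultimately have "bprd \<xi> y \<le> (dist p y + L) / 2 + 2 * \<delta>"
      using zero_le_dist[of p y] abs_ge_self[of L] abs_ge_zero[of L] by argo
    then show ?thesis by (simp add: bus_eq field_simps)
  qed
  then show "\<xi> \<in> lower (L + 4 * \<delta>)" using bd by (simp add: lower_def)
qed

lemma measure_cover_limit:
  assumes A: "A \<in> events"
  shows "(\<lambda>n. measure \<mu> (cover L r (real n) - A)) \<longlonglongrightarrow> measure \<mu> ((\<Inter>n. cover L r (real n)) - A)"
proof -
  have "(\<lambda>n. measure \<mu> (cover L r (real n) - A)) \<longlonglongrightarrow> measure \<mu> (\<Inter>n. cover L r (real n) - A)"
  proof (rule finite_Lim_measure_decseq)
    show "range (\<lambda>n. cover L r (real n) - A) \<subseteq> events" using cover_event A by auto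
    show "decseq (\<lambda>n. cover L r (real n) - A)"
      using cover_antimono by (intro decseq_SucI) (metis Diff_mono of_nat_le_iff le_Suc_eq order_refl)
  qed
  moreover have "(\<Inter>n. cover L r (real n) - A) = (\<Inter>n. cover L r (real n)) - A" by auto
  ultimately show ?thesis by simp
qed

section \<open>Big and small horospheric limit points coincide almost everywhere\<close>

text \<open>Let \<open>\<xi>\<close> see infinitely many \<open>y \<in> Hp\<close> at bounded height and none above height \<open>L\<close>. Branching off the
  ray to \<open>\<xi>\<close> at the point \<open>z\<close> nearest to \<open>y\<close> and following the geodesic to \<open>y\<close> for a further distance \<open>M\<close>
  leads to boundary points which see \<open>y\<close> high up. They fill a definite proportion of the shadow of \<open>z\<close>.\<close>

lemma shadow_with_hole:
  assumes r1: "0 \<le> r1" and L: "0 \<le> L" and L': "0 \<le> L'"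
  defines "L1 \<equiv> L + 4 * D + 6 * \<delta>"
  defines "r2 \<equiv> 2 * D + r1 + 7 * \<delta>"
  obtains M where "\<And>\<xi> n. \<xi> \<in> lower L \<inter> recur L' \<Longrightarrow> \<exists>z\<in>fat L1. n \<le> dist p z \<and> \<xi> \<in> shadow z r2 \<and>
     (\<exists>v\<in>orb. shadow v r1 \<subseteq> shadow z r2 - lower (L1 + 4 * \<delta>) \<and> dist p v \<le> dist p z + M)"
proof -
  \<comment> \<open>Makes \<open>L' - 2 * M + 2 * D + 2 * r1 + 6 * \<delta>\<close>, the bound for
    the height of \<open>y\<close> seen from the hole, smaller than
    \<open>- (L1 + 4 * \<delta>)\<close>.\<close>
  define M where "M = (L' + L1 + 4 * \<delta> + 2 * D + 2 * r1 + 6 * \<delta>) / 2 + 1"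
  have nn: "0 \<le> D" "0 \<le> \<delta>" "0 \<le> r1" using D_nonneg delta_nonneg r1 by auto
  have M0: "0 \<le> M" using nn L L' by (simp add: M_def L1_def)
  have main: "\<exists>z\<in>fat L1. n \<le> dist p z \<and> \<xi> \<in> shadow z r2 \<and>
     (\<exists>v\<in>orb. shadow v r1 \<subseteq> shadow z r2 - lower (L1 + 4 * \<delta>) \<and> dist p v \<le> dist p z + (2 * D + M))"
    if \<xi>: "\<xi> \<in> lower L \<inter> recur L'" for \<xi> n
  proof -
    have bd: "\<xi> \<in> gromov_boundary p" using \<xi> by (simp add: lower_def)
    \<comment> \<open>As \<open>dist p y = 2 * bprd \<xi> y + bus \<xi> y\<close> with bounded
      height, a distant \<open>y\<close> leaves the ray to \<xi> at a late parameter
      \<open>t\<close>. \<open>T\<close> puts \<open>t\<close> beyond \<open>n\<close> with room to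
      go on by \<open>M\<close> towards \<open>y\<close>.\<close>
    define T where "T = 2 * (\<bar>n\<bar> + D) + L' + 2 * (M + L)"
    have "infinite {y\<in>Hp. bus \<xi> y \<le> L'}" using \<xi> by (simp add: recur_def)
    then have "\<not> {y\<in>Hp. bus \<xi> y \<le> L'} \<subseteq> {y\<in>Hp. dist p y \<le> T}" using finite_Hp_ball finite_subset by blast
    then obtain y where "y \<in> {y\<in>Hp. bus \<xi> y \<le> L'}" "y \<notin> {y\<in>Hp. dist p y \<le> T}" by blast
    then have y: "y \<in> Hp" "bus \<xi> y \<le> L'" "T < dist p y" by auto
    have yL: "- L \<le> bus \<xi> y" using \<xi> y by (simp add: lower_def)
    define t where "t = bprd \<xi> y"
    have yt: "dist p y = 2 * t + bus \<xi> y" by (simp add: t_def bus_eq)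
    have t: "\<bar>n\<bar> + D + (M + L) \<le> t" using yt y by (simp add: T_def)
    have t0: "0 \<le> t" using t nn M0 L by linarith
    obtain z where z: "z \<in> orb" "\<bar>dist p z - t\<bar> \<le> D" "t - D - \<delta> \<le> bprd \<xi> z"
      by (rule shadow_cover[OF bd t0])
    have "t + M \<le> dist p y" using yt yL t nn by linarith
    then obtain v where v: "v \<in> orb" "\<bar>dist p v - (t + M)\<bar> \<le> D" "t + M - D \<le> prd y v"
      using orb_between[of "t + M" y] t0 M0 by (metis add_nonneg_nonneg)
    have zy: "t - D - 3 * \<delta> \<le> prd z y"
      using prd_ge_min_bprd[OF bd, of z y] z(3) nn by (auto simp: t_def min_def split: if_splits)
    have zv: "t - D - 4 * \<delta> \<le> prd z v"
      using hyperbolic[of p z y v] zy v(3) M0 nn by (auto simp: min_def split: if_splits)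
    \<comment> \<open>The height of \<open>z\<close> is at most
      \<open>- dist p z + 4 * D + 2 * \<delta>\<close>, while no point of \<open>Hp\<close> lies
      below \<open>- L\<close>; the Lipschitz bound of \<open>bus\<close> adds
      \<open>4 * \<delta>\<close>. This is the origin of \<open>L1\<close>.\<close>
    have "z \<in> fat L1"
      unfolding fat_def
    proof (intro CollectI conjI ballI)
      show "z \<in> orb" by fact
      fix y' assume "y' \<in> Hp"
      then have "- L \<le> bus \<xi> y'" using \<xi> by (simp add: lower_def)
      then show "dist p z \<le> dist y' z + L1"
        using bus_Lipschitz[OF bd, of y' z] z(2,3) by (simp add: bus_eq[of \<xi> z] L1_def abs_le_iff)
    qed
    moreover have "n \<le> dist p z" using z(2) t M0 L by linarith
    moreover have "\<xi> \<in> shadow z r2" using bd z nn by (auto simp: shadow_def r2_def abs_le_iff)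
    moreover have "shadow v r1 \<subseteq> shadow z r2 - lower (L1 + 4 * \<delta>)"
    proof
      fix \<eta> assume \<eta>: "\<eta> \<in> shadow v r1"
      then have bd': "\<eta> \<in> gromov_boundary p" by (simp add: shadow_def)
      have \<eta>v: "t + M - D - r1 \<le> bprd \<eta> v" using \<eta> v(2) by (simp add: shadow_def abs_le_iff)
      have "t + M - D - r1 - 3 * \<delta> \<le> bprd \<eta> y"
        using bprd_ge_min[OF bd', of y v] \<eta>v v(3) nn by (auto simp: min_def split: if_splits)
      then have "bus \<eta> y \<le> L' - 2 * M + 2 * D + 2 * r1 + 6 * \<delta>"
        using yt y(2) by (simp add: bus_eq[of \<eta>])
      also have "\<dots> < - (L1 + 4 * \<delta>)" by (simp add: M_def field_simps)
      finally have "\<eta> \<notin> lower (L1 + 4 * \<delta>)" using y(1) by (auto simp: lower_def not_le intro!: bexI[of _ y])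
      moreover have "t - D - r1 - 7 * \<delta> \<le> bprd \<eta> z"
        using bprd_ge_min[OF bd', of z v] \<eta>v zv M0 nn by (auto simp: min_def split: if_splits)
      ultimately show "\<eta> \<in> shadow z r2 - lower (L1 + 4 * \<delta>)"
        using bd' z(2) by (auto simp: shadow_def r2_def abs_le_iff)
    qed
    moreover have "dist p v \<le> dist p z + (2 * D + M)" using z(2) v(2) by (simp add: abs_le_iff)
    ultimately show ?thesis using v(1) by blast
  qed
  show ?thesis by (rule that[OF main])
qed

text \<open>Vitali's greedy selection, run through the points in the order of their distance from \<open>p\<close>.\<close>

lemma vitali_selection:
  assumes \<Z>: "\<Z> \<subseteq> orb"
  obtains \<S> where "\<S> \<subseteq> \<Z>" "\<And>z z'. z \<in> \<S> \<Longrightarrow> z' \<in> \<S> \<Longrightarrow> z \<noteq> z' \<Longrightarrow> S z \<inter> S z' = {}"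
    "\<And>z. z \<in> \<Z> \<Longrightarrow> \<exists>z'\<in>\<S>. dist p z' \<le> dist p z + 1 \<and> (z = z' \<or> S z \<inter> S z' \<noteq> {})"
proof -
  define lev where "lev z = nat \<lfloor>dist p z\<rfloor>" for z
  \<comment> \<open>Integer levels make the order well-founded, at the price of 1 in the comparison
    of distances; the enumeration of \<open>orb\<close> breaks ties, so that distinct points are
    comparable.\<close>
  define r where "r = inv_image (less_than <*lex*> less_than) (\<lambda>z. (lev z, to_nat_on orb z))"
  have wf: "wf r" unfolding r_def by (intro wf_inv_image wf_lex_prod wf_less_than)
  have r_dist: "dist p z' \<le> dist p z + 1" if "(z', z) \<in> r" for z z'
  proof -
    have "lev z' \<le> lev z" using that by (auto simp: r_def)
    then have "\<lfloor>dist p z'\<rfloor> \<le> \<lfloor>dist p z\<rfloor>" by (simp add: lev_def nat_le_eq_zle)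
    then show ?thesis by linarith
  qed
  have r_total: "(z', z) \<in> r \<or> (z, z') \<in> r" if "z \<in> orb" "z' \<in> orb" "z \<noteq> z'" for z z'
  proof -
    have "to_nat_on orb z \<noteq> to_nat_on orb z'"
      using inj_on_eq_iff[OF inj_on_to_nat_on[OF countable_orb]] that by simp
    then show ?thesis
      using less_linear[of "lev z" "lev z'"] less_linear[of "to_nat_on orb z" "to_nat_on orb z'"]
      unfolding r_def in_inv_image in_lex_prod less_than_iff by metis
  qed
  \<comment> \<open>Greedy choice as well-founded recursion: a point is taken if its set misses
    those of all earlier taken points.\<close>
  define sel where "sel = wfrec r (\<lambda>f z. \<forall>z'. (z', z) \<in> r \<longrightarrow> z' \<in> \<Z> \<longrightarrow> f z' \<longrightarrow> S z \<inter> S z' = {})"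
  have sel: "sel z \<longleftrightarrow> (\<forall>z'. (z', z) \<in> r \<longrightarrow> z' \<in> \<Z> \<longrightarrow> sel z' \<longrightarrow> S z \<inter> S z' = {})" for z
    unfolding sel_def by (subst wfrec[OF wf]) (simp add: cut_def)
  show ?thesis
  proof (rule that[of "{z\<in>\<Z>. sel z}"])
    show "S z \<inter> S z' = {}" if "z \<in> {z\<in>\<Z>. sel z}" "z' \<in> {z\<in>\<Z>. sel z}" "z \<noteq> z'" for z z'
    proof -
      have "(z', z) \<in> r \<or> (z, z') \<in> r" using that \<Z> r_total[of z z'] by blast
      then show ?thesis using sel[of z] sel[of z'] that by blast
    qed
    show "\<exists>z'\<in>{z\<in>\<Z>. sel z}. dist p z' \<le> dist p z + 1 \<and> (z = z' \<or> S z \<inter> S z' \<noteq> {})" if "z \<in> \<Z>" for z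
    proof (cases "sel z")
      case True
      then show ?thesis using that by (intro bexI[of _ z]) auto
    next
      case False
      then obtain z' where "(z', z) \<in> r" "z' \<in> \<Z>" "sel z'" "S z \<inter> S z' \<noteq> {}" using sel[of z] by blast
      then show ?thesis using r_dist by blast
    qed
  qed auto
qed

text \<open>The enlarged selected shadows cover the set, and each has at most \<open>C\<close> times
  the mass of its hole. The disjoint holes lie in \<open>cover L1 r2 n\<close> outside
  \<open>E\<close>; since \<open>cover_Inter\<close> puts the intersection of the covers into
  \<open>E\<close>, their total mass tends to 0 with \<open>n\<close>.\<close>

lemma lower_recur_null:
  assumes L: "0 \<le> L" and L': "0 \<le> L'"
  shows "measure \<mu> (lower L \<inter> recur L') = 0"
proof -
  obtain r1 where r1: "0 \<le> r1" "\<And>z. z \<in> orb \<Longrightarrow> exp (- omega * dist p z) / 2 \<le> measure \<mu> (shadow z r1)"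
    by (rule measure_shadow_lower) blast
  define L1 where "L1 = L + 4 * D + 6 * \<delta>"
  define r2 where "r2 = 2 * D + r1 + 7 * \<delta>"
  \<comment> \<open>Comparing two centres through a common boundary point costs
    \<open>2 * \<delta>\<close>, passing to another boundary point \<open>3 * \<delta>\<close>, and
    the selection order 1.\<close>
  define r3 where "r3 = r2 + 5 * \<delta> + 1"
  have r0: "0 \<le> r2" "0 \<le> r3" using r1 D_nonneg delta_nonneg by (simp_all add: r2_def r3_def)
  obtain M where hole: "\<And>\<xi> n. \<xi> \<in> lower L \<inter> recur L' \<Longrightarrow> \<exists>z\<in>fat L1. n \<le> dist p z \<and> \<xi> \<in> shadow z r2 \<and>
     (\<exists>v\<in>orb. shadow v r1 \<subseteq> shadow z r2 - lower (L1 + 4 * \<delta>) \<and> dist p v \<le> dist p z + M)"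
    using shadow_with_hole[OF r1(1) L L'] unfolding L1_def r2_def by metis
  define A where "A = lower L \<inter> recur L'"
  define E where "E = lower (L1 + 4 * \<delta>)"
  \<comment> \<open>Quotient of the upper bound for \<open>shadow z r3\<close> and the lower bound
    for a hole centred at most \<open>M\<close> further out.\<close>
  define C where "C = exp (2 * omega * (r3 + 2 * \<delta> + 1)) * 2 * exp (omega * M)"
  have C: "0 < C" by (simp add: C_def)
  have bound: "measure \<mu> A \<le> C * measure \<mu> (cover L1 r2 (real n) - E)" for n
  proof -
    define \<Z> where "\<Z> = {z\<in>fat L1. real n \<le> dist p z \<and>
      (\<exists>v\<in>orb. shadow v r1 \<subseteq> shadow z r2 - E \<and> dist p v \<le> dist p z + M)}"
    have \<Z>: "\<Z> \<subseteq> orb" by (auto simp: \<Z>_def fat_def)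
    obtain \<S> where \<S>: "\<S> \<subseteq> \<Z>" "\<And>z z'. z \<in> \<S> \<Longrightarrow> z' \<in> \<S> \<Longrightarrow> z \<noteq> z' \<Longrightarrow> shadow z r2 \<inter> shadow z' r2 = {}"
      "\<And>z. z \<in> \<Z> \<Longrightarrow> \<exists>z'\<in>\<S>. dist p z' \<le> dist p z + 1 \<and> (z = z' \<or> shadow z r2 \<inter> shadow z' r2 \<noteq> {})"
      using vitali_selection[OF \<Z>, of "\<lambda>z. shadow z r2"] by blast
    have enlarge: "shadow z r2 \<subseteq> shadow z' r3"
      if "dist p z' \<le> dist p z + 1" and meet: "z = z' \<or> shadow z r2 \<inter> shadow z' r2 \<noteq> {}" for z z'
    proof (cases "z = z'")
      case True
      then show ?thesis using delta_nonneg by (auto simp: shadow_def r3_def)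
    next
      case False
      then obtain \<eta> where \<eta>: "\<eta> \<in> shadow z r2" "\<eta> \<in> shadow z' r2" using meet by blast
      have zz: "dist p z' - 1 - r2 - 2 * \<delta> \<le> prd z' z"
        using prd_ge_min_bprd[of \<eta> z' z] \<eta> that(1) by (auto simp: shadow_def min_def split: if_splits)
      show ?thesis
      proof
        fix \<xi> assume \<xi>: "\<xi> \<in> shadow z r2"
        then have bd: "\<xi> \<in> gromov_boundary p" by (simp add: shadow_def)
        have "dist p z' - r3 \<le> bprd \<xi> z'"
          using bprd_ge_min[OF bd, of z' z] zz \<xi> that(1) delta_nonneg
          by (auto simp: shadow_def r3_def min_def split: if_splits)
        then show "\<xi> \<in> shadow z' r3" using bd by (simp add: shadow_def)
      qed
    qed
    define v where "v z = (SOME v. v \<in> orb \<and> shadow v r1 \<subseteq> shadow z r2 - E \<and> dist p v \<le> dist p z + M)" for z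
    have v: "v z \<in> orb" "shadow (v z) r1 \<subseteq> shadow z r2 - E" "dist p (v z) \<le> dist p z + M" if "z \<in> \<S>" for z
    proof -
      have "\<exists>v. v \<in> orb \<and> shadow v r1 \<subseteq> shadow z r2 - E \<and> dist p v \<le> dist p z + M"
        using that \<S>(1) by (auto simp: \<Z>_def)
      from someI_ex[OF this] show "v z \<in> orb" "shadow (v z) r1 \<subseteq> shadow z r2 - E" "dist p (v z) \<le> dist p z + M"
        by (auto simp: v_def)
    qed
    \<comment> \<open>The selection may be infinite; the estimate is made for finite truncations and
      passed to their increasing union.\<close>
    define \<S>' where "\<S>' k = {z\<in>\<S>. dist p z \<le> real k}" for k :: nat
    have fin: "finite (\<S>' k)" for k
      by (rule finite_subset[OF _ finite_orb_ball[of p "real k"]]) (use \<S>(1) \<Z> in \<open>auto simp: \<S>'_def\<close>)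
    have level: "measure \<mu> (\<Union>z\<in>\<S>' k. shadow z r3) \<le> C * measure \<mu> (cover L1 r2 (real n) - E)" for k
    proof -
      have "measure \<mu> (\<Union>z\<in>\<S>' k. shadow z r3) \<le> (\<Sum>z\<in>\<S>' k. measure \<mu> (shadow z r3))"
        using fin shadow_event by (intro finite_measure_subadditive_finite) auto
      also have "\<dots> \<le> (\<Sum>z\<in>\<S>' k. C * measure \<mu> (shadow (v z) r1))"
      proof (rule sum_mono)
        fix z assume "z \<in> \<S>' k"
        then have z: "z \<in> \<S>" "z \<in> orb" using \<S>(1) \<Z> by (auto simp: \<S>'_def)
        have "measure \<mu> (shadow z r3) \<le> exp (2 * omega * (r3 + 2 * \<delta> + 1)) * exp (- omega * dist p z)"
          by (rule measure_shadow_upper[OF z(2) r0(2)])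
        also have "\<dots> = C * (exp (- omega * (dist p z + M)) / 2)"
          by (simp add: C_def exp_add[symmetric] algebra_simps mult_exp_exp)
        also have "\<dots> \<le> C * (exp (- omega * dist p (v z)) / 2)"
          using v(3)[OF z(1)] omega_positive C by (intro mult_left_mono divide_right_mono) auto
        also have "\<dots> \<le> C * measure \<mu> (shadow (v z) r1)"
          using r1(2)[OF v(1)[OF z(1)]] C by (intro mult_left_mono) auto
        finally show "measure \<mu> (shadow z r3) \<le> C * measure \<mu> (shadow (v z) r1)" .
      qed
      also have "\<dots> = C * measure \<mu> (\<Union>z\<in>\<S>' k. shadow (v z) r1)"
      proof -
        have "disjoint_family_on (\<lambda>z. shadow (v z) r1) (\<S>' k)"
          unfolding disjoint_family_on_def
        proof (intro ballI impI)
          fix z z' assume zz': "z \<in> \<S>' k" "z' \<in> \<S>' k" "z \<noteq> z'"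
          then have "shadow z r2 \<inter> shadow z' r2 = {}" using \<S>(2) by (auto simp: \<S>'_def)
          then show "shadow (v z) r1 \<inter> shadow (v z') r1 = {}"
            using v(2)[of z] v(2)[of z'] zz' by (auto simp: \<S>'_def)
        qed
        then have "measure \<mu> (\<Union>z\<in>\<S>' k. shadow (v z) r1) = (\<Sum>z\<in>\<S>' k. measure \<mu> (shadow (v z) r1))"
          using fin shadow_event by (intro finite_measure_finite_Union) auto
        then show ?thesis by (simp add: sum_distrib_left)
      qed
      also have "\<dots> \<le> C * measure \<mu> (cover L1 r2 (real n) - E)"
      proof (intro mult_left_mono finite_measure_mono)
        show "(\<Union>z\<in>\<S>' k. shadow (v z) r1) \<subseteq> cover L1 r2 (real n) - E"
        proof
          fix \<eta> assume "\<eta> \<in> (\<Union>z\<in>\<S>' k. shadow (v z) r1)"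
          then obtain z where z: "z \<in> \<S>" "\<eta> \<in> shadow (v z) r1" by (auto simp: \<S>'_def)
          then have "\<eta> \<in> shadow z r2 - E" using v(2) by blast
          moreover have "z \<in> fat L1" "real n \<le> dist p z" using z \<S>(1) by (auto simp: \<Z>_def)
          ultimately show "\<eta> \<in> cover L1 r2 (real n) - E" by (auto simp: cover_def)
        qed
        show "cover L1 r2 (real n) - E \<in> events" unfolding E_def using cover_event lower_event by auto
      qed (use C in auto)
      finally show ?thesis .
    qed
    have "(\<lambda>k. measure \<mu> (\<Union>z\<in>\<S>' k. shadow z r3)) \<longlonglongrightarrow> measure \<mu> (\<Union>k. \<Union>z\<in>\<S>' k. shadow z r3)"
    proof (rule finite_Lim_measure_incseq)
      show "range (\<lambda>k. \<Union>z\<in>\<S>' k. shadow z r3) \<subseteq> events" using fin shadow_event by auto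
      show "incseq (\<lambda>k. \<Union>z\<in>\<S>' k. shadow z r3)" by (rule incseq_SucI) (auto simp: \<S>'_def)
    qed
    then have lim: "measure \<mu> (\<Union>k. \<Union>z\<in>\<S>' k. shadow z r3) \<le> C * measure \<mu> (cover L1 r2 (real n) - E)"
      using level by (intro LIMSEQ_le_const2) auto
    have "A \<subseteq> (\<Union>k. \<Union>z\<in>\<S>' k. shadow z r3)"
    proof
      fix \<xi> assume "\<xi> \<in> A"
      then obtain z where z: "z \<in> \<Z>" "\<xi> \<in> shadow z r2"
        using hole[of \<xi> "real n"] by (auto simp: A_def \<Z>_def E_def)
      obtain z' where z': "z' \<in> \<S>" "dist p z' \<le> dist p z + 1" "z = z' \<or> shadow z r2 \<inter> shadow z' r2 \<noteq> {}"
        using \<S>(3)[OF z(1)] by blast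
      have "\<xi> \<in> shadow z' r3" using enlarge[OF z'(2,3)] z(2) by blast
      moreover obtain k where "dist p z' \<le> real k" using real_arch_simple by blast
      ultimately show "\<xi> \<in> (\<Union>k. \<Union>z\<in>\<S>' k. shadow z r3)" using z'(1) by (auto simp: \<S>'_def)
    qed
    moreover have "(\<Union>k. \<Union>z\<in>\<S>' k. shadow z r3) \<in> events"
    proof -
      have "(\<Union>z\<in>\<S>' k. shadow z r3) \<in> events" for k using fin shadow_event by (intro sets.finite_UN) auto
      then show ?thesis by auto
    qed
    ultimately show ?thesis using finite_measure_mono lim by (meson order_trans)
  qed
  have E: "E \<in> events" by (simp add: E_def lower_event)
  have empty: "(\<Inter>n. cover L1 r2 (real n)) - E = {}" using cover_Inter[of L1 r2] by (auto simp: E_def)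
  have "(\<lambda>n. measure \<mu> (cover L1 r2 (real n) - E)) \<longlonglongrightarrow> 0"
    using measure_cover_limit[OF E, of L1 r2] unfolding empty by simp
  then have "(\<lambda>n. C * measure \<mu> (cover L1 r2 (real n) - E)) \<longlonglongrightarrow> C * 0" by (intro tendsto_intros)
  then have "measure \<mu> A \<le> C * 0" using bound by (intro LIMSEQ_le_const) auto
  then show ?thesis using measure_nonneg[of \<mu> A] unfolding A_def by linarith
qed

text \<open>A boundary point that is not small lies in \<open>lower i\<close> for some
  \<open>i\<close>; if it is big, also in \<open>recur j\<close> for some \<open>j\<close>. Only
  countably many null sets are added.\<close>

lemma big_full_imp_small_full:
  assumes big: "full_in_boundary p \<mu> (big_horospheric_limit_set G \<phi> H p)"
  shows "full_in_boundary p \<mu> (small_horospheric_limit_set G \<phi> H p)"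
proof -
  let ?B = "gromov_boundary p - big_horospheric_limit_set G \<phi> H p"
  have "?B \<in> null_sets \<mu>" using big by (simp add: full_in_boundary_def)
  moreover have "lower (real i) \<inter> recur (real j) \<in> null_sets \<mu>" for i j
    using lower_recur_null[of "real i" "real j"] lower_event recur_event
    by (auto simp: null_sets_def emeasure_eq_measure)
  ultimately have null: "?B \<union> (\<Union>i. \<Union>j. lower (real i) \<inter> recur (real j)) \<in> null_sets \<mu>"
    by (intro null_sets.Un null_sets_UN) auto
  have "gromov_boundary p - small_horospheric_limit_set G \<phi> H p \<subseteq> ?B \<union> (\<Union>i. \<Union>j. lower (real i) \<inter> recur (real j))"
  proof
    fix \<xi> assume \<xi>: "\<xi> \<in> gromov_boundary p - small_horospheric_limit_set G \<phi> H p"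
    then obtain n where "\<xi> \<notin> recur (- real n)" by (auto simp: small_eq)
    then have fin: "finite {y\<in>Hp. bus \<xi> y \<le> - real n}" using \<xi> by (simp add: recur_def)
    obtain i where i: "\<xi> \<in> lower (real i)"
    proof -
      have "bdd_below (bus \<xi> ` {y\<in>Hp. bus \<xi> y \<le> - real n})" using fin by simp
      then obtain m where m: "\<And>y. y \<in> Hp \<Longrightarrow> bus \<xi> y \<le> - real n \<Longrightarrow> m \<le> bus \<xi> y" by (auto simp: bdd_below_def)
      obtain i where i: "max (real n) (- m) \<le> real i" using real_arch_simple by blast
      have "- real i \<le> bus \<xi> y" if "y \<in> Hp" for y using m[OF that] i by linarith
      then show ?thesis using that \<xi> by (auto simp: lower_def)
    qed
    then show "\<xi> \<in> ?B \<union> (\<Union>i. \<Union>j. lower (real i) \<inter> recur (real j))" using \<xi> by (auto simp: big_eq)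
  qed
  moreover have "gromov_boundary p - small_horospheric_limit_set G \<phi> H p \<in> events"
    using boundary_event small_event by auto
  ultimately show ?thesis unfolding full_in_boundary_def using null null_sets_subset by blast
qed

lemma small_full_imp_big_full:
  assumes small: "full_in_boundary p \<mu> (small_horospheric_limit_set G \<phi> H p)"
  shows "full_in_boundary p \<mu> (big_horospheric_limit_set G \<phi> H p)"
proof -
  have "gromov_boundary p - big_horospheric_limit_set G \<phi> H p \<in> events"
    using boundary_event big_event by auto
  then show ?thesis
    using small small_subset_big null_sets_subset unfolding full_in_boundary_def by blast
qed

lemma small_full_iff_measure:
  "full_in_boundary p \<mu> (small_horospheric_limit_set G \<phi> H p) \<longleftrightarrow> \<not> measure \<mu> (small_horospheric_limit_set G \<phi> H p) < 1"
proof -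
  let ?S = "small_horospheric_limit_set G \<phi> H p"
  have "?S \<subseteq> gromov_boundary p" by (auto simp: small_eq recur_def)
  then have "measure \<mu> (gromov_boundary p - ?S) = 1 - measure \<mu> ?S"
    using finite_measure_Diff[OF boundary_event small_event] measure_gromov_boundary by simp
  moreover have "full_in_boundary p \<mu> ?S \<longleftrightarrow> measure \<mu> (gromov_boundary p - ?S) = 0"
    using boundary_event small_event by (auto simp: full_in_boundary_def null_sets_def emeasure_eq_measure)
  ultimately show ?thesis using prob_le_1[of ?S] by (auto simp: less_le)
qed

end

section \<open>Growth of the quotient\<close>

context subgroup_action
begin

section \<open>Orbits of \<open>H\<close> and their representatives nearest to
  \<open>p\<close>\<close>

abbreviation cls :: "'a \<Rightarrow> 'a set" where "cls \<equiv> sub_orbit G \<phi> H"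

lemma cls_self: "x \<in> cls x"
  unfolding sub_orbit_eq using subgroup.one_closed[OF H] act_one[of x] by (metis imageI)

lemma cls_act: assumes "h \<in> H" shows "cls (\<phi> h x) = cls x"
proof -
  have mem: "h' \<otimes> h'' \<in> H" "inv h' \<in> H" if "h' \<in> H" "h'' \<in> H" for h' h''
    using H that by (auto intro: subgroup.m_closed subgroup.m_inv_closed)
  have "\<phi> k (\<phi> h x) \<in> cls x" if "k \<in> H" for k
    using mem(1)[OF that assms] that assms H_carrier by (auto simp: sub_orbit_eq act_mult[symmetric])
  moreover have "\<phi> k x \<in> cls (\<phi> h x)" if k: "k \<in> H" for k
  proof -
    have "\<phi> k x = \<phi> (k \<otimes> inv h) (\<phi> h x)" using k assms H_carrier by (simp add: act_mult act_inv)
    moreover have "k \<otimes> inv h \<in> H" using k mem assms by blast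
    ultimately show ?thesis by (auto simp: sub_orbit_eq)
  qed
  ultimately show ?thesis by (auto simp: sub_orbit_eq[of x] sub_orbit_eq[of "\<phi> h x"])
qed

lemma cls_near:
  assumes e: "0 < e" obtains h where "h \<in> H" "dist u (\<phi> h x) < setdist (cls u) (cls x) + e"
proof -
  have "(INF h\<in>H. dist u (\<phi> h x)) < setdist (cls u) (cls x) + e"
    using setdist_sub_orbit[OF isometric H, of u x] e by simp
  moreover have "H \<noteq> {}" using subgroup.one_closed[OF H] by blast
  ultimately show ?thesis using that cInf_lessD[of "(\<lambda>h. dist u (\<phi> h x)) ` H"] by blast
qed

lemma setdist_cls_le: "setdist (cls u) (cls x) \<le> dist u x"
  by (rule setdist_le_dist[OF cls_self cls_self])

lemma Hp_eq: "Hp = cls p" by (simp add: Hp_def sub_orbit_eq)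

lemma orb_act_H: "h \<in> H \<Longrightarrow> z \<in> orb \<Longrightarrow> \<phi> h z \<in> orb"
  using act_orb H_carrier by blast

text \<open>Choose \<open>h\<close> almost minimising \<open>dist p (\<phi> h z)\<close>; every
  distance from \<open>Hp\<close> to the orbit of \<open>z\<close> is at least the quotient
  distance, so \<open>p\<close> is almost nearest.\<close>

lemma fat_representative:
  assumes z: "z \<in> orb"
  obtains z' where "z' \<in> fat 1" "cls z' = cls z" "dist p z' \<le> setdist (cls p) (cls z) + 1"
proof -
  obtain h where h: "h \<in> H" "dist p (\<phi> h z) < setdist (cls p) (cls z) + 1" by (rule cls_near[of 1 p z]) auto
  have "\<phi> h z \<in> fat 1"
    unfolding fat_def
  proof (intro CollectI conjI ballI)
    show "\<phi> h z \<in> orb" using h z orb_act_H by blast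
    fix y assume "y \<in> Hp"
    then have "setdist (cls p) (cls z) \<le> dist y (\<phi> h z)"
      using h by (intro setdist_le_dist) (auto simp: Hp_eq sub_orbit_eq)
    then show "dist p (\<phi> h z) \<le> dist y (\<phi> h z) + 1" using h by simp
  qed
  then show ?thesis using that cls_act[OF h(1), of z] h by auto
qed

definition near_orbits :: "real \<Rightarrow> 'a set set" where
  "near_orbits t = cls ` {z\<in>orb. setdist (cls p) (cls z) \<le> t}"

lemma quotient_orbit_count_eq: "quotient_orbit_count G \<phi> H p n = card (near_orbits (real n))"
proof -
  have "{cls (\<phi> g p) |g. g \<in> carrier G \<and> setdist (cls p) (cls (\<phi> g p)) \<le> real n} = near_orbits (real n)"
    by (auto simp: near_orbits_def orb_def)
  then show ?thesis by (simp add: quotient_orbit_count_def)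
qed

lemma near_orbits_subset: "near_orbits t \<subseteq> cls ` (fat 1 \<inter> cball p (t + 1))"
proof
  fix b assume "b \<in> near_orbits t"
  then obtain z where z: "z \<in> orb" "setdist (cls p) (cls z) \<le> t" "b = cls z" by (auto simp: near_orbits_def)
  obtain z' where "z' \<in> fat 1" "cls z' = cls z" "dist p z' \<le> setdist (cls p) (cls z) + 1"
    by (rule fat_representative[OF z(1)])
  then show "b \<in> cls ` (fat 1 \<inter> cball p (t + 1))" using z by (auto intro!: image_eqI[of _ _ z'])
qed

lemma finite_fat_ball: "finite (fat L \<inter> cball p t)"
  by (rule finite_subset[OF _ finite_orb_ball[of p t]]) (auto simp: fat_def)

lemma finite_near_orbits: "finite (near_orbits t)"
  by (rule finite_subset[OF near_orbits_subset finite_imageI[OF finite_fat_ball]])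

lemma card_near_orbits_le_fat: "card (near_orbits t) \<le> card (fat 1 \<inter> cball p (t + 1))"
  using card_mono[OF finite_imageI[OF finite_fat_ball] near_orbits_subset] card_image_le[OF finite_fat_ball]
  by (meson order_trans)

lemma card_near_orbits_le_cnt: "card (near_orbits t) \<le> cnt (t + 1)"
proof -
  have "card (fat 1 \<inter> cball p (t + 1)) \<le> cnt (t + 1)"
    unfolding cnt_def by (intro card_mono finite_orb_ball) (auto simp: fat_def)
  then show ?thesis using card_near_orbits_le_fat[of t] by simp
qed

lemma near_orbits_mono: "s \<le> t \<Longrightarrow> card (near_orbits s) \<le> card (near_orbits t)"
  by (intro card_mono finite_near_orbits) (auto simp: near_orbits_def)

lemma card_near_orbits_ge_1: "0 \<le> t \<Longrightarrow> 1 \<le> card (near_orbits t)"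
proof -
  assume "0 \<le> t"
  then have "cls p \<in> near_orbits t" using base_in_orb setdist_cls_le[of p p] by (auto simp: near_orbits_def)
  then show ?thesis using finite_near_orbits[of t] by (auto simp: Suc_le_eq card_gt_0_iff)
qed

text \<open>Outside the big horospheric limit set only finitely many points of \<open>Hp\<close> lie in a given horoball. Then
  boundedly many points of the same \<open>H\<close>-orbit can shadow the given boundary point at the same distance: if \<open>z\<close>
  and \<open>h z\<close> do, then \<open>inv h p\<close> lies in the horoball of the level used here.\<close>

definition few_recurrences :: "nat \<Rightarrow> 'a bordif set" where
  "few_recurrences N = {\<xi>\<in>gromov_boundary p. finite {y\<in>Hp. bus \<xi> y \<le> 6 * D + 6 * \<delta>} \<and>
     card {y\<in>Hp. bus \<xi> y \<le> 6 * D + 6 * \<delta>} \<le> N}"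

text \<open>The shadows of \<open>V\<close> cover; \<open>V\<close> lies at most
  \<open>N * stab\<close> to one over the near orbits, and each shadow has mass at most a multiple
  of \<open>exp (- omega * m)\<close>. Bounding a measurable superset \<open>S\<close> avoids
  measurability of \<open>few_recurrences\<close> itself.\<close>

lemma few_recurrences_cover:
  obtains C k where "0 < C"
    "\<And>N m. k \<le> m \<Longrightarrow> \<exists>S\<in>events. few_recurrences N \<subseteq> S \<and>
      measure \<mu> S \<le> C * real N * (real (card (near_orbits (real m))) * exp (- omega * real m))"
proof -
  define r where "r = 2 * D + \<delta>"
  have r: "0 \<le> r" using D_nonneg delta_nonneg by (simp add: r_def)
  define k where "k = nat \<lceil>D\<rceil>"
  have k: "D \<le> real k" unfolding k_def by linarith
  define C0 where "C0 = exp (2 * omega * (r + 2 * \<delta> + 1))"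
  define C where "C = (real stab + 1) * C0 * exp (omega * (real k + D))"
  have C: "0 < C" by (simp add: C_def C0_def add_nonneg_pos)
  have main: "\<exists>S\<in>events. few_recurrences N \<subseteq> S \<and>
      measure \<mu> S \<le> C * real N * (real (card (near_orbits (real m))) * exp (- omega * real m))" if m: "k \<le> m" for N m
  proof -
    define Y where "Y \<xi> = {y\<in>Hp. bus \<xi> y \<le> 6 * D + 6 * \<delta>}" for \<xi>
    define Q where "Q = few_recurrences N"
    have Q_iff: "\<xi> \<in> Q \<longleftrightarrow> \<xi> \<in> gromov_boundary p \<and> finite (Y \<xi>) \<and> card (Y \<xi>) \<le> N" for \<xi>
      by (simp add: Q_def few_recurrences_def Y_def)
    \<comment> \<open>The shadowing points lie at distance at most \<open>n + D\<close>, which must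
      not exceed \<open>m\<close>.\<close>
    define n where "n = real (m - k)"
    have n: "n = real m - real k" "0 \<le> n" using m by (simp_all add: n_def of_nat_diff)
    define V where "V = {z\<in>orb. \<bar>dist p z - n\<bar> \<le> D \<and> (\<exists>\<xi>\<in>Q. \<xi> \<in> shadow z r)}"
    have finV: "finite V"
      by (rule finite_subset[OF _ finite_orb_ball[of p "n + D"]]) (auto simp: V_def abs_le_iff)
    have fiber: "card {z'\<in>V. cls z' = b} \<le> N * stab" if b: "b \<in> cls ` V" for b
    proof -
      obtain z where z: "z \<in> V" "b = cls z" using b by blast
      then obtain \<xi> where \<xi>: "\<xi> \<in> Q" "\<xi> \<in> shadow z r" by (auto simp: V_def)
      have bd: "\<xi> \<in> gromov_boundary p" using \<xi> by (simp add: shadow_def)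
      have Y: "finite (Y \<xi>)" "card (Y \<xi>) \<le> N" using \<xi> by (auto simp: Q_iff)
      let ?A = "\<Union>y\<in>Y \<xi>. {h\<in>carrier G. \<phi> h p = y}"
      have finA: "finite ?A" using Y card_act_eq(1) by auto
      have "{z'\<in>V. cls z' = b} \<subseteq> (\<lambda>h. \<phi> (inv h) z) ` ?A"
      proof
        fix z' assume z': "z' \<in> {z'\<in>V. cls z' = b}"
        then have "z' \<in> cls z" using cls_self[of z'] z by simp
        then obtain h where h: "h \<in> H" "z' = \<phi> h z" by (auto simp: sub_orbit_eq)
        have hG: "h \<in> carrier G" using h H_carrier by blast
        have ih: "inv h \<in> H" "inv h \<in> carrier G" using h(1) H subgroup.m_inv_closed hG by auto
        define y where "y = \<phi> (inv h) p"
        have yH: "y \<in> Hp" using ih by (auto simp: y_def Hp_def)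
        have "dist y z = dist p z'"
          using act_dist[OF hG, of y z] hG h by (simp add: y_def act_inv')
        then have "dist y z \<le> dist p z + 2 * D" using z' z by (auto simp: V_def abs_le_iff)
        moreover have "bus \<xi> z \<le> - dist p z + 2 * r" using \<xi>(2) by (simp add: shadow_def bus_eq)
        \<comment> \<open>Origin of the level: \<open>2 * D\<close> from two points of the annulus,
          \<open>2 * r = 4 * D + 2 * \<delta>\<close> from the shadow, and
          \<open>4 * \<delta>\<close> from the Lipschitz bound.\<close>
        ultimately have "bus \<xi> y \<le> 6 * D + 6 * \<delta>"
          using bus_Lipschitz[OF bd, of y z] by (simp add: r_def abs_le_iff)
        then have "inv h \<in> ?A" using yH ih by (auto simp: Y_def y_def)
        moreover have "z' = \<phi> (inv (inv h)) z" using h hG by simp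
        ultimately show "z' \<in> (\<lambda>h. \<phi> (inv h) z) ` ?A" by blast
      qed
      then have "card {z'\<in>V. cls z' = b} \<le> card ?A" using finA by (rule surj_card_le[rotated])
      also have "\<dots> \<le> (\<Sum>y\<in>Y \<xi>. card {h\<in>carrier G. \<phi> h p = y})" using Y by (intro card_UN_le) auto
      also have "\<dots> \<le> of_nat (card (Y \<xi>)) * stab" using card_act_eq(2)[OF base_in_orb] by (intro sum_bounded_above) auto
      also have "\<dots> \<le> N * stab" using Y by simp
      finally show ?thesis .
    qed
    have "cls ` V \<subseteq> near_orbits (real m)"
    proof (rule image_subsetI)
      fix z assume "z \<in> V"
      then have "z \<in> orb" "dist p z \<le> real m" using n k by (auto simp: V_def abs_le_iff)
      then show "cls z \<in> near_orbits (real m)" using setdist_cls_le[of p z] by (auto simp: near_orbits_def)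
    qed
    then have cV: "card (cls ` V) \<le> card (near_orbits (real m))" using finite_near_orbits by (intro card_mono)
    have "card V = (\<Sum>b\<in>cls ` V. card {z\<in>V. cls z = b})"
      using sum.image_gen[OF finV, of "\<lambda>_. 1 :: nat" cls] by simp
    also have "\<dots> \<le> of_nat (card (cls ` V)) * (N * stab)" using fiber by (intro sum_bounded_above) auto
    also have "\<dots> \<le> card (near_orbits (real m)) * (N * stab)" using cV by simp
    finally have "card V \<le> card (near_orbits (real m)) * (N * stab)" .
    then have cardV: "real (card V) \<le> real (card (near_orbits (real m))) * (real N * real stab)"
      by (metis of_nat_le_iff of_nat_mult)
    define S where "S = (\<Union>z\<in>V. shadow z r)"
    have "S \<in> events" unfolding S_def using finV shadow_event by (intro sets.finite_UN) auto
    moreover have "Q \<subseteq> S"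
    proof
      fix \<xi> assume \<xi>: "\<xi> \<in> Q"
      then have bd: "\<xi> \<in> gromov_boundary p" by (simp add: Q_iff)
      obtain z where z: "z \<in> orb" "\<bar>dist p z - n\<bar> \<le> D" "n - D - \<delta> \<le> bprd \<xi> z"
        by (rule shadow_cover[OF bd n(2)])
      then have "\<xi> \<in> shadow z r" using bd by (simp add: shadow_def r_def abs_le_iff)
      then show "\<xi> \<in> S" using z \<xi> by (auto simp: S_def V_def)
    qed
    moreover have "measure \<mu> S \<le> C * real N * (real (card (near_orbits (real m))) * exp (- omega * real m))"
    proof -
      have "measure \<mu> S \<le> (\<Sum>z\<in>V. measure \<mu> (shadow z r))"
        unfolding S_def using finV shadow_event by (intro finite_measure_subadditive_finite) auto
      also have "\<dots> \<le> real (card V) * (C0 * exp (- omega * (n - D)))"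
      proof (rule sum_bounded_above)
        fix z assume z: "z \<in> V"
        have "measure \<mu> (shadow z r) \<le> C0 * exp (- omega * dist p z)"
          unfolding C0_def using z r by (intro measure_shadow_upper) (auto simp: V_def)
        also have "\<dots> \<le> C0 * exp (- omega * (n - D))"
          using z omega_positive by (intro mult_left_mono) (auto simp: V_def C0_def abs_le_iff)
        finally show "measure \<mu> (shadow z r) \<le> C0 * exp (- omega * (n - D))" .
      qed
      also have "\<dots> \<le> (real (card (near_orbits (real m))) * (real N * (real stab + 1))) * (C0 * exp (- omega * (n - D)))"
      proof (rule mult_right_mono)
        have "real (card (near_orbits (real m))) * (real N * real stab) \<le> real (card (near_orbits (real m))) * (real N * (real stab + 1))"
          by (intro mult_left_mono) auto
        then show "real (card V) \<le> real (card (near_orbits (real m))) * (real N * (real stab + 1))" using cardV by linarith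
      qed (simp add: C0_def)
      also have "exp (- omega * (n - D)) = exp (omega * (real k + D)) * exp (- omega * real m)"
        by (simp add: n(1) exp_add[symmetric] algebra_simps)
      finally show ?thesis by (simp add: C_def mult_ac)
    qed
    ultimately show ?thesis unfolding Q_def by blast
  qed
  show ?thesis by (rule that[OF C main])
qed

text \<open>If every \<open>c\<close> fails, there are radii at which
  \<open>card (near_orbits n) * exp (- omega * n)\<close> is arbitrarily small. Then each
  \<open>few_recurrences N\<close> is contained in a null set, and together they contain the
  complement of the big set.\<close>

lemma big_not_full_growth:
  assumes big: "\<not> full_in_boundary p \<mu> (big_horospheric_limit_set G \<phi> H p)"
  obtains c where "0 < c" "\<And>n. c * exp (omega * real n) \<le> real (card (near_orbits (real n)))"
proof (rule ccontr)
  assume no: "\<not> thesis"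
  note witness = that
  have small: "\<exists>n. real (card (near_orbits (real n))) < c * exp (omega * real n)" if "0 < c" for c
    using witness[OF that] no by (meson not_le)
  obtain C k where C: "0 < C" and cov: "\<And>N m. k \<le> m \<Longrightarrow> \<exists>S\<in>events. few_recurrences N \<subseteq> S \<and>
      measure \<mu> S \<le> C * real N * (real (card (near_orbits (real m))) * exp (- omega * real m))"
    by (rule few_recurrences_cover) blast
  have nullQ: "\<exists>S\<in>null_sets \<mu>. few_recurrences N \<subseteq> S" for N
  proof -
    have "\<exists>S\<in>events. few_recurrences N \<subseteq> S \<and> measure \<mu> S \<le> C * real N * (1 / real (Suc i))" for i
    proof -
      \<comment> \<open>The first entry forces \<open>n \<ge> k\<close>, where the covering is
        available, because there is always at least one orbit to count.\<close>
      define c where "c = min (exp (- omega * real k)) (1 / real (Suc i))"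
      have "0 < c" by (simp add: c_def)
      then obtain n where n: "real (card (near_orbits (real n))) < c * exp (omega * real n)" using small by blast
      have "k \<le> n"
      proof (rule ccontr)
        assume "\<not> k \<le> n"
        then have "omega * real n \<le> omega * real k" using omega_positive by (intro mult_left_mono) auto
        then have "c * exp (omega * real n) \<le> exp (- omega * real k) * exp (omega * real k)"
          by (intro mult_mono) (auto simp: c_def)
        then show False using n card_near_orbits_ge_1[of "real n"] by (simp add: exp_minus)
      qed
      then obtain S where S: "S \<in> events" "few_recurrences N \<subseteq> S"
        "measure \<mu> S \<le> C * real N * (real (card (near_orbits (real n))) * exp (- omega * real n))" using cov by blast
      have "real (card (near_orbits (real n))) * exp (- omega * real n) \<le> c * exp (omega * real n) * exp (- omega * real n)"
        using n by (intro mult_right_mono) auto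
      also have "\<dots> = c" by (simp add: exp_minus)
      also have "\<dots> \<le> 1 / real (Suc i)" by (simp add: c_def)
      finally have "C * real N * (real (card (near_orbits (real n))) * exp (- omega * real n)) \<le> C * real N * (1 / real (Suc i))"
        using C by (intro mult_left_mono) auto
      then show ?thesis using S by (meson order_trans)
    qed
    then obtain S where S: "\<And>i. S i \<in> events" "\<And>i. few_recurrences N \<subseteq> S i" "\<And>i. measure \<mu> (S i) \<le> C * real N * (1 / real (Suc i))"
      by metis
    have ev: "(\<Inter>i. S i) \<in> events" using S(1) by auto
    have "measure \<mu> (\<Inter>i. S i) \<le> C * real N * (1 / real (Suc i))" for i
      using finite_measure_mono[OF _ S(1)[of i], of "\<Inter>i. S i"] S(3)[of i] by (meson INT_lower UNIV_I order_trans)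
    moreover have "(\<lambda>i. C * real N * (1 / real (Suc i))) \<longlonglongrightarrow> C * real N * 0"
      using LIMSEQ_inverse_real_of_nat by (intro tendsto_mult tendsto_const) (simp add: inverse_eq_divide)
    ultimately have "measure \<mu> (\<Inter>i. S i) \<le> C * real N * 0" by (intro LIMSEQ_le_const) auto
    then have "measure \<mu> (\<Inter>i. S i) = 0" using measure_nonneg[of \<mu> "\<Inter>i. S i"] by linarith
    then have "(\<Inter>i. S i) \<in> null_sets \<mu>" using ev by (simp add: null_sets_def emeasure_eq_measure)
    then show ?thesis using S(2) by blast
  qed
  obtain S where S: "\<And>N. S N \<in> null_sets \<mu>" "\<And>N. few_recurrences N \<subseteq> S N" using nullQ by metis
  have "gromov_boundary p - big_horospheric_limit_set G \<phi> H p \<subseteq> (\<Union>N. S N)"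
  proof
    fix \<xi> assume \<xi>: "\<xi> \<in> gromov_boundary p - big_horospheric_limit_set G \<phi> H p"
    then have "\<xi> \<notin> recur (6 * D + 6 * \<delta>)" by (simp add: horospheric_limit_sets)
    then have "\<xi> \<in> few_recurrences (card {y\<in>Hp. bus \<xi> y \<le> 6 * D + 6 * \<delta>})"
      using \<xi> by (simp add: recur_def few_recurrences_def)
    then show "\<xi> \<in> (\<Union>N. S N)" using S(2) by blast
  qed
  moreover have "(\<Union>N. S N) \<in> null_sets \<mu>" using S(1) by (intro null_sets_UN) auto
  moreover have "gromov_boundary p - big_horospheric_limit_set G \<phi> H p \<in> events"
    using boundary_event big_event by auto
  ultimately show False using big null_sets_subset unfolding full_in_boundary_def by blast
qed

text \<open>Enough fat representatives of the orbits lie in an annulus, since a smaller ball has too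
  few orbit points. Their shadows overlap boundedly, so \<open>cover 1 r m\<close> has measure at
  least \<open>c'\<close> for every \<open>m\<close>; so has the intersection, which lies in
  \<open>lower (1 + 4 * \<delta>)\<close>.\<close>

lemma growth_small_not_full:
  assumes c: "0 < c" and inf: "\<And>m. \<exists>n\<ge>m. c * exp (omega * real n) \<le> real (card (near_orbits (real n)))"
  shows "\<not> full_in_boundary p \<mu> (small_horospheric_limit_set G \<phi> H p)"
proof -
  obtain r where r: "0 \<le> r" "\<And>z. z \<in> orb \<Longrightarrow> exp (- omega * dist p z) / 2 \<le> measure \<mu> (shadow z r)"
    by (rule measure_shadow_lower) blast
  obtain C where C: "0 < C" "\<And>t. 0 \<le> t \<Longrightarrow> real (cnt t) \<le> C * exp (omega * t)" using cnt_upper[OF omega_positive] by blast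
  \<comment> \<open>Wide enough for the ball of radius \<open>n + 1 - K\<close> to hold at most
    \<open>c / 2 * exp (omega * n)\<close> orbit points.\<close>
  define K where "K = max 1 (1 + ln (2 * C / c) / omega)"
  have K1: "1 \<le> K" by (simp add: K_def)
  have CK: "C * exp (omega * (1 - K)) \<le> c / 2"
  proof -
    have "ln (2 * C / c) / omega \<le> K - 1" by (simp add: K_def)
    then have "ln (2 * C / c) \<le> omega * (K - 1)" using omega_positive by (simp add: field_simps)
    then have "exp (ln (2 * C / c)) \<le> exp (omega * (K - 1))" by simp
    then have "2 * C / c \<le> exp (omega * (K - 1))" using C c by simp
    moreover have "exp (omega * (1 - K)) = 1 / exp (omega * (K - 1))"
      by (simp add: exp_minus[symmetric] inverse_eq_divide[symmetric] algebra_simps)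
    ultimately show ?thesis using c by (simp add: divide_le_eq mult.commute)
  qed
  define Nm where "Nm = cnt (K + 2 * r + 4 * \<delta>)"
  have Nm: "0 < real Nm" using cnt_ge_1[of "K + 2 * r + 4 * \<delta>"] K1 r(1) delta_nonneg by (simp add: Nm_def)
  define c' where "c' = c / 4 * exp (- omega) / real Nm"
  have c': "0 < c'" using c Nm by (simp add: c'_def)
  have cov: "c' \<le> measure \<mu> (cover 1 r (real m))" for m
  proof -
    obtain k where k: "K \<le> real k" using real_arch_simple by blast
    obtain n where n: "m + k \<le> n" "c * exp (omega * real n) \<le> real (card (near_orbits (real n)))" using inf by blast
    define A where "A = {z\<in>fat 1. real n + 1 - K \<le> dist p z \<and> dist p z \<le> real n + 1}"
    have finA: "finite A" by (rule finite_subset[OF _ finite_fat_ball[of 1 "real n + 1"]]) (auto simp: A_def)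
    have nK: "0 \<le> real n + 1 - K" "real m \<le> real n + 1 - K" using n(1) k by linarith+
    have "card (fat 1 \<inter> cball p (real n + 1)) \<le> card (A \<union> (orb \<inter> cball p (real n + 1 - K)))"
      using finA finite_orb_ball by (intro card_mono) (auto simp: A_def fat_def)
    also have "\<dots> \<le> card A + cnt (real n + 1 - K)" unfolding cnt_def by (rule card_Un_le)
    finally have "real (card (near_orbits (real n))) \<le> real (card A) + real (cnt (real n + 1 - K))"
      using card_near_orbits_le_fat[of "real n"] by linarith
    moreover have "real (cnt (real n + 1 - K)) \<le> c / 2 * exp (omega * real n)"
    proof -
      have "real (cnt (real n + 1 - K)) \<le> C * exp (omega * (real n + 1 - K))" using C nK by blast
      also have "\<dots> = (C * exp (omega * (1 - K))) * exp (omega * real n)" by (simp add: exp_add[symmetric] algebra_simps)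
      also have "\<dots> \<le> c / 2 * exp (omega * real n)" using CK by (intro mult_right_mono) auto
      finally show ?thesis .
    qed
    ultimately have cardA: "c / 2 * exp (omega * real n) \<le> real (card A)" using n(2) by simp
    have "c / 4 * exp (- omega) = (c / 2 * exp (omega * real n)) * (exp (- omega * (real n + 1)) / 2)"
      by (simp add: exp_add[symmetric] algebra_simps)
    also have "\<dots> \<le> real (card A) * (exp (- omega * (real n + 1)) / 2)" using cardA by (intro mult_right_mono) auto
    also have "\<dots> \<le> (\<Sum>z\<in>A. measure \<mu> (shadow z r))"
    proof (rule sum_bounded_below)
      fix z assume z: "z \<in> A"
      then have "exp (- omega * (real n + 1)) / 2 \<le> exp (- omega * dist p z) / 2" using omega_positive by (auto simp: A_def)
      also have "\<dots> \<le> measure \<mu> (shadow z r)" using z by (intro r(2)) (auto simp: A_def fat_def)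
      finally show "exp (- omega * (real n + 1)) / 2 \<le> measure \<mu> (shadow z r)" .
    qed
    also have "\<dots> \<le> real Nm * measure \<mu> (\<Union>z\<in>A. shadow z r)"
    proof (rule sum_measure_le_multiplicity[OF finA shadow_event])
      fix x
      show "card {z\<in>A. x \<in> shadow z r} \<le> Nm"
      proof (cases "x \<in> gromov_boundary p")
        case True
        let ?B = "{z\<in>orb. real n + 1 - K \<le> dist p z \<and> dist p z \<le> real n + 1 \<and> x \<in> shadow z r}"
        have "finite ?B" by (rule finite_subset[OF _ finite_orb_ball[of p "real n + 1"]]) auto
        then have "card {z\<in>A. x \<in> shadow z r} \<le> card ?B" by (intro card_mono) (auto simp: A_def fat_def)
        also have "\<dots> \<le> cnt (real n + 1 - (real n + 1 - K) + 2 * r + 4 * \<delta>)" by (rule boundary_shadow_multiplicity[OF True])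
        finally show ?thesis by (simp add: Nm_def)
      next
        case False
        then have "{z\<in>A. x \<in> shadow z r} = {}" by (auto simp: shadow_def)
        then show ?thesis by (simp only: card.empty)
      qed
    qed
    also have "\<dots> \<le> real Nm * measure \<mu> (cover 1 r (real m))"
      using nK by (intro mult_left_mono finite_measure_mono cover_event) (auto simp: cover_def A_def)
    finally show ?thesis using Nm by (simp add: c'_def field_simps)
  qed
  have "(\<lambda>n. measure \<mu> (cover 1 r (real n) - {})) \<longlonglongrightarrow> measure \<mu> ((\<Inter>n. cover 1 r (real n)) - {})"
    by (rule measure_cover_limit) simp
  then have "c' \<le> measure \<mu> (\<Inter>n. cover 1 r (real n))" using cov by (intro LIMSEQ_le_const) auto
  also have "\<dots> \<le> measure \<mu> (lower (1 + 4 * \<delta>))" by (intro finite_measure_mono cover_Inter lower_event)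
  also have "\<dots> \<le> measure \<mu> (gromov_boundary p - small_horospheric_limit_set G \<phi> H p)"
  proof (rule finite_measure_mono)
    show "gromov_boundary p - small_horospheric_limit_set G \<phi> H p \<in> events" using boundary_event small_event by auto
    show "lower (1 + 4 * \<delta>) \<subseteq> gromov_boundary p - small_horospheric_limit_set G \<phi> H p"
    proof
      fix \<xi> assume \<xi>: "\<xi> \<in> lower (1 + 4 * \<delta>)"
      then have "{y\<in>Hp. bus \<xi> y \<le> - 2 - 4 * \<delta>} = {}" by (force simp: lower_def)
      then have "\<xi> \<notin> recur (- 2 - 4 * \<delta>)" by (simp only: recur_def mem_Collect_eq finite.emptyI simp_thms)
      then show "\<xi> \<in> gromov_boundary p - small_horospheric_limit_set G \<phi> H p"
        using \<xi> by (auto simp: lower_def horospheric_limit_sets)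
    qed
  qed
  finally have "0 < measure \<mu> (gromov_boundary p - small_horospheric_limit_set G \<phi> H p)" using c' by linarith
  then show ?thesis by (auto simp: full_in_boundary_def null_sets_def emeasure_eq_measure)
qed

section \<open>Nets\<close>

text \<open>Translation reduces to one ball around \<open>p\<close>; in a finite cover of it by
  balls of radius \<open>R / 2\<close>, separated points get distinct centres. So \<open>N\<close>
  does not depend on \<open>z\<close>.\<close>

lemma packing:
  assumes R: "0 < R"
  obtains N where "0 < N"
    "\<And>z S. z \<in> orb \<Longrightarrow> S \<subseteq> cball z \<rho> \<Longrightarrow> separated dist R S \<Longrightarrow> finite S \<and> card S \<le> N"
proof -
  have "compact (cball p \<rho>)" using proper_space by (simp add: proper_metric_def)
  moreover have "cball p \<rho> \<subseteq> (\<Union>x\<in>cball p \<rho>. ball x (R / 2))"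
  proof
    show "x \<in> (\<Union>x\<in>cball p \<rho>. ball x (R / 2))" if "x \<in> cball p \<rho>" for x
      using that R by (intro UN_I[of x]) auto
  qed
  ultimately obtain k where k: "k \<subseteq> cball p \<rho>" "finite k" "cball p \<rho> \<subseteq> (\<Union>x\<in>k. ball x (R / 2))"
    by (metis compactE_image open_ball)
  have "finite S \<and> card S \<le> card k + 1"
    if z: "z \<in> orb" and S: "S \<subseteq> cball z \<rho>" and sep: "separated dist R S" for z S
  proof -
    obtain g where g: "g \<in> carrier G" "z = \<phi> g p" using z by (auto simp: orb_def)
    have "\<forall>x\<in>S. \<exists>c\<in>k. dist c (\<phi> (inv g) x) < R / 2"
    proof
      fix x assume "x \<in> S"
      then have "dist z x \<le> \<rho>" using S by auto
      then have "\<phi> (inv g) x \<in> cball p \<rho>" using act_dist[of g p "\<phi> (inv g) x"] g by (simp add: act_inv')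
      then show "\<exists>c\<in>k. dist c (\<phi> (inv g) x) < R / 2" using k(3) by (auto simp: subset_iff)
    qed
    then obtain f where f: "\<And>x. x \<in> S \<Longrightarrow> f x \<in> k \<and> dist (f x) (\<phi> (inv g) x) < R / 2" by metis
    have "inj_on f S"
    proof (rule inj_onI, rule ccontr)
      fix x y assume xy: "x \<in> S" "y \<in> S" "f x = f y" "x \<noteq> y"
      have "dist (\<phi> (inv g) x) (\<phi> (inv g) y) < R"
        using f[OF xy(1)] f[OF xy(2)] xy(3) dist_triangle2[of "\<phi> (inv g) x" "\<phi> (inv g) y" "f x"]
        by (simp add: dist_commute)
      then show False using sep xy(1,2,4) g by (fastforce simp: act_dist separated_def)
    qed
    moreover have "f ` S \<subseteq> k" using f by auto
    ultimately show ?thesis using k(2) by (meson card_inj_on_le inj_on_finite le_SucI Suc_eq_plus1_left trans_le_add1)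
  qed
  then show ?thesis using that[of "card k + 1"] by simp
qed

lemma card_le_fibers:
  assumes "finite B" "A \<subseteq> (\<Union>b\<in>B. F b)" "\<And>b. b \<in> B \<Longrightarrow> finite (F b) \<and> card (F b) \<le> N"
  shows "finite A" "card A \<le> card B * N"
proof -
  have fin: "finite (\<Union>b\<in>B. F b)" using assms by blast
  then show "finite A" using assms(2) finite_subset by blast
  have "card A \<le> card (\<Union>b\<in>B. F b)" using fin assms(2) by (rule card_mono)
  also have "\<dots> \<le> (\<Sum>b\<in>B. card (F b))" using assms(1) by (rule card_UN_le)
  also have "\<dots> \<le> of_nat (card B) * N" using assms(3) by (intro sum_bounded_above) auto
  finally show "card A \<le> card B * N" by simp
qed

lemma card_orb_ball_le: "card (orb \<inter> cball x r) \<le> cnt (r + D)"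
proof -
  obtain z where z: "z \<in> orb" "dist x z \<le> D" using orb_dense by blast
  have "orb \<inter> cball x r \<subseteq> orb \<inter> cball z (r + D)"
  proof
    fix y assume "y \<in> orb \<inter> cball x r"
    then show "y \<in> orb \<inter> cball z (r + D)" using z dist_triangle[of z y x] by (simp add: dist_commute)
  qed
  then show ?thesis using card_mono[OF finite_orb_ball] card_orb_ball[OF z(1)] by metis
qed

lemma maximal_separated_near:
  assumes "maximal_separated M d R S" "x \<in> M" "0 < R" and d: "\<And>x y. d x y = d y x" "\<And>x. d x x = 0"
  shows "\<exists>s\<in>S. d x s < R"
proof (cases "x \<in> S")
  case True
  then show ?thesis using d assms(3) by (intro bexI[of _ x]) auto
next
  case False
  show ?thesis
  proof (rule ccontr)
    assume "\<not> ?thesis"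
    then have "separated d R (insert x S)"
      using assms(1) d by (auto simp: maximal_separated_def separated_def not_less)
    then have "insert x S = S" using assms(1,2) unfolding maximal_separated_def by blast
    then show False using False by blast
  qed
qed

lemma net_growth:
  assumes R: "0 < R" and Z: "maximal_separated UNIV dist R Z"
  obtains c C k where "0 < c" "0 < C" "\<And>n. k \<le> n \<Longrightarrow> c * exp (omega * real n) \<le> real (card (Z \<inter> cball p (real n)))"
    "\<And>n. real (card (Z \<inter> cball p (real n))) \<le> C * exp (omega * real n)"
proof -
  obtain N where N: "0 < N"
    "\<And>z S. z \<in> orb \<Longrightarrow> S \<subseteq> cball z D \<Longrightarrow> separated dist R S \<Longrightarrow> finite S \<and> card S \<le> N"
    by (rule packing[OF R, of D]) blast
  have sep: "separated dist R (Z \<inter> A)" for A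
    using Z by (auto simp: maximal_separated_def separated_def)
  have upper: "finite (Z \<inter> cball p t)" "card (Z \<inter> cball p t) \<le> cnt (t + D) * N" for t
  proof -
    have cov: "Z \<inter> cball p t \<subseteq> (\<Union>w\<in>orb \<inter> cball p (t + D). Z \<inter> cball w D)"
    proof
      fix x assume x: "x \<in> Z \<inter> cball p t"
      obtain w where w: "w \<in> orb" "dist x w \<le> D" using orb_dense by blast
      then have "dist p w \<le> t + D" using x dist_triangle[of p w x] by simp
      then show "x \<in> (\<Union>w\<in>orb \<inter> cball p (t + D). Z \<inter> cball w D)"
        using x w by (intro UN_I[of w]) (auto simp: dist_commute)
    qed
    have fib: "finite (Z \<inter> cball w D) \<and> card (Z \<inter> cball w D) \<le> N" if "w \<in> orb \<inter> cball p (t + D)" for w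
      using that sep by (intro N(2)[of w]) auto
    show "finite (Z \<inter> cball p t)" by (rule card_le_fibers(1)[OF finite_orb_ball cov fib])
    show "card (Z \<inter> cball p t) \<le> cnt (t + D) * N"
      unfolding cnt_def by (rule card_le_fibers(2)[OF finite_orb_ball cov fib])
  qed
  have lower: "cnt t \<le> card (Z \<inter> cball p (t + R)) * cnt (R + D)" for t
    unfolding cnt_def[of t]
  proof (rule card_le_fibers(2)[where F = "\<lambda>x. orb \<inter> cball x R"])
    show "orb \<inter> cball p t \<subseteq> (\<Union>x\<in>Z \<inter> cball p (t + R). orb \<inter> cball x R)"
    proof
      fix z assume z: "z \<in> orb \<inter> cball p t"
      obtain x where x: "x \<in> Z" "dist z x < R"
        using maximal_separated_near[OF Z _ R, of z] by (auto simp: dist_commute)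
      then have "dist p x \<le> t + R" using z dist_triangle[of p x z] by simp
      then show "z \<in> (\<Union>x\<in>Z \<inter> cball p (t + R). orb \<inter> cball x R)"
        using z x by (intro UN_I[of x]) (auto simp: dist_commute)
    qed
  qed (use upper(1) finite_orb_ball card_orb_ball_le in auto)
  obtain C where C: "0 < C" "\<And>t. 0 \<le> t \<Longrightarrow> real (cnt t) \<le> C * exp (omega * t)" using cnt_upper[OF omega_positive] by blast
  define C1 where "C1 = C * exp (omega * D) * real N"
  have "real (card (Z \<inter> cball p (real n))) \<le> C1 * exp (omega * real n)" for n
  proof -
    have "real (card (Z \<inter> cball p (real n))) \<le> real (cnt (real n + D)) * real N"
      using upper(2)[of "real n"] by (metis of_nat_le_iff of_nat_mult)
    also have "\<dots> \<le> C * exp (omega * (real n + D)) * real N"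
      using C(2)[of "real n + D"] D_nonneg by (intro mult_right_mono) auto
    also have "\<dots> = C1 * exp (omega * real n)" by (simp add: C1_def exp_add algebra_simps)
    finally show ?thesis .
  qed
  moreover have "0 < C1" using C N by (simp add: C1_def)
  moreover define N' where "N' = real (cnt (R + D))"
  have N': "0 < N'" using cnt_ge_1[of "R + D"] R D_nonneg by (simp add: N'_def)
  define c where "c = exp (- omega * (R + 1 + real offset)) / N'"
  have "c * exp (omega * real n) \<le> real (card (Z \<inter> cball p (real n)))" if n: "nat \<lceil>R\<rceil> \<le> n" for n
  proof -
    have nR: "0 \<le> real n - R" using n by linarith
    have "c * exp (omega * real n) = exp (omega * (real n - R - 1 - real offset)) / N'"
      by (simp add: c_def exp_add[symmetric] algebra_simps)
    also have "\<dots> \<le> real (cnt (real n - R)) / N'"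
      using cnt_lower[OF nR] N' by (intro divide_right_mono) auto
    also have "\<dots> \<le> real (card (Z \<inter> cball p (real n)))"
    proof -
      have "real (cnt (real n - R)) \<le> real (card (Z \<inter> cball p (real n))) * N'"
        using lower[of "real n - R"] unfolding N'_def by (simp flip: of_nat_mult)
      then show ?thesis using N' by (simp add: field_simps)
    qed
    finally show ?thesis .
  qed
  moreover have "0 < c" using N' by (simp add: c_def)
  ultimately show ?thesis using that[of c C1 "nat \<lceil>R\<rceil>"] by blast
qed

text \<open>Net points and orbits of \<open>orb\<close> are matched by proximity; the fibres are
  bounded by \<open>packing\<close> in one direction and by orbit points in a ball of radius
  \<open>R\<close> in the other. The shift \<open>k\<close> pays for the displacement and for almost
  attaining the infimum in \<open>setdist\<close>.\<close>

lemma quotient_net_growth: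
  assumes R: "0 < R" and W: "maximal_separated (quotient_space G \<phi> H) setdist R W"
  defines "wc \<equiv> \<lambda>t. card {w\<in>W. setdist (cls p) w \<le> t}"
  obtains N k where "0 < N" "\<And>n. wc (real n) \<le> N * card (near_orbits (real (n + k)))"
    "\<And>n. card (near_orbits (real n)) \<le> N * wc (real (n + k))"
proof -
  obtain N where N: "0 < N"
    "\<And>z S. z \<in> orb \<Longrightarrow> S \<subseteq> cball z D \<Longrightarrow> separated dist R S \<Longrightarrow> finite S \<and> card S \<le> N"
    by (rule packing[OF R, of D]) blast
  have qs: "quotient_space G \<phi> H = range cls"
    by (auto simp: quotient_space_def orbits_def sub_orbit_def)
  have WX: "\<exists>x. w = cls x" if "w \<in> W" for w using W that by (auto simp: maximal_separated_def qs)
  have sep: "R \<le> setdist w w'" if "w \<in> W" "w' \<in> W" "w \<noteq> w'" for w w'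
    using W that by (auto simp: maximal_separated_def separated_def)
  define F where "F b = {w\<in>W. \<exists>x. w = cls x \<and> (\<exists>z\<in>orb. b = cls z \<and> dist z x \<le> D)}" for b
  have cov: "{w\<in>W. setdist (cls p) w \<le> t} \<subseteq> (\<Union>b\<in>near_orbits (t + 1 + D). F b)" for t
  proof
    fix w assume w: "w \<in> {w\<in>W. setdist (cls p) w \<le> t}"
    then obtain x0 where x0: "w = cls x0" using WX by blast
    obtain h where h: "h \<in> H" "dist p (\<phi> h x0) < setdist (cls p) (cls x0) + 1" by (rule cls_near[of 1 p x0]) auto
    define x where "x = \<phi> h x0"
    have x: "w = cls x" "dist p x \<le> t + 1" using x0 w h cls_act[OF h(1), of x0] by (auto simp: x_def)
    obtain z where z: "z \<in> orb" "dist x z \<le> D" using orb_dense by blast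
    have "setdist (cls p) (cls z) \<le> t + 1 + D"
      using setdist_cls_le[of p z] dist_triangle[of p z x] x z by linarith
    then have "cls z \<in> near_orbits (t + 1 + D)" using z by (auto simp: near_orbits_def)
    moreover have "w \<in> F (cls z)" using w x z by (auto simp: F_def dist_commute)
    ultimately show "w \<in> (\<Union>b\<in>near_orbits (t + 1 + D). F b)" by blast
  qed
  have fib: "finite (F b) \<and> card (F b) \<le> N" if "b \<in> near_orbits t" for b t
  proof -
    obtain z where z: "z \<in> orb" "b = cls z" using \<open>b \<in> near_orbits t\<close> by (auto simp: near_orbits_def)
    \<comment> \<open>Representatives of all \<open>w\<close> are moved by \<open>H\<close> next to
      the same \<open>z\<close>. They stay separated, as \<open>setdist\<close> is at most the
      distance, so \<open>packing\<close> applies.\<close>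
    have "\<exists>x. w = cls x \<and> dist z x \<le> D" if w: "w \<in> F b" for w
    proof -
      obtain x z' where x: "w = cls x" "z' \<in> orb" "b = cls z'" "dist z' x \<le> D" using w by (auto simp: F_def)
      then have "z \<in> cls z'" using cls_self[of z] z by simp
      then obtain h where h: "h \<in> H" "z = \<phi> h z'" by (auto simp: sub_orbit_eq)
      then show ?thesis using x cls_act[OF h(1), of x] act_dist[OF H_carrier[OF h(1)], of z' x] by auto
    qed
    then obtain f where f: "\<And>w. w \<in> F b \<Longrightarrow> w = cls (f w) \<and> dist z (f w) \<le> D" by metis
    have inj: "inj_on f (F b)" by (rule inj_onI) (metis f)
    have "separated dist R (f ` F b)"
      unfolding separated_def
    proof (intro ballI impI)
      fix x y assume "x \<in> f ` F b" "y \<in> f ` F b" "x \<noteq> y"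
      then obtain w w' where ww: "w \<in> F b" "w' \<in> F b" "x = f w" "y = f w'" "w \<noteq> w'" by blast
      then have "R \<le> setdist w w'" by (intro sep) (auto simp: F_def)
      also have "\<dots> = setdist (cls x) (cls y)" using f ww by auto
      also have "\<dots> \<le> dist x y" by (rule setdist_cls_le)
      finally show "R \<le> dist x y" .
    qed
    moreover have "f ` F b \<subseteq> cball z D" using f by auto
    ultimately have "finite (f ` F b) \<and> card (f ` F b) \<le> N" by (intro N(2)[OF z(1)])
    then show ?thesis using inj by (simp add: card_image finite_image_iff)
  qed
  have upper: "finite {w\<in>W. setdist (cls p) w \<le> t}" "wc t \<le> card (near_orbits (t + 1 + D)) * N" for t
    unfolding wc_def using card_le_fibers[OF finite_near_orbits cov fib] by auto
  have lower: "card (near_orbits t) \<le> wc (t + 1 + R) * cnt (R + D)" for t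
    unfolding wc_def
  proof (rule card_le_fibers(2)[OF upper(1), where F = "\<lambda>w. {b. \<exists>z\<in>orb. b = cls z \<and> setdist w b < R}"])
    show "near_orbits t \<subseteq> (\<Union>w\<in>{w\<in>W. setdist (cls p) w \<le> t + 1 + R}. {b. \<exists>z\<in>orb. b = cls z \<and> setdist w b < R})"
    proof
      fix b assume b: "b \<in> near_orbits t"
      then obtain z where z: "z \<in> fat 1" "dist p z \<le> t + 1" "b = cls z" using near_orbits_subset by fastforce
      have zorb: "z \<in> orb" using z by (simp add: fat_def)
      have "b \<in> quotient_space G \<phi> H" using z by (simp add: qs)
      moreover have "setdist x x = 0" for x :: "'a set" by (rule setdist_refl)
      ultimately obtain w where w: "w \<in> W" "setdist b w < R"
        using maximal_separated_near[OF W _ R setdist_sym] by blast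
      obtain x where x: "w = cls x" using WX w by blast
      obtain h where h: "h \<in> H" "dist z (\<phi> h x) < setdist (cls z) (cls x) + (R - setdist b w)"
        by (rule cls_near[of "R - setdist b w" z x]) (use w in auto)
      then have "dist z (\<phi> h x) < R" using z x by simp
      then have "dist p (\<phi> h x) \<le> t + 1 + R" using z dist_triangle[of p "\<phi> h x" z] by simp
      then have "setdist (cls p) w \<le> t + 1 + R"
        using setdist_cls_le[of p "\<phi> h x"] cls_act[OF h(1), of x] x by simp
      then show "b \<in> (\<Union>w\<in>{w\<in>W. setdist (cls p) w \<le> t + 1 + R}. {b. \<exists>z\<in>orb. b = cls z \<and> setdist w b < R})"
        using w z zorb setdist_sym[of b w] by auto
    qed
    fix w assume "w \<in> {w\<in>W. setdist (cls p) w \<le> t + 1 + R}"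
    then obtain x where x: "w = cls x" using WX by blast
    have "{b. \<exists>z\<in>orb. b = cls z \<and> setdist w b < R} \<subseteq> cls ` (orb \<inter> cball x R)"
    proof
      fix b assume "b \<in> {b. \<exists>z\<in>orb. b = cls z \<and> setdist w b < R}"
      then obtain z where z: "z \<in> orb" "b = cls z" "setdist (cls x) (cls z) < R" using x by auto
      obtain h where h: "h \<in> H" "dist x (\<phi> h z) < setdist (cls x) (cls z) + (R - setdist (cls x) (cls z))"
        by (rule cls_near[of "R - setdist (cls x) (cls z)" x z]) (use z in auto)
      then show "b \<in> cls ` (orb \<inter> cball x R)"
        using z cls_act[OF h(1), of z] orb_act_H[OF h(1) z(1)] by (intro image_eqI[of _ _ "\<phi> h z"]) auto
    qed
    moreover have "card (cls ` (orb \<inter> cball x R)) \<le> cnt (R + D)"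
      using card_image_le[OF finite_orb_ball] card_orb_ball_le by (meson order_trans)
    moreover have fin: "finite (cls ` (orb \<inter> cball x R))" using finite_orb_ball by simp
    ultimately show "finite {b. \<exists>z\<in>orb. b = cls z \<and> setdist w b < R} \<and>
        card {b. \<exists>z\<in>orb. b = cls z \<and> setdist w b < R} \<le> cnt (R + D)"
      using card_mono[OF fin] finite_subset by (meson order_trans)
  qed
  define k where "k = nat \<lceil>1 + D + R\<rceil>"
  have k: "1 + D + R \<le> real k" unfolding k_def by linarith
  show ?thesis
  proof (rule that[of "N + cnt (R + D)" k])
    show "0 < N + cnt (R + D)" using N by simp
    show "wc (real n) \<le> (N + cnt (R + D)) * card (near_orbits (real (n + k)))" for n
    proof -
      have "wc (real n) \<le> card (near_orbits (real n + 1 + D)) * N" by (rule upper)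
      also have "\<dots> \<le> card (near_orbits (real (n + k))) * (N + cnt (R + D))"
        using k R by (intro mult_mono near_orbits_mono) auto
      finally show ?thesis by (simp add: mult.commute)
    qed
    show "card (near_orbits (real n)) \<le> (N + cnt (R + D)) * wc (real (n + k))" for n
    proof -
      have "card (near_orbits (real n)) \<le> wc (real n + 1 + R) * cnt (R + D)" by (rule lower)
      also have "\<dots> \<le> wc (real (n + k)) * (N + cnt (R + D))"
      proof (rule mult_mono)
        show "wc (real n + 1 + R) \<le> wc (real (n + k))"
          unfolding wc_def using k D_nonneg by (intro card_mono upper) auto
      qed auto
      finally show ?thesis by (simp add: mult.commute)
    qed
  qed
qed

text \<open>Shifting the radius by \<open>k\<close> changes \<open>exp (omega * n)\<close> only by a
  constant factor, so both quotients bound each other. The bounds start at \<open>k0\<close>,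
  because a small ball may contain no point of \<open>Z\<close>.\<close>

lemma grows_slower_iff:
  assumes R: "0 < R" and Z: "maximal_separated UNIV dist R Z"
    and W: "maximal_separated (quotient_space G \<phi> H) setdist R W"
  shows "quotient_grows_slower G \<phi> H p Z W \<longleftrightarrow>
    (\<lambda>n. real (card (near_orbits (real n))) / exp (omega * real n)) \<longlonglongrightarrow> 0"
proof -
  obtain c C k0 where Zb: "0 < c" "0 < C" "\<And>n. k0 \<le> n \<Longrightarrow> c * exp (omega * real n) \<le> real (card (Z \<inter> cball p (real n)))"
    "\<And>n. real (card (Z \<inter> cball p (real n))) \<le> C * exp (omega * real n)"
    using net_growth[OF R Z] by metis
  define wc where "wc t = card {w\<in>W. setdist (cls p) w \<le> t}" for t
  obtain N k where Wb: "0 < N" "\<And>n. wc (real n) \<le> N * card (near_orbits (real (n + k)))"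
    "\<And>n. card (near_orbits (real n)) \<le> N * wc (real (n + k))"
    by (rule quotient_net_growth[OF R W, folded wc_def]) blast
  define f where "f n = real (wc (real n)) / real (card (Z \<inter> cball p (real n)))" for n :: nat
  define a where "a n = real (card (near_orbits (real n))) / exp (omega * real n)" for n :: nat
  have f_nn: "0 \<le> f n" and a_nn: "0 \<le> a n" for n by (simp_all add: f_def a_def)
  have fa: "f n \<le> real N * exp (omega * real k) / c * a (n + k)" if "k0 \<le> n" for n
  proof -
    have "f n \<le> real (N * card (near_orbits (real (n + k)))) / (c * exp (omega * real n))"
      unfolding f_def
    proof (rule frac_le)
      show "real (wc (real n)) \<le> real (N * card (near_orbits (real (n + k))))" using Wb(2)[of n] of_nat_le_iff by blast
    qed (use Zb that in auto)
    also have "\<dots> = real N * exp (omega * real k) / c * a (n + k)"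
      using Zb by (simp add: a_def distrib_left exp_add field_simps)
    finally show ?thesis .
  qed
  have af: "a n \<le> real N * C * exp (omega * real k) * f (n + k)" if n: "k0 \<le> n" for n
  proof -
    have "0 < c * exp (omega * real (n + k))" using Zb by simp
    then have Zpos: "0 < real (card (Z \<inter> cball p (real (n + k))))" using Zb(3)[of "n + k"] n by linarith
    have "a n \<le> real (N * wc (real (n + k))) / exp (omega * real n)"
      unfolding a_def by (intro divide_right_mono) (use Wb(3)[of n] of_nat_le_iff in blast, simp)
    also have "\<dots> = real N * real (wc (real (n + k))) * exp (omega * real k) / exp (omega * real (n + k))"
      by (simp add: distrib_left exp_add)
    also have "\<dots> \<le> real N * real (wc (real (n + k))) * exp (omega * real k) / (real (card (Z \<inter> cball p (real (n + k)))) / C)"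
    proof (rule divide_left_mono)
      show "real (card (Z \<inter> cball p (real (n + k)))) / C \<le> exp (omega * real (n + k))"
        using Zb(2) Zb(4)[of "n + k"] by (simp add: divide_le_eq mult.commute)
    qed (use Zpos Zb in auto)
    also have "\<dots> = real N * C * exp (omega * real k) * f (n + k)" by (simp add: f_def)
    finally show ?thesis .
  qed
  have "quotient_grows_slower G \<phi> H p Z W \<longleftrightarrow> f \<longlonglongrightarrow> 0"
    unfolding quotient_grows_slower_def f_def wc_def ..
  also have "\<dots> \<longleftrightarrow> a \<longlonglongrightarrow> 0"
  proof
    assume "f \<longlonglongrightarrow> 0"
    then have "(\<lambda>n. real N * C * exp (omega * real k) * f (n + k)) \<longlonglongrightarrow> real N * C * exp (omega * real k) * 0"
      by (intro tendsto_mult tendsto_const LIMSEQ_ignore_initial_segment)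
    then have "(\<lambda>n. real N * C * exp (omega * real k) * f (n + k)) \<longlonglongrightarrow> 0" by simp
    then show "a \<longlonglongrightarrow> 0"
      by (rule tendsto_sandwich[OF _ _ tendsto_const, rotated 2])
        (use a_nn af in \<open>auto simp: eventually_sequentially\<close>)
  next
    assume "a \<longlonglongrightarrow> 0"
    then have "(\<lambda>n. real N * exp (omega * real k) / c * a (n + k)) \<longlonglongrightarrow> real N * exp (omega * real k) / c * 0"
      by (intro tendsto_mult tendsto_const LIMSEQ_ignore_initial_segment)
    then have "(\<lambda>n. real N * exp (omega * real k) / c * a (n + k)) \<longlonglongrightarrow> 0" by simp
    then show "f \<longlonglongrightarrow> 0"
      by (rule tendsto_sandwich[OF _ _ tendsto_const, rotated 2])
        (use f_nn fa in \<open>auto simp: eventually_sequentially\<close>)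
  qed
  finally show ?thesis by (simp add: a_def[abs_def])
qed

section \<open>The equivalences\<close>

lemma small_full_imp_grows_slower:
  assumes small: "full_in_boundary p \<mu> (small_horospheric_limit_set G \<phi> H p)"
  shows "(\<lambda>n. real (card (near_orbits (real n))) / exp (omega * real n)) \<longlonglongrightarrow> 0"
proof (rule ccontr)
  let ?a = "\<lambda>n. real (card (near_orbits (real n))) / exp (omega * real n)"
  assume "\<not> ?a \<longlonglongrightarrow> 0"
  then obtain c where c: "0 < c" "\<And>m. \<exists>n\<ge>m. c \<le> ?a n"
    by (auto simp: LIMSEQ_iff not_less)
  then have "\<exists>n\<ge>m. c * exp (omega * real n) \<le> real (card (near_orbits (real n)))" for m
    by (simp add: le_divide_eq)
  then show False using growth_small_not_full[OF c(1)] small by blast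
qed

lemma grows_slower_imp_big_full:
  assumes slow: "(\<lambda>n. real (card (near_orbits (real n))) / exp (omega * real n)) \<longlonglongrightarrow> 0"
  shows "full_in_boundary p \<mu> (big_horospheric_limit_set G \<phi> H p)"
proof (rule ccontr)
  assume "\<not> ?thesis"
  then obtain c where c: "0 < c" "\<And>n. c * exp (omega * real n) \<le> real (card (near_orbits (real n)))"
    using big_not_full_growth by blast
  then have "c \<le> real (card (near_orbits (real n))) / exp (omega * real n)" for n by (simp add: le_divide_eq)
  then have "c \<le> 0" using slow by (intro LIMSEQ_le_const) auto
  then show False using c by simp
qed

text \<open>The upper bound is that for \<open>cnt\<close> and always holds; the content is the
  lower bound, which \<open>big_not_full_growth\<close> supplies for every \<open>n\<close>.\<close>

lemma small_not_full_iff_comparable: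
  "\<not> full_in_boundary p \<mu> (small_horospheric_limit_set G \<phi> H p) \<longleftrightarrow>
    comparable (\<lambda>n. real (quotient_orbit_count G \<phi> H p n)) (\<lambda>n. exp (growth_rate G \<phi> p * real n))"
  unfolding quotient_orbit_count_eq omega_def[symmetric]
proof
  assume "\<not> full_in_boundary p \<mu> (small_horospheric_limit_set G \<phi> H p)"
  then have "\<not> full_in_boundary p \<mu> (big_horospheric_limit_set G \<phi> H p)" using big_full_imp_small_full by blast
  then obtain c where c: "0 < c" "\<And>n. c * exp (omega * real n) \<le> real (card (near_orbits (real n)))"
    using big_not_full_growth by blast
  obtain C where C: "0 < C" "\<And>t. 0 \<le> t \<Longrightarrow> real (cnt t) \<le> C * exp (omega * t)" using cnt_upper[OF omega_positive] by blast
  define B where "B = max 1 (max (1 / c) (C * exp omega))"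
  have B: "1 \<le> B" "1 / B \<le> c" "C * exp omega \<le> B"
  proof -
    show B1: "1 \<le> B" "C * exp omega \<le> B" by (simp_all add: B_def)
    have "1 / c \<le> B" by (simp add: B_def)
    then show "1 / B \<le> c" using c(1) B1 by (simp add: field_simps)
  qed
  have "exp (omega * real n) / B \<le> real (card (near_orbits (real n)))" for n
  proof -
    have "exp (omega * real n) / B = 1 / B * exp (omega * real n)" by simp
    also have "\<dots> \<le> c * exp (omega * real n)" using B by (intro mult_right_mono) auto
    finally show ?thesis using c(2)[of n] by simp
  qed
  moreover have "real (card (near_orbits (real n))) \<le> B * exp (omega * real n)" for n
  proof -
    have "real (card (near_orbits (real n))) \<le> real (cnt (real n + 1))" using card_near_orbits_le_cnt by simp
    also have "\<dots> \<le> C * exp (omega * (real n + 1))" by (rule C) simp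
    also have "\<dots> = C * exp omega * exp (omega * real n)" by (simp add: distrib_left exp_add)
    also have "\<dots> \<le> B * exp (omega * real n)" using B by (intro mult_right_mono) auto
    finally show ?thesis .
  qed
  ultimately show "comparable (\<lambda>n. real (card (near_orbits (real n)))) (\<lambda>n. exp (omega * real n))"
    unfolding comparable_def using B by blast
next
  assume "comparable (\<lambda>n. real (card (near_orbits (real n)))) (\<lambda>n. exp (omega * real n))"
  then obtain B where B: "1 \<le> B" "\<And>n. exp (omega * real n) / B \<le> real (card (near_orbits (real n)))"
    unfolding comparable_def by blast
  then show "\<not> full_in_boundary p \<mu> (small_horospheric_limit_set G \<phi> H p)"
    by (intro growth_small_not_full[of "1 / B"]) auto
qed

end

theorem theorem1p17:
  fixes G :: "('g, 'm) monoid_scheme" and \<phi> :: "'g \<Rightarrow> 'a::metric_space \<Rightarrow> 'a"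
    and p :: 'a and \<mu> :: "'a bordif measure" and H :: "'g set"
    and R :: real and Z :: "'a set" and W :: "'a set set"
  assumes "proper_metric TYPE('a)" "geodesic_metric TYPE('a)" "gromov_hyperbolic TYPE('a)"
    and "isometric_action G \<phi>" "proper_action G \<phi>" "cocompact_action G \<phi>"
    and "\<not> elementary_group G"
    and "patterson_sullivan G \<phi> p \<mu>"
    and "subgroup H G"
    and "R > 0" "maximal_separated UNIV dist R Z"
        "maximal_separated (quotient_space G \<phi> H) setdist R W"
  shows "(full_in_boundary p \<mu> (small_horospheric_limit_set G \<phi> H p) \<longleftrightarrow>
            full_in_boundary p \<mu> (big_horospheric_limit_set G \<phi> H p)) \<and>
         (full_in_boundary p \<mu> (big_horospheric_limit_set G \<phi> H p) \<longleftrightarrow>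
            quotient_grows_slower G \<phi> H p Z W) \<and>
         (measure \<mu> (small_horospheric_limit_set G \<phi> H p) < 1 \<longleftrightarrow>
            comparable (\<lambda>n. real (quotient_orbit_count G \<phi> H p n))
              (\<lambda>n. exp (growth_rate G \<phi> p * real n)))"
proof -
  obtain \<delta> where \<delta>: "\<forall>q x y z::'a. gromov_product q x z \<ge> min (gromov_product q x y) (gromov_product q y z) - \<delta>"
    using assms(3) unfolding gromov_hyperbolic_def by blast
  obtain K where K: "compact K" "(\<Union>g\<in>carrier G. \<phi> g ` K) = UNIV"
    using assms(6) unfolding cocompact_action_def by blast
  obtain D where D: "\<And>x. x \<in> K \<Longrightarrow> dist p x \<le> D"
    using compact_imp_bounded[OF K(1)] by (auto simp: bounded_any_center[of _ p])
  have dense: "\<exists>g\<in>carrier G. dist x (\<phi> g p) \<le> D" for x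
  proof -
    obtain g k where gk: "g \<in> carrier G" "k \<in> K" "x = \<phi> g k" using K(2) by blast
    then have "dist x (\<phi> g p) = dist k p" using assms(4) by (simp add: isometric_action_def)
    then show ?thesis using gk D[OF gk(2)] by (intro bexI[of _ g]) (auto simp: dist_commute)
  qed
  have "group G"
    using assms(4) by (simp add: isometric_action_def group_action_def group_hom_def)
  then interpret A: hyperbolic_action p \<delta> G \<phi> D
    using \<delta> assms(1,2,4,5) dense
    by (simp add: hyperbolic_action_def hyperbolic_space_def hyperbolic_action_axioms_def)
  have "0 < A.omega" using assms(7) by (rule A.omega_pos)
  then interpret subgroup_action p \<delta> G \<phi> D \<mu> H
    using A.hyperbolic_action_axioms assms(8,9)
    by (simp add: subgroup_action_def subgroup_action_axioms_def patterson_sullivan_action_def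
        patterson_sullivan_action_axioms_def)
  have slow: "quotient_grows_slower G \<phi> H p Z W \<longleftrightarrow> (\<lambda>n. real (card (near_orbits (real n))) / exp (A.omega * real n)) \<longlonglongrightarrow> 0"
    by (rule grows_slower_iff[OF assms(10-12)])
  \<comment> \<open>The three conditions are closed into a cycle: small full, slow growth, big full,
    small full.\<close>
  show ?thesis
    using slow big_full_imp_small_full small_full_imp_big_full small_full_imp_grows_slower
      grows_slower_imp_big_full small_full_iff_measure small_not_full_iff_comparable
    by blast
qed

end
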